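(* A continuous map $f:X\to Y$ of topological spaces is a weak homotopy $2$-equivalence (i.e., it induces bijections on the homotopy groups $\pi_i$ for $i\le2$, at all base points) if and only if the induced double functor $\mathbf\Pi f:\mathbf\Pi X\to\mathbf\Pi Y$ is a weak equivalence.
   Context: **Double groupoids.** A double category consists of sets $O$ (objects), $H$ (horizontal morphisms), $V$ (vertical morphisms), $C$ (squares) with four category structures $(H,O,s^h,t^h,I^h,\circ_h)$, $(V,O,s^v,t^v,I^v,\circ_v)$, $(C,V,s^h,t^h,I^h,\circ_h)$, $(C,H,s^v,t^v,I^v,\circ_v)$ (sources, targets, identities, compositions; $f\circ g$ is defined when source of $f$ = target of $g$), with the usual compatibilities: the horizontal and vertical source, target and identity maps commute with each other, horizontal (vertical) compositions of squares are preserved by the vertical (horizontal) source, target and identity maps, and the interchange law $(\alpha\circ_h\beta)\circ_v(\gamma\circ_h\delta)=(\alpha\circ_v\gamma)\circ_h(\beta\circ_v\delta)$ holds. It is a double groupoid if all four categories are groupoids. Filling condition: for every horizontal $g$ and vertical $u$ with $s^hg=t^vu$ there is a square $\alpha$ with $s^h\alpha=u$, $t^v\alpha=g$. Double functors preserve all the structure. **Homotopy groups** of a double groupoid $\mathcal G$ with filling condition. Objects $a,b$ are connected if there are a horizontal $g$ and a vertical $u$ with $s^hg=t^vu$, $t^hg=b$, $s^vu=a$ (an equivalence relation); $\pi_0\mathcal G$ is the set of classes, $\pi_0(\mathcal G,a)$ is it pointed by $[a]$. $\pi_1(\mathcal G,a)$ is the set of pairs $(g,u)$, $g$ horizontal,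 $u$ vertical, $t^hg=a=s^vu$, $s^hg=t^vu$, modulo $(g,u)\sim(g',u')$ iff there are squares $\alpha,\alpha'$ with $t^h\alpha=t^h\alpha'$, $s^v\alpha=s^v\alpha'$, $s^h\alpha=u$, $t^v\alpha=g$, $s^h\alpha'=u'$, $t^v\alpha'=g'$; the product is $[g_1,u_1]\circ[g_2,u_2]=[g_1\circ_ht^v\gamma,\ s^h\gamma\circ_vu_2]$ for any square $\gamma$ with $s^v\gamma=g_2$, $t^h\gamma=u_1$. $\pi_2(\mathcal G,a)$ is the abelian group of squares $\alpha$ with $s^h\alpha=t^h\alpha=I^va$, $s^v\alpha=t^v\alpha=I^ha$, under $\circ_h=\circ_v$. $\pi_i(\mathcal G,a)=0$ for $i\ge3$. A double functor $F:\mathcal G\to\mathcal G'$ between such double groupoids is a weak equivalence if it induces a bijection on $\pi_0$ and isomorphisms $\pi_i(\mathcal G,a)\cong\pi_i(\mathcal G',Fa)$ for all $i\geq 1$ and objects $a$. **Homotopy double groupoid $\mathbf\Pi X$** of a space $X$, $I=[0,1]$. Objects: paths $u:I\to X$. There is a unique horizontal morphism $u\to u'$ if $u(1)=u'(1)$ and none otherwise; a unique vertical morphism $u\to v$ if $u(0)=v(0)$ and none otherwise. A square with $s^h=(u\to v)$, $t^h=(u'\to v')$, $s^v=(u\to u')$, $t^v=(v\to v')$ is a homotopy class rel $\partial(I^2)$ of maps $\alpha:I^2\to X$ with $\alpha(x,0)=u(x)$, $\alpha(0,y)=v(y)$, $\alpha(1,1-y)=u'(y)$, $\alpha(1-x,1)=v'(x)$.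 Compositions are $[\alpha']\circ_h[\alpha]=[\alpha'\circ_h\alpha]$, $[\beta]\circ_v[\alpha]=[\beta\circ_v\alpha]$ where $(\alpha'\circ_h\alpha)(x,y)$ is $\alpha(2x,x+y)$ if $x\le y,x+y\le1$; $\alpha(x+y,2y)$ if $x\ge y,x+y\le1$; $\alpha'(x+y-1,2y-1)$ if $x\le y,x+y\ge1$; $\alpha'(2x-1,x+y-1)$ if $x\ge y,x+y\ge1$; $(\beta\circ_v\alpha)(x,y)$ is $\alpha(2x-1,1-x+y)$ if $x\ge y,x+y\ge1$; $\alpha(x-y,2y)$ if $x\ge y,x+y\le1$; $\beta(1+x-y,2y-1)$ if $x\le y,x+y\ge1$; $\beta(2x,y-x)$ if $x\le y,x+y\le1$. The identity $I^h(u\to v)$ is the class of $e^h(x,y)=v(y-x)$ for $x\le y$, $u(x-y)$ for $x\ge y$; $I^v(u\to u')$ is the class of $e^v(x,y)=u(x+y)$ for $x+y\le1$, $u'(2-x-y)$ for $x+y\ge1$. $\mathbf\Pi X$ is a double groupoid satisfying the filling condition, functorial in $X$: $\mathbf\Pi f$ is given by composing paths and squares with $f$. *)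

theory Defs
  imports "HOL-Analysis.Analysis" "HOL-Algebra.Group"
begin

section \<open>Weak homotopy 2-equivalences\<close>

definition cube :: "nat \<Rightarrow> (nat \<Rightarrow> real) topology" where
  "cube n = product_topology (\<lambda>_. top_of_set {0..1}) {..<n}"

definition cube_boundary :: "nat \<Rightarrow> (nat \<Rightarrow> real) set" where
  "cube_boundary n = {z \<in> topspace (cube n). \<exists>i<n. z i = 0 \<or> z i = 1}"

definition htpy_class :: "nat \<Rightarrow> 'a topology \<Rightarrow> 'a \<Rightarrow> ((nat \<Rightarrow> real) \<Rightarrow> 'a) \<Rightarrow> ((nat \<Rightarrow> real) \<Rightarrow> 'a) set" where
  "htpy_class n X a p =
     {q. homotopic_with (\<lambda>h. \<forall>z\<in>cube_boundary n. h z = a) (cube n) X p q}"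

text \<open>The underlying set of the \<open>n\<close>-th homotopy group (used for \<open>n \<ge> 1\<close>). Maps on the cube are not
  required to be extensional: functions that agree on the cube are homotopic, hence in the same class.\<close>

definition htpy_group :: "nat \<Rightarrow> 'a topology \<Rightarrow> 'a \<Rightarrow> ((nat \<Rightarrow> real) \<Rightarrow> 'a) set set" where
  "htpy_group n X a =
     {htpy_class n X a p | p. continuous_map (cube n) X p \<and> (\<forall>z\<in>cube_boundary n. p z = a)}"

text \<open>Here and below, a map on a quotient is given, as in \<open>HOL.Equiv_Relations\<close>, by the union of the
  classes of the images of all representatives; this is one class if the map is well defined.\<close>

definition htpy_group_map ::
  "nat \<Rightarrow> 'b topology \<Rightarrow> ('a \<Rightarrow> 'b) \<Rightarrow> 'a \<Rightarrow> ((nat \<Rightarrow> real) \<Rightarrow> 'a) set \<Rightarrow> ((nat \<Rightarrow> real) \<Rightarrow> 'b) set" where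
  "htpy_group_map n Y f a C = (\<Union>p\<in>C. htpy_class n Y (f a) (f \<circ> p))"

text \<open>The condition on \<open>\<pi>\<^sub>0\<close>, the set of path components, is kept apart from the base points: it
  also has to hold when \<open>X\<close> is empty.\<close>

definition weak_homotopy_2_equivalence :: "'a topology \<Rightarrow> 'b topology \<Rightarrow> ('a \<Rightarrow> 'b) \<Rightarrow> bool" where
  "weak_homotopy_2_equivalence X Y f \<longleftrightarrow>
     continuous_map X Y f \<and>
     bij_betw (\<lambda>C. \<Union>x\<in>C. path_component_of_set Y (f x))
       (path_components_of X) (path_components_of Y) \<and>
     (\<forall>a\<in>topspace X. \<forall>n\<in>{1, 2}.
        bij_betw (htpy_group_map n Y f a) (htpy_group n X a) (htpy_group n Y (f a)))"


section \<open>Double groupoids\<close>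

record ('o, 'm) cat =
  Ob :: "'o set"
  Mor :: "'m set"
  Src :: "'m \<Rightarrow> 'o"
  Tgt :: "'m \<Rightarrow> 'o"
  Idn :: "'o \<Rightarrow> 'm"
  Cmp :: "'m \<Rightarrow> 'm \<Rightarrow> 'm"  \<comment> \<open>\<open>Cmp K f g\<close> is meaningful when \<open>Src K f = Tgt K g\<close>\<close>

locale category =
  fixes K :: "('o, 'm) cat"
  assumes src_in: "f \<in> Mor K \<Longrightarrow> Src K f \<in> Ob K"
    and tgt_in: "f \<in> Mor K \<Longrightarrow> Tgt K f \<in> Ob K"
    and idn_in: "a \<in> Ob K \<Longrightarrow> Idn K a \<in> Mor K"
    and src_idn: "a \<in> Ob K \<Longrightarrow> Src K (Idn K a) = a"
    and tgt_idn: "a \<in> Ob K \<Longrightarrow> Tgt K (Idn K a) = a"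
    and cmp_in: "\<lbrakk>f \<in> Mor K; g \<in> Mor K; Src K f = Tgt K g\<rbrakk> \<Longrightarrow> Cmp K f g \<in> Mor K"
    and src_cmp: "\<lbrakk>f \<in> Mor K; g \<in> Mor K; Src K f = Tgt K g\<rbrakk> \<Longrightarrow> Src K (Cmp K f g) = Src K g"
    and tgt_cmp: "\<lbrakk>f \<in> Mor K; g \<in> Mor K; Src K f = Tgt K g\<rbrakk> \<Longrightarrow> Tgt K (Cmp K f g) = Tgt K f"
    and idn_left: "f \<in> Mor K \<Longrightarrow> Cmp K (Idn K (Tgt K f)) f = f"
    and idn_right: "f \<in> Mor K \<Longrightarrow> Cmp K f (Idn K (Src K f)) = f"
    and assoc: "\<lbrakk>f \<in> Mor K; g \<in> Mor K; h \<in> Mor K; Src K f = Tgt K g; Src K g = Tgt K h\<rbrakk>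
      \<Longrightarrow> Cmp K (Cmp K f g) h = Cmp K f (Cmp K g h)"

locale groupoid = category +
  assumes inverse: "f \<in> Mor K \<Longrightarrow>
    \<exists>g\<in>Mor K. Src K g = Tgt K f \<and> Tgt K g = Src K f \<and>
      Cmp K g f = Idn K (Src K f) \<and> Cmp K f g = Idn K (Tgt K f)"

text \<open>The four category structures \<open>(H, O)\<close>, \<open>(V, O)\<close>, \<open>(C, V)\<close> and \<open>(C, H)\<close>: the horizontal category
  \<open>SqH\<close> of squares has the vertical morphisms as objects, and vice versa.\<close>

record ('o, 'h, 'v, 'c) double_cat =
  Hor :: "('o, 'h) cat"
  Ver :: "('o, 'v) cat"
  SqH :: "('v, 'c) cat"
  SqV :: "('h, 'c) cat"

locale double_category =
  fixes D :: "('o, 'h, 'v, 'c) double_cat"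
  assumes cat_Hor: "category (Hor D)" and cat_Ver: "category (Ver D)"
    and cat_SqH: "category (SqH D)" and cat_SqV: "category (SqV D)"
    and Ob_Ver: "Ob (Ver D) = Ob (Hor D)"
    and Ob_SqH: "Ob (SqH D) = Mor (Ver D)"
    and Ob_SqV: "Ob (SqV D) = Mor (Hor D)"
    and Mor_SqV: "Mor (SqV D) = Mor (SqH D)"
    and src_src: "\<alpha> \<in> Mor (SqH D) \<Longrightarrow> Src (Hor D) (Src (SqV D) \<alpha>) = Src (Ver D) (Src (SqH D) \<alpha>)"
    and src_tgt: "\<alpha> \<in> Mor (SqH D) \<Longrightarrow> Src (Hor D) (Tgt (SqV D) \<alpha>) = Tgt (Ver D) (Src (SqH D) \<alpha>)"
    and tgt_src: "\<alpha> \<in> Mor (SqH D) \<Longrightarrow> Tgt (Hor D) (Src (SqV D) \<alpha>) = Src (Ver D) (Tgt (SqH D) \<alpha>)"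
    and tgt_tgt: "\<alpha> \<in> Mor (SqH D) \<Longrightarrow> Tgt (Hor D) (Tgt (SqV D) \<alpha>) = Tgt (Ver D) (Tgt (SqH D) \<alpha>)"
    and src_idn_V: "g \<in> Mor (Hor D) \<Longrightarrow> Src (SqH D) (Idn (SqV D) g) = Idn (Ver D) (Src (Hor D) g)"
    and tgt_idn_V: "g \<in> Mor (Hor D) \<Longrightarrow> Tgt (SqH D) (Idn (SqV D) g) = Idn (Ver D) (Tgt (Hor D) g)"
    and src_idn_H: "u \<in> Mor (Ver D) \<Longrightarrow> Src (SqV D) (Idn (SqH D) u) = Idn (Hor D) (Src (Ver D) u)"
    and tgt_idn_H: "u \<in> Mor (Ver D) \<Longrightarrow> Tgt (SqV D) (Idn (SqH D) u) = Idn (Hor D) (Tgt (Ver D) u)"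
    and idn_idn: "a \<in> Ob (Hor D) \<Longrightarrow> Idn (SqH D) (Idn (Ver D) a) = Idn (SqV D) (Idn (Hor D) a)"
    and src_cmp_H: "\<lbrakk>\<alpha> \<in> Mor (SqH D); \<beta> \<in> Mor (SqH D); Src (SqH D) \<alpha> = Tgt (SqH D) \<beta>\<rbrakk> \<Longrightarrow>
      Src (SqV D) (Cmp (SqH D) \<alpha> \<beta>) = Cmp (Hor D) (Src (SqV D) \<alpha>) (Src (SqV D) \<beta>)"
    and tgt_cmp_H: "\<lbrakk>\<alpha> \<in> Mor (SqH D); \<beta> \<in> Mor (SqH D); Src (SqH D) \<alpha> = Tgt (SqH D) \<beta>\<rbrakk> \<Longrightarrow>
      Tgt (SqV D) (Cmp (SqH D) \<alpha> \<beta>) = Cmp (Hor D) (Tgt (SqV D) \<alpha>) (Tgt (SqV D) \<beta>)"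
    and src_cmp_V: "\<lbrakk>\<alpha> \<in> Mor (SqV D); \<beta> \<in> Mor (SqV D); Src (SqV D) \<alpha> = Tgt (SqV D) \<beta>\<rbrakk> \<Longrightarrow>
      Src (SqH D) (Cmp (SqV D) \<alpha> \<beta>) = Cmp (Ver D) (Src (SqH D) \<alpha>) (Src (SqH D) \<beta>)"
    and tgt_cmp_V: "\<lbrakk>\<alpha> \<in> Mor (SqV D); \<beta> \<in> Mor (SqV D); Src (SqV D) \<alpha> = Tgt (SqV D) \<beta>\<rbrakk> \<Longrightarrow>
      Tgt (SqH D) (Cmp (SqV D) \<alpha> \<beta>) = Cmp (Ver D) (Tgt (SqH D) \<alpha>) (Tgt (SqH D) \<beta>)"
    and idn_cmp_H: "\<lbrakk>f \<in> Mor (Hor D); g \<in> Mor (Hor D); Src (Hor D) f = Tgt (Hor D) g\<rbrakk> \<Longrightarrow>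
      Idn (SqV D) (Cmp (Hor D) f g) = Cmp (SqH D) (Idn (SqV D) f) (Idn (SqV D) g)"
    and idn_cmp_V: "\<lbrakk>u \<in> Mor (Ver D); w \<in> Mor (Ver D); Src (Ver D) u = Tgt (Ver D) w\<rbrakk> \<Longrightarrow>
      Idn (SqH D) (Cmp (Ver D) u w) = Cmp (SqV D) (Idn (SqH D) u) (Idn (SqH D) w)"
    and interchange: "\<lbrakk>\<alpha> \<in> Mor (SqH D); \<beta> \<in> Mor (SqH D); \<gamma> \<in> Mor (SqH D); \<delta> \<in> Mor (SqH D);
        Src (SqH D) \<alpha> = Tgt (SqH D) \<beta>; Src (SqH D) \<gamma> = Tgt (SqH D) \<delta>;
        Src (SqV D) \<alpha> = Tgt (SqV D) \<gamma>; Src (SqV D) \<beta> = Tgt (SqV D) \<delta>\<rbrakk> \<Longrightarrow>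
      Cmp (SqV D) (Cmp (SqH D) \<alpha> \<beta>) (Cmp (SqH D) \<gamma> \<delta>) =
      Cmp (SqH D) (Cmp (SqV D) \<alpha> \<gamma>) (Cmp (SqV D) \<beta> \<delta>)"

locale double_groupoid = double_category +
  assumes groupoids: "groupoid (Hor D)" "groupoid (Ver D)" "groupoid (SqH D)" "groupoid (SqV D)"

definition filling_condition :: "('o, 'h, 'v, 'c) double_cat \<Rightarrow> bool" where
  "filling_condition D \<longleftrightarrow>
     (\<forall>g\<in>Mor (Hor D). \<forall>u\<in>Mor (Ver D). Src (Hor D) g = Tgt (Ver D) u \<longrightarrow>
        (\<exists>\<alpha>\<in>Mor (SqH D). Src (SqH D) \<alpha> = u \<and> Tgt (SqV D) \<alpha> = g))"

definition is_functor ::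
  "('o, 'm) cat \<Rightarrow> ('p, 'n) cat \<Rightarrow> ('o \<Rightarrow> 'p) \<Rightarrow> ('m \<Rightarrow> 'n) \<Rightarrow> bool" where
  "is_functor K L fo fm \<longleftrightarrow>
     (\<forall>a\<in>Ob K. fo a \<in> Ob L \<and> fm (Idn K a) = Idn L (fo a)) \<and>
     (\<forall>f\<in>Mor K. fm f \<in> Mor L \<and> Src L (fm f) = fo (Src K f) \<and> Tgt L (fm f) = fo (Tgt K f)) \<and>
     (\<forall>f\<in>Mor K. \<forall>g\<in>Mor K. Src K f = Tgt K g \<longrightarrow> fm (Cmp K f g) = Cmp L (fm f) (fm g))"

record ('o, 'h, 'v, 'c, 'o1, 'h1, 'v1, 'c1) double_map =
  map_Ob :: "'o \<Rightarrow> 'o1"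
  map_Hor :: "'h \<Rightarrow> 'h1"
  map_Ver :: "'v \<Rightarrow> 'v1"
  map_Sq :: "'c \<Rightarrow> 'c1"

definition double_functor ::
  "('o, 'h, 'v, 'c) double_cat \<Rightarrow> ('o1, 'h1, 'v1, 'c1) double_cat \<Rightarrow>
   ('o, 'h, 'v, 'c, 'o1, 'h1, 'v1, 'c1) double_map \<Rightarrow> bool" where
  "double_functor D E F \<longleftrightarrow>
     is_functor (Hor D) (Hor E) (map_Ob F) (map_Hor F) \<and>
     is_functor (Ver D) (Ver E) (map_Ob F) (map_Ver F) \<and>
     is_functor (SqH D) (SqH E) (map_Ver F) (map_Sq F) \<and>
     is_functor (SqV D) (SqV E) (map_Hor F) (map_Sq F)"


section \<open>Homotopy groups and weak equivalences of double groupoids\<close>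

definition conn_rel :: "('o, 'h, 'v, 'c) double_cat \<Rightarrow> ('o \<times> 'o) set" where
  "conn_rel D = {(a, b). \<exists>g\<in>Mor (Hor D). \<exists>u\<in>Mor (Ver D).
     Src (Hor D) g = Tgt (Ver D) u \<and> Tgt (Hor D) g = b \<and> Src (Ver D) u = a}"

definition pi0 :: "('o, 'h, 'v, 'c) double_cat \<Rightarrow> 'o set set" where
  "pi0 D = Ob (Hor D) // conn_rel D"

definition pi0_map ::
  "('o1, 'h1, 'v1, 'c1) double_cat \<Rightarrow> ('o, 'h, 'v, 'c, 'o1, 'h1, 'v1, 'c1) double_map \<Rightarrow>
   'o set \<Rightarrow> 'o1 set" where
  "pi0_map E F A = (\<Union>a\<in>A. conn_rel E `` {map_Ob F a})"

definition pi1_pairs :: "('o, 'h, 'v, 'c) double_cat \<Rightarrow> 'o \<Rightarrow> ('h \<times> 'v) set" where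
  "pi1_pairs D a = {(g, u). g \<in> Mor (Hor D) \<and> u \<in> Mor (Ver D) \<and>
     Tgt (Hor D) g = a \<and> Src (Ver D) u = a \<and> Src (Hor D) g = Tgt (Ver D) u}"

definition pi1_rel :: "('o, 'h, 'v, 'c) double_cat \<Rightarrow> 'o \<Rightarrow> (('h \<times> 'v) \<times> ('h \<times> 'v)) set" where
  "pi1_rel D a = {((g, u), (g', u')). (g, u) \<in> pi1_pairs D a \<and> (g', u') \<in> pi1_pairs D a \<and>
     (\<exists>\<alpha>\<in>Mor (SqH D). \<exists>\<alpha>'\<in>Mor (SqH D).
        Tgt (SqH D) \<alpha> = Tgt (SqH D) \<alpha>' \<and> Src (SqV D) \<alpha> = Src (SqV D) \<alpha>' \<and>
        Src (SqH D) \<alpha> = u \<and> Tgt (SqV D) \<alpha> = g \<and> Src (SqH D) \<alpha>' = u' \<and> Tgt (SqV D) \<alpha>' = g')}"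

definition pi1 :: "('o, 'h, 'v, 'c) double_cat \<Rightarrow> 'o \<Rightarrow> ('h \<times> 'v) set monoid" where
  "pi1 D a = \<lparr>
     carrier = pi1_pairs D a // pi1_rel D a,
     mult = (\<lambda>A B. \<Union>{pi1_rel D a `` {(Cmp (Hor D) g1 (Tgt (SqV D) \<gamma>), Cmp (Ver D) (Src (SqH D) \<gamma>) u2)}
               | g1 u1 g2 u2 \<gamma>. (g1, u1) \<in> A \<and> (g2, u2) \<in> B \<and> \<gamma> \<in> Mor (SqH D) \<and>
                   Src (SqV D) \<gamma> = g2 \<and> Tgt (SqH D) \<gamma> = u1}),
     one = pi1_rel D a `` {(Idn (Hor D) a, Idn (Ver D) a)}\<rparr>"

definition pi1_map ::
  "('o1, 'h1, 'v1, 'c1) double_cat \<Rightarrow> ('o, 'h, 'v, 'c, 'o1, 'h1, 'v1, 'c1) double_map \<Rightarrow> 'o \<Rightarrow>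
   ('h \<times> 'v) set \<Rightarrow> ('h1 \<times> 'v1) set" where
  "pi1_map E F a A = (\<Union>(g, u)\<in>A. pi1_rel E (map_Ob F a) `` {(map_Hor F g, map_Ver F u)})"

text \<open>By interchange, composing horizontally or vertically gives the same operation on \<open>\<pi>\<^sub>2\<close>.\<close>

definition pi2 :: "('o, 'h, 'v, 'c) double_cat \<Rightarrow> 'o \<Rightarrow> 'c monoid" where
  "pi2 D a = \<lparr>
     carrier = {\<alpha> \<in> Mor (SqH D). Src (SqH D) \<alpha> = Idn (Ver D) a \<and> Tgt (SqH D) \<alpha> = Idn (Ver D) a \<and>
                  Src (SqV D) \<alpha> = Idn (Hor D) a \<and> Tgt (SqV D) \<alpha> = Idn (Hor D) a},
     mult = Cmp (SqH D),
     one = Idn (SqH D) (Idn (Ver D) a)\<rparr>"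

text \<open>The groups \<open>\<pi>\<^sub>i\<close> with \<open>i \<ge> 3\<close> are \<open>0\<close> by definition, so they impose no condition.\<close>

definition weak_equivalence ::
  "('o, 'h, 'v, 'c) double_cat \<Rightarrow> ('o1, 'h1, 'v1, 'c1) double_cat \<Rightarrow>
   ('o, 'h, 'v, 'c, 'o1, 'h1, 'v1, 'c1) double_map \<Rightarrow> bool" where
  "weak_equivalence D E F \<longleftrightarrow>
     double_groupoid D \<and> filling_condition D \<and>
     double_groupoid E \<and> filling_condition E \<and>
     double_functor D E F \<and>
     bij_betw (pi0_map E F) (pi0 D) (pi0 E) \<and>
     (\<forall>a\<in>Ob (Hor D).
        pi1_map E F a \<in> iso (pi1 D a) (pi1 E (map_Ob F a)) \<and>
        map_Sq F \<in> iso (pi2 D a) (pi2 E (map_Ob F a)))"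


section \<open>The homotopy double groupoid of a space\<close>

text \<open>Paths are taken to be extensional, so that equality of objects is equality on \<open>[0, 1]\<close>.\<close>

type_synonym 'a path = "real \<Rightarrow> 'a"

definition paths :: "'a topology \<Rightarrow> 'a path set" where
  "paths X = {u \<in> extensional {0..1}. pathin X u}"

text \<open>A horizontal or vertical morphism, being determined by its ends, is the pair (source, target).\<close>

definition Pi_Hor :: "'a topology \<Rightarrow> ('a path, 'a path \<times> 'a path) cat" where
  "Pi_Hor X = \<lparr>Ob = paths X, Mor = {(u, u'). u \<in> paths X \<and> u' \<in> paths X \<and> u 1 = u' 1},
     Src = fst, Tgt = snd, Idn = (\<lambda>u. (u, u)), Cmp = (\<lambda>f g. (fst g, snd f))\<rparr>"

definition Pi_Ver :: "'a topology \<Rightarrow> ('a path, 'a path \<times> 'a path) cat" where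
  "Pi_Ver X = \<lparr>Ob = paths X, Mor = {(u, v). u \<in> paths X \<and> v \<in> paths X \<and> u 0 = v 0},
     Src = fst, Tgt = snd, Idn = (\<lambda>u. (u, u)), Cmp = (\<lambda>f g. (fst g, snd f))\<rparr>"

type_synonym 'a sqmap = "real \<times> real \<Rightarrow> 'a"

definition unit_sq :: "(real \<times> real) topology" where
  "unit_sq = top_of_set ({0..1} \<times> {0..1})"

definition unit_sq_boundary :: "(real \<times> real) set" where
  "unit_sq_boundary = {(x, y) \<in> {0..1} \<times> {0..1}. x = 0 \<or> x = 1 \<or> y = 0 \<or> y = 1}"

definition sq_class :: "'a topology \<Rightarrow> 'a sqmap \<Rightarrow> 'a sqmap set" where
  "sq_class X \<alpha> = {\<beta>. homotopic_with (\<lambda>h. \<forall>z\<in>unit_sq_boundary. h z = \<alpha> z) unit_sq X \<alpha> \<beta>}"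

definition squares :: "'a topology \<Rightarrow> 'a sqmap set set" where
  "squares X = {sq_class X \<alpha> | \<alpha>. continuous_map unit_sq X \<alpha>}"

definition rep :: "'a sqmap set \<Rightarrow> 'a sqmap" where
  "rep c = (SOME \<alpha>. \<alpha> \<in> c)"

text \<open>The sides of a square map, oriented as objects \<open>u\<close>, \<open>v\<close>, \<open>u'\<close>, \<open>v'\<close> of the square with horizontal
  source \<open>u \<rightarrow> v\<close>, horizontal target \<open>u' \<rightarrow> v'\<close>, vertical source \<open>u \<rightarrow> u'\<close>, vertical target \<open>v \<rightarrow> v'\<close>.
  They depend only on the class of the map.\<close>

definition side_u :: "'a sqmap \<Rightarrow> 'a path" where
  "side_u \<alpha> = (\<lambda>x\<in>{0..1}. \<alpha> (x, 0))"

definition side_v :: "'a sqmap \<Rightarrow> 'a path" where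
  "side_v \<alpha> = (\<lambda>y\<in>{0..1}. \<alpha> (0, y))"

definition side_u' :: "'a sqmap \<Rightarrow> 'a path" where
  "side_u' \<alpha> = (\<lambda>y\<in>{0..1}. \<alpha> (1, 1 - y))"

definition side_v' :: "'a sqmap \<Rightarrow> 'a path" where
  "side_v' \<alpha> = (\<lambda>x\<in>{0..1}. \<alpha> (1 - x, 1))"

definition hcomp :: "'a sqmap \<Rightarrow> 'a sqmap \<Rightarrow> 'a sqmap" where
  "hcomp \<alpha>' \<alpha> = (\<lambda>(x, y).
     if x + y \<le> 1 then (if x \<le> y then \<alpha> (2 * x, x + y) else \<alpha> (x + y, 2 * y))
     else (if x \<le> y then \<alpha>' (x + y - 1, 2 * y - 1) else \<alpha>' (2 * x - 1, x + y - 1)))"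

definition vcomp :: "'a sqmap \<Rightarrow> 'a sqmap \<Rightarrow> 'a sqmap" where
  "vcomp \<beta> \<alpha> = (\<lambda>(x, y).
     if y \<le> x then (if 1 \<le> x + y then \<alpha> (2 * x - 1, 1 - x + y) else \<alpha> (x - y, 2 * y))
     else (if 1 \<le> x + y then \<beta> (1 + x - y, 2 * y - 1) else \<beta> (2 * x, y - x)))"

definition sq_idn_h :: "'a path \<Rightarrow> 'a path \<Rightarrow> 'a sqmap" where
  "sq_idn_h u v = (\<lambda>(x, y). if x \<le> y then v (y - x) else u (x - y))"

definition sq_idn_v :: "'a path \<Rightarrow> 'a path \<Rightarrow> 'a sqmap" where
  "sq_idn_v u u' = (\<lambda>(x, y). if x + y \<le> 1 then u (x + y) else u' (2 - x - y))"

definition Pi_SqH :: "'a topology \<Rightarrow> ('a path \<times> 'a path, 'a sqmap set) cat" where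
  "Pi_SqH X = \<lparr>Ob = Mor (Pi_Ver X), Mor = squares X,
     Src = (\<lambda>c. (side_u (rep c), side_v (rep c))),
     Tgt = (\<lambda>c. (side_u' (rep c), side_v' (rep c))),
     Idn = (\<lambda>(u, v). sq_class X (sq_idn_h u v)),
     Cmp = (\<lambda>c' c. sq_class X (hcomp (rep c') (rep c)))\<rparr>"

definition Pi_SqV :: "'a topology \<Rightarrow> ('a path \<times> 'a path, 'a sqmap set) cat" where
  "Pi_SqV X = \<lparr>Ob = Mor (Pi_Hor X), Mor = squares X,
     Src = (\<lambda>c. (side_u (rep c), side_u' (rep c))),
     Tgt = (\<lambda>c. (side_v (rep c), side_v' (rep c))),
     Idn = (\<lambda>(u, u'). sq_class X (sq_idn_v u u')),
     Cmp = (\<lambda>c' c. sq_class X (vcomp (rep c') (rep c)))\<rparr>"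

definition htpy_double_groupoid ::
  "'a topology \<Rightarrow> ('a path, 'a path \<times> 'a path, 'a path \<times> 'a path, 'a sqmap set) double_cat" where
  "htpy_double_groupoid X = \<lparr>Hor = Pi_Hor X, Ver = Pi_Ver X, SqH = Pi_SqH X, SqV = Pi_SqV X\<rparr>"

definition path_image_map :: "('a \<Rightarrow> 'b) \<Rightarrow> 'a path \<Rightarrow> 'b path" where
  "path_image_map f u = restrict (f \<circ> u) {0..1}"

definition htpy_double_functor ::
  "'b topology \<Rightarrow> ('a \<Rightarrow> 'b) \<Rightarrow>
   ('a path, 'a path \<times> 'a path, 'a path \<times> 'a path, 'a sqmap set,
    'b path, 'b path \<times> 'b path, 'b path \<times> 'b path, 'b sqmap set) double_map" where
  "htpy_double_functor Y f = \<lparr>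
     map_Ob = path_image_map f,
     map_Hor = map_prod (path_image_map f) (path_image_map f),
     map_Ver = map_prod (path_image_map f) (path_image_map f),
     map_Sq = (\<lambda>c. sq_class Y (f \<circ> rep c))\<rparr>"

end

theory Submission
  imports Defs
begin

text \<open>Along the segments \<open>x - y = const\<close> of the unit square, horizontal composition is concatenation of
  paths, and vertical composition is its mirror image under \<open>x \<mapsto> 1 - x\<close>. The groupoid laws are therefore
  reparametrizations, and the square is convex. Only the interchange law and the compatibility of
  identities with composition need homotopies of another kind.

  For a path \<open>a\<close>, the elements of \<open>\<pi>\<^sub>1(\<Pi>X, a)\<close> are the homotopy classes of paths with the ends of
  \<open>a\<close>, so that composition with the inverse of \<open>a\<close> compares them with loops at \<open>a 0\<close>. The group
  \<open>\<pi>\<^sub>2(\<Pi>X, a)\<close> is carried to the one at the constant path at \<open>a 1\<close> by conjugation with an identity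
  square, and there it is the usual second homotopy group. Both changes of base are natural in \<open>X\<close>.\<close>

section \<open>Homotopies of square maps relative to the boundary\<close>

text \<open>No isomorphism between the two kinds of homotopy groups is built. Bijectivity of each
  induced map is rewritten as a condition on representatives, and then only sets of representatives
  and their equivalence relations are matched. The homomorphism property required of a weak
  equivalence holds for every continuous map, so only bijectivity has to be compared.

  The groups of degree 1 and 2 need different means. Horizontal and vertical morphisms are mere
  pairs of paths, so \<open>pi1\<close> depends only on which quadruples of paths bound a square; a
  calculus of existence of squares suffices. For \<open>pi2\<close> the classes of squares
  themselves matter, and the base is moved by algebra valid in any double category. This also
  explains the two base points: horizontal morphisms join paths with a common end, which leads to
  \<open>a 1\<close>, while changing the base of the relation on \<open>pi1\<close> keeps the
  starting point, which leads to \<open>a 0\<close>.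

  Squares are classes with an arbitrarily chosen representative. Everything therefore rests on
  congruence of composition, which works because homotopies are fixed on the boundary and so
  preserve the gluing conditions at each time.\<close>

abbreviation usq :: "(real \<times> real) set" where
  "usq \<equiv> {0..1} \<times> {0..1}"

lemma continuous_map_compose_on:
  assumes "continuous_map (top_of_set C) X p" "continuous_on S \<phi>" "\<And>z. z \<in> S \<Longrightarrow> \<phi> z \<in> C"
  shows "continuous_map (top_of_set S) X (\<lambda>z. p (\<phi> z))"
proof -
  have "continuous_map (top_of_set S) (top_of_set C) \<phi>"
    using assms(2,3) by (auto simp: continuous_map_in_subtopology)
  from continuous_map_compose[OF this assms(1)] show ?thesis
    by (simp only: o_def)
qed

lemma continuous_map_paste:
  fixes p q :: "'z::topological_space \<Rightarrow> real"
  assumes "continuous_on S p" "continuous_on S q"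
    and "continuous_map (top_of_set {z\<in>S. p z \<le> q z}) X f"
    and "continuous_map (top_of_set {z\<in>S. q z \<le> p z}) X g"
    and "\<And>z. z \<in> S \<Longrightarrow> p z = q z \<Longrightarrow> f z = g z"
  shows "continuous_map (top_of_set S) X (\<lambda>z. if p z \<le> q z then f z else g z)"
proof (rule continuous_map_cases_le)
  have *: "subtopology (top_of_set S) {z \<in> topspace (top_of_set S). P z} = top_of_set {z\<in>S. P z}" for P
    by (simp add: subtopology_subtopology Int_def conj_commute cong: conj_cong)
  show "continuous_map (subtopology (top_of_set S) {x \<in> topspace (top_of_set S). p x \<le> q x}) X f"
    "continuous_map (subtopology (top_of_set S) {x \<in> topspace (top_of_set S). q x \<le> p x}) X g"
    unfolding * by fact+
qed (use assms in \<open>auto simp: continuous_map_in_subtopology\<close>)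

lemma unit_sq_boundary_iff:
  "(x, y) \<in> unit_sq_boundary \<longleftrightarrow> (x, y) \<in> usq \<and> (x = 0 \<or> x = 1 \<or> y = 0 \<or> y = 1)"
  by (auto simp: unit_sq_boundary_def)

lemma unit_sq_boundary_subset: "unit_sq_boundary \<subseteq> usq"
  by (auto simp: unit_sq_boundary_def)

text \<open>Only the boundary values of the first map are mentioned; symmetry and transitivity
  therefore go through \<open>sq_homotopic_boundary\<close>.\<close>

definition sq_homotopic :: "'a topology \<Rightarrow> 'a sqmap \<Rightarrow> 'a sqmap \<Rightarrow> bool" where
  "sq_homotopic X \<alpha> \<beta> \<longleftrightarrow>
     homotopic_with (\<lambda>h. \<forall>z\<in>unit_sq_boundary. h z = \<alpha> z) unit_sq X \<alpha> \<beta>"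

lemma sq_homotopic_iff:
  "sq_homotopic X \<alpha> \<beta> \<longleftrightarrow>
     (\<exists>H. continuous_map (top_of_set ({0..1::real} \<times> usq)) X H \<and>
          (\<forall>z\<in>usq. H (0, z) = \<alpha> z) \<and> (\<forall>z\<in>usq. H (1, z) = \<beta> z) \<and>
          (\<forall>t\<in>{0..1}. \<forall>z\<in>unit_sq_boundary. H (t, z) = \<alpha> z))"
  unfolding sq_homotopic_def unit_sq_def
  by (subst homotopic_with)
     (use unit_sq_boundary_subset in \<open>force, simp add: Ball_def del: topspace_euclidean_subtopology\<close>)

lemma sq_homotopicI:
  assumes "continuous_map (top_of_set ({0..1::real} \<times> usq)) X H"
    and "\<And>x y. (x, y) \<in> usq \<Longrightarrow> H (0, x, y) = \<alpha> (x, y)"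
    and "\<And>x y. (x, y) \<in> usq \<Longrightarrow> H (1, x, y) = \<beta> (x, y)"
    and "\<And>t x y. \<lbrakk>t \<in> {0..1}; (x, y) \<in> usq; x = 0 \<or> x = 1 \<or> y = 0 \<or> y = 1\<rbrakk> \<Longrightarrow> H (t, x, y) = \<alpha> (x, y)"
  shows "sq_homotopic X \<alpha> \<beta>"
  unfolding sq_homotopic_iff
proof (rule exI[of _ H], intro conjI ballI)
  fix t :: real and z assume t: "t \<in> {0..1}" and z: "z \<in> unit_sq_boundary"
  obtain x y where "z = (x, y)" by (cases z)
  then show "H (t, z) = \<alpha> z" using assms(4)[of t x y] t z by (auto simp: unit_sq_boundary_def)
qed (use assms in auto)

lemma sq_homotopic_boundary:
  "sq_homotopic X \<alpha> \<beta> \<Longrightarrow> z \<in> unit_sq_boundary \<Longrightarrow> \<beta> z = \<alpha> z"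
  unfolding sq_homotopic_def by (drule homotopic_with_imp_property) simp

lemma sq_homotopic_continuous:
  assumes "sq_homotopic X \<alpha> \<beta>"
  shows "continuous_map unit_sq X \<alpha>" "continuous_map unit_sq X \<beta>"
  using homotopic_with_imp_continuous_maps assms unfolding sq_homotopic_def by blast+

lemma sq_homotopic_refl: "continuous_map unit_sq X \<alpha> \<Longrightarrow> sq_homotopic X \<alpha> \<alpha>"
  by (simp add: sq_homotopic_def)

lemma sq_homotopic_sym:
  assumes "sq_homotopic X \<alpha> \<beta>"
  shows "sq_homotopic X \<beta> \<alpha>"
  unfolding sq_homotopic_def
  by (rule homotopic_with_mono[OF homotopic_with_symD[OF assms[unfolded sq_homotopic_def]]])
     (use sq_homotopic_boundary[OF assms] in auto)

lemma sq_homotopic_trans [trans]: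
  assumes "sq_homotopic X \<alpha> \<beta>" "sq_homotopic X \<beta> \<gamma>"
  shows "sq_homotopic X \<alpha> \<gamma>"
proof -
  have "homotopic_with (\<lambda>h. \<forall>z\<in>unit_sq_boundary. h z = \<alpha> z) unit_sq X \<beta> \<gamma>"
    by (rule homotopic_with_mono[OF assms(2)[unfolded sq_homotopic_def]])
       (use sq_homotopic_boundary[OF assms(1)] in auto)
  then show ?thesis
    using assms(1) unfolding sq_homotopic_def by (rule homotopic_with_trans[rotated])
qed

lemma sq_homotopic_cong:
  assumes "continuous_map unit_sq X \<alpha>" "\<And>x y. (x, y) \<in> usq \<Longrightarrow> \<alpha> (x, y) = \<beta> (x, y)"
  shows "sq_homotopic X \<alpha> \<beta>"
  unfolding sq_homotopic_def
  by (rule homotopic_with_equal) (use assms in \<open>auto simp: unit_sq_def unit_sq_boundary_def\<close>)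

lemma sq_homotopic_compose:
  assumes "sq_homotopic X \<alpha> \<beta>" "continuous_map X Y f"
  shows "sq_homotopic Y (f \<circ> \<alpha>) (f \<circ> \<beta>)"
  using homotopic_with_compose_continuous_map_left[OF assms(1)[unfolded sq_homotopic_def] assms(2)]
  unfolding sq_homotopic_def by auto

text \<open>The straight-line homotopy from \<phi> to \<psi> stays in the convex set, and composing
  it with \<open>p\<close> gives the homotopy. All reparametrization arguments below end
  here.\<close>

lemma sq_homotopic_convex:
  fixes C :: "'z::real_normed_vector set"
  assumes p: "continuous_map (top_of_set C) X p" and C: "convex C"
    and \<phi>: "continuous_on usq \<phi>" "\<And>z. z \<in> usq \<Longrightarrow> \<phi> z \<in> C"
    and \<psi>: "continuous_on usq \<psi>" "\<And>z. z \<in> usq \<Longrightarrow> \<psi> z \<in> C"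
    and bd: "\<And>x y. \<lbrakk>(x, y) \<in> usq; x = 0 \<or> x = 1 \<or> y = 0 \<or> y = 1\<rbrakk> \<Longrightarrow> \<phi> (x, y) = \<psi> (x, y)"
    and "\<And>x y. (x, y) \<in> usq \<Longrightarrow> \<alpha> (x, y) = p (\<phi> (x, y))"
    and "\<And>x y. (x, y) \<in> usq \<Longrightarrow> \<beta> (x, y) = p (\<psi> (x, y))"
  shows "sq_homotopic X \<alpha> \<beta>"
proof (rule sq_homotopicI)
  let ?H = "\<lambda>z. (1 - fst z) *\<^sub>R \<phi> (snd z) + fst z *\<^sub>R \<psi> (snd z)"
  show "continuous_map (top_of_set ({0..1} \<times> usq)) X (\<lambda>z. p (?H z))"
  proof (rule continuous_map_compose_on[OF p])
    show "continuous_on ({0..1} \<times> usq) ?H"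
      by (intro continuous_intros continuous_on_compose2[OF \<phi>(1)] continuous_on_compose2[OF \<psi>(1)]) auto
    show "?H z \<in> C" if "z \<in> {0..1} \<times> usq" for z
      using that \<phi>(2) \<psi>(2) by (auto intro!: convexD[OF C])
  qed
  fix t x y :: real assume "t \<in> {0..1}" "(x, y) \<in> usq" "x = 0 \<or> x = 1 \<or> y = 0 \<or> y = 1"
  then show "p (?H (t, x, y)) = \<alpha> (x, y)"
    using bd[of x y] assms(8)[of x y] by (simp flip: scaleR_add_left)
qed (use assms in auto)


subsection \<open>Diagonal coordinates\<close>

text \<open>A point \<open>(b\<^sub>1 + r, b\<^sub>2 + r)\<close> with \<open>min b\<^sub>1 b\<^sub>2 = 0\<close> of the unit square lies at position \<open>r\<close> on the
  diagonal segment of length \<open>L = 1 - b\<^sub>1 - b\<^sub>2\<close> that starts at \<open>(b\<^sub>1, b\<^sub>2)\<close>. Horizontal composition is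
  concatenation along these segments.\<close>

definition diag_map :: "(real \<Rightarrow> real \<Rightarrow> real) \<Rightarrow> real \<times> real \<Rightarrow> real \<times> real" where
  "diag_map \<tau> = (\<lambda>(x, y). let r = min x y; s = \<tau> r (1 - \<bar>x - y\<bar>) in (x - r + s, y - r + s))"

lemma diag_cases:
  assumes "(x, y) \<in> usq"
  obtains b1 b2 r where "x = b1 + r" "y = b2 + r" "b1 = 0 \<or> b2 = 0" "b1 \<ge> 0" "b2 \<ge> 0"
    "0 \<le> r" "r \<le> 1 - b1 - b2"
proof
  show "x = (x - min x y) + min x y" "y = (y - min x y) + min x y" by auto
qed (use assms in auto)

lemma diag_map_diag:
  assumes "b1 = 0 \<or> b2 = 0" "b1 \<ge> 0" "b2 \<ge> 0"
  shows "diag_map \<tau> (b1 + r, b2 + r) = (b1 + \<tau> r (1 - b1 - b2), b2 + \<tau> r (1 - b1 - b2))"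
  using assms by (auto simp: diag_map_def Let_def min_def algebra_simps)

lemma hcomp_diag:
  assumes "b1 = 0 \<or> b2 = 0" "b1 \<ge> 0" "b2 \<ge> 0"
  shows "hcomp \<alpha>' \<alpha> (b1 + r, b2 + r) =
    (if 2 * r \<le> 1 - b1 - b2 then \<alpha> (b1 + 2 * r, b2 + 2 * r)
     else \<alpha>' (b1 + (2 * r - (1 - b1 - b2)), b2 + (2 * r - (1 - b1 - b2))))"
  using assms by (auto simp: hcomp_def algebra_simps)

lemma diag_in_usq:
  assumes "b1 = 0 \<or> b2 = 0" "b1 \<ge> 0" "b2 \<ge> 0" "0 \<le> r" "r \<le> 1 - b1 - b2"
  shows "(b1 + r, b2 + r) \<in> usq"
  using assms by auto

text \<open>Moving along the diagonals is a convex motion of the unit square. Its boundary consists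
  exactly of the two ends r = 0 and r = L of the diagonals, so \<tau> and \<sigma> have to agree
  only there.\<close>

lemma sq_homotopic_diag_map:
  assumes p: "continuous_map unit_sq X p"
    and \<tau>: "continuous_on UNIV (\<lambda>(r, L). \<tau> r L)" "\<And>r L. 0 \<le> r \<Longrightarrow> r \<le> L \<Longrightarrow> 0 \<le> \<tau> r L \<and> \<tau> r L \<le> L"
    and \<sigma>: "continuous_on UNIV (\<lambda>(r, L). \<sigma> r L)" "\<And>r L. 0 \<le> r \<Longrightarrow> r \<le> L \<Longrightarrow> 0 \<le> \<sigma> r L \<and> \<sigma> r L \<le> L"
    and bd: "\<And>L. 0 \<le> L \<Longrightarrow> \<tau> 0 L = \<sigma> 0 L \<and> \<tau> L L = \<sigma> L L"
    and \<alpha>: "\<And>b1 b2 r. \<lbrakk>b1 = 0 \<or> b2 = 0; b1 \<ge> 0; b2 \<ge> 0; 0 \<le> r; r \<le> 1 - b1 - b2\<rbrakk> \<Longrightarrow>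
      \<alpha> (b1 + r, b2 + r) = p (b1 + \<tau> r (1 - b1 - b2), b2 + \<tau> r (1 - b1 - b2))"
    and \<beta>: "\<And>b1 b2 r. \<lbrakk>b1 = 0 \<or> b2 = 0; b1 \<ge> 0; b2 \<ge> 0; 0 \<le> r; r \<le> 1 - b1 - b2\<rbrakk> \<Longrightarrow>
      \<beta> (b1 + r, b2 + r) = p (b1 + \<sigma> r (1 - b1 - b2), b2 + \<sigma> r (1 - b1 - b2))"
  shows "sq_homotopic X \<alpha> \<beta>"
proof (rule sq_homotopic_convex[where \<phi> = "diag_map \<tau>" and \<psi> = "diag_map \<sigma>"])
  have *: "continuous_on usq (diag_map \<tau>)" if "continuous_on UNIV (\<lambda>(r, L). \<tau> r L)" for \<tau> :: "real \<Rightarrow> real \<Rightarrow> real"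
  proof -
    have "continuous_on usq (\<lambda>z. (\<lambda>(r, L). \<tau> r L) (min (fst z) (snd z), 1 - \<bar>fst z - snd z\<bar>))"
      by (intro continuous_on_compose2[OF that] continuous_intros) auto
    then show ?thesis
      unfolding diag_map_def Let_def case_prod_unfold by (auto intro!: continuous_intros)
  qed
  show "continuous_on usq (diag_map \<tau>)" "continuous_on usq (diag_map \<sigma>)" using * \<tau> \<sigma> by auto
  have in_usq: "diag_map \<tau> z \<in> usq" if "\<And>r L. 0 \<le> r \<Longrightarrow> r \<le> L \<Longrightarrow> 0 \<le> \<tau> r L \<and> \<tau> r L \<le> L" "z \<in> usq" for \<tau> z
  proof -
    obtain x y where z: "z = (x, y)" by (cases z)
    with \<open>z \<in> usq\<close> have "(x, y) \<in> usq" by simp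
    then show ?thesis
    proof (cases rule: diag_cases)
      case (1 b1 b2 r)
      show ?thesis
        unfolding z 1(1,2) diag_map_diag[OF 1(3-5)]
        by (rule diag_in_usq) (use 1 that(1)[of r "1 - b1 - b2"] in auto)
    qed
  qed
  show "diag_map \<tau> z \<in> usq" "diag_map \<sigma> z \<in> usq" if "z \<in> usq" for z
    using in_usq[OF \<tau>(2) that] in_usq[OF \<sigma>(2) that] by auto
  show "diag_map \<tau> (x, y) = diag_map \<sigma> (x, y)"
    if "(x, y) \<in> usq" "x = 0 \<or> x = 1 \<or> y = 0 \<or> y = 1" for x y
    using that(1)
  proof (cases rule: diag_cases)
    case (1 b1 b2 r)
    then have "r = 0 \<or> r = 1 - b1 - b2" using that(2) by auto
    then show ?thesis
      unfolding 1(1,2) diag_map_diag[OF 1(3-5)] using 1 bd[of "1 - b1 - b2"] by auto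
  qed
  show "\<alpha> (x, y) = p (diag_map \<tau> (x, y))" "\<beta> (x, y) = p (diag_map \<sigma> (x, y))" if "(x, y) \<in> usq" for x y
    using that
    by (cases rule: diag_cases; simp only: diag_map_diag \<alpha> \<beta>)+
qed (use p in \<open>auto simp: unit_sq_def convex_Times\<close>)

subsection \<open>The horizontal groupoid laws\<close>

text \<open>Pointwise on the unit interval, as gluing requires it; \<open>hcompat_iff\<close> turns
  it into equality of the horizontal source of \<beta> and the horizontal target of
  \<alpha>.\<close>

definition hcompat :: "'a sqmap \<Rightarrow> 'a sqmap \<Rightarrow> bool" where
  "hcompat \<beta> \<alpha> \<longleftrightarrow> (\<forall>t\<in>{0..1}. \<beta> (t, 0) = \<alpha> (1, 1 - t) \<and> \<beta> (0, t) = \<alpha> (1 - t, 1))"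

lemma hcompatD:
  assumes "hcompat \<beta> \<alpha>" "0 \<le> t" "t \<le> 1"
  shows "\<beta> (t, 0) = \<alpha> (1, 1 - t)" "\<beta> (0, t) = \<alpha> (1 - t, 1)"
  using assms by (auto simp: hcompat_def)

lemma restrict_eq_iff: "restrict f A = restrict g A \<longleftrightarrow> (\<forall>x\<in>A. f x = g x)"
  by (metis restrict_apply' restrict_ext)

lemma hcompat_iff: "hcompat \<beta> \<alpha> \<longleftrightarrow> side_u \<beta> = side_u' \<alpha> \<and> side_v \<beta> = side_v' \<alpha>"
  by (auto simp: hcompat_def side_u_def side_u'_def side_v_def side_v'_def restrict_eq_iff)

text \<open>With \<open>min\<close> and \<open>max\<close> the pieces on the two sides of x = y
  merge, and the antidiagonal x + y = 1 remains as the only seam.\<close>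

lemma hcomp_min_max:
  "hcomp \<beta> \<alpha> = (\<lambda>(x, y). if x + y \<le> 1 then \<alpha> (x + min x y, y + min x y)
     else \<beta> (x + max x y - 1, y + max x y - 1))"
  by (auto simp: hcomp_def fun_eq_iff algebra_simps)

lemma hcomp_boundary:
  assumes "hcompat \<beta> \<alpha>" "0 \<le> t" "t \<le> 1"
  shows "hcomp \<beta> \<alpha> (t, 0) = \<alpha> (t, 0)" "hcomp \<beta> \<alpha> (0, t) = \<alpha> (0, t)"
    "hcomp \<beta> \<alpha> (1, t) = \<beta> (1, t)" "hcomp \<beta> \<alpha> (t, 1) = \<beta> (t, 1)"
  using assms hcompatD[OF assms(1), of 1] by (auto simp: hcomp_def)

lemma sq_homotopic_boundaryD:
  assumes "sq_homotopic X \<alpha> \<beta>" "0 \<le> t" "t \<le> 1"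
  shows "\<beta> (t, 0) = \<alpha> (t, 0)" "\<beta> (0, t) = \<alpha> (0, t)" "\<beta> (1, t) = \<alpha> (1, t)" "\<beta> (t, 1) = \<alpha> (t, 1)"
  using sq_homotopic_boundary[OF assms(1)] assms(2,3) by (auto simp: unit_sq_boundary_def)

text \<open>The two homotopies are composed at each time. Being fixed on the boundary, they stay
  compatible throughout.\<close>

lemma hcomp_cong:
  assumes \<alpha>: "sq_homotopic X \<alpha> \<alpha>'" and \<beta>: "sq_homotopic X \<beta> \<beta>'" and c: "hcompat \<beta> \<alpha>"
  shows "sq_homotopic X (hcomp \<beta> \<alpha>) (hcomp \<beta>' \<alpha>')"
proof -
  obtain F where F: "continuous_map (top_of_set ({0..1::real} \<times> usq)) X F"
    "\<And>z. z\<in>usq \<Longrightarrow> F (0, z) = \<alpha> z" "\<And>z. z\<in>usq \<Longrightarrow> F (1, z) = \<alpha>' z"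
    "\<And>t z. t\<in>{0..1} \<Longrightarrow> z\<in>unit_sq_boundary \<Longrightarrow> F (t, z) = \<alpha> z"
    using \<alpha> unfolding sq_homotopic_iff by metis
  obtain G where G: "continuous_map (top_of_set ({0..1::real} \<times> usq)) X G"
    "\<And>z. z\<in>usq \<Longrightarrow> G (0, z) = \<beta> z" "\<And>z. z\<in>usq \<Longrightarrow> G (1, z) = \<beta>' z"
    "\<And>t z. t\<in>{0..1} \<Longrightarrow> z\<in>unit_sq_boundary \<Longrightarrow> G (t, z) = \<beta> z"
    using \<beta> unfolding sq_homotopic_iff by metis
  define H where "H = (\<lambda>z. if fst (snd z) + snd (snd z) \<le> 1
    then F (fst z, fst (snd z) + min (fst (snd z)) (snd (snd z)), snd (snd z) + min (fst (snd z)) (snd (snd z)))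
    else G (fst z, fst (snd z) + max (fst (snd z)) (snd (snd z)) - 1,
      snd (snd z) + max (fst (snd z)) (snd (snd z)) - 1))"
  have H: "H (t, z) = hcomp (\<lambda>z. G (t, z)) (\<lambda>z. F (t, z)) z" for t z
    by (simp add: H_def hcomp_min_max case_prod_unfold)
  have compat: "hcompat (\<lambda>z. G (t, z)) (\<lambda>z. F (t, z))" if "t \<in> {0..1}" for t
    unfolding hcompat_def
    using hcompatD[OF c] by (auto simp: F(4)[OF that] G(4)[OF that] unit_sq_boundary_def)
  show ?thesis
  proof (rule sq_homotopicI)
    show "continuous_map (top_of_set ({0..1} \<times> usq)) X H"
      unfolding H_def
    proof (rule continuous_map_paste, goal_cases)
      case 3
      show ?case
        by (rule continuous_map_compose_on[OF F(1)], intro continuous_intros, auto simp: min_def)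
    next
      case 4
      show ?case
        by (rule continuous_map_compose_on[OF G(1)], intro continuous_intros, auto simp: max_def)
    next
      \<comment> \<open>On the seam the point lies on the side y = 1 of the first square and x = 0
        of the second if x \<le> 1/2, and on the sides x = 1 and y = 0 otherwise. This accounts for
        the two instances of compatibility.\<close>
      case (5 z)
      obtain t x y where "z = (t, x, y)" by (cases z) auto
      with 5 have z: "z = (t, x, 1 - x)" by simp
      show ?case
        using 5 hcompatD(1)[OF compat, of t "2 * x - 1"] hcompatD(2)[OF compat, of t "1 - 2 * x"]
        by (cases "x \<le> 1 - x") (simp_all add: z min_def max_def)
    qed (intro continuous_intros)+
  next
    fix x y assume *: "(x, y) \<in> usq"
    show "H (0, x, y) = hcomp \<beta> \<alpha> (x, y)" "H (1, x, y) = hcomp \<beta>' \<alpha>' (x, y)"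
      using * by (auto simp: H_def hcomp_min_max F(2,3) G(2,3) min_def max_def)
    fix t :: real assume t: "t \<in> {0..1}" and bd: "x = 0 \<or> x = 1 \<or> y = 0 \<or> y = 1"
    show "H (t, x, y) = hcomp \<beta> \<alpha> (x, y)"
      using * bd
      by (auto simp: H hcomp_boundary[OF compat[OF t]] hcomp_boundary[OF c]
          F(4)[OF t] G(4)[OF t] unit_sq_boundary_def)
  qed
qed

text \<open>The gluing argument is already contained in the congruence lemma, applied here to
  constant homotopies.\<close>

lemma hcomp_continuous:
  assumes "continuous_map unit_sq X \<alpha>" "continuous_map unit_sq X \<beta>" "hcompat \<beta> \<alpha>"
  shows "continuous_map unit_sq X (hcomp \<beta> \<alpha>)"
  using hcomp_cong[OF sq_homotopic_refl sq_homotopic_refl] assms sq_homotopic_continuous by blast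

lemma hcomp_diag_lower:
  assumes "b1 = 0 \<or> b2 = 0" "b1 \<ge> 0" "b2 \<ge> 0" "2 * r \<le> 1 - b1 - b2"
  shows "hcomp \<beta> \<alpha> (b1 + r, b2 + r) = \<alpha> (b1 + 2 * r, b2 + 2 * r)"
  using assms(4) by (simp add: hcomp_diag[OF assms(1-3)])

lemma hcomp_diag_upper:
  assumes "b1 = 0 \<or> b2 = 0" "b1 \<ge> 0" "b2 \<ge> 0" "L = 1 - b1 - b2" "L < 2 * r"
  shows "hcomp \<beta> \<alpha> (b1 + r, b2 + r) = \<beta> (b1 + (2 * r - L), b2 + (2 * r - L))"
  using assms(4,5) by (simp add: hcomp_diag[OF assms(1-3)])

lemma hcomp_assoc:
  assumes "continuous_map unit_sq X \<alpha>" "continuous_map unit_sq X \<beta>" "continuous_map unit_sq X \<gamma>"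
    and c: "hcompat \<alpha> \<beta>" "hcompat \<beta> \<gamma>"
  shows "sq_homotopic X (hcomp (hcomp \<alpha> \<beta>) \<gamma>) (hcomp \<alpha> (hcomp \<beta> \<gamma>))"
proof -
  have c': "hcompat (hcomp \<alpha> \<beta>) \<gamma>"
    using c by (auto simp: hcompat_def hcomp_boundary[OF c(1)])
  show ?thesis
  \<comment> \<open>The usual reparametrization for associativity of paths, on a segment of length
    L: the breaks L/4 and L/2 go to L/2 and 3L/4. The slopes 2, 1, 1/2 decrease, so the function is
    a minimum of three affine ones.\<close>
  proof (rule sq_homotopic_diag_map[where \<tau> = "\<lambda>r L. r"
        and \<sigma> = "\<lambda>r L. min (2 * r) (min (r + L / 4) ((r + L) / 2))"
        and p = "hcomp (hcomp \<alpha> \<beta>) \<gamma>"], goal_cases)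
    case 1
    show ?case by (intro hcomp_continuous assms c')
  next
    case 2
    show ?case unfolding case_prod_unfold by (intro continuous_intros)
  next
    case 4
    show ?case unfolding case_prod_unfold by (intro continuous_intros) auto
  next
    case (8 b1 b2 r)
    define L where L: "L = 1 - b1 - b2"
    define m where "m = min (2 * r) (min (r + L / 4) ((r + L) / 2))"
    have "hcomp (hcomp \<alpha> \<beta>) \<gamma> (b1 + m, b2 + m) = hcomp \<alpha> (hcomp \<beta> \<gamma>) (b1 + r, b2 + r)"
    proof (cases "2 * r \<le> L")
      case lower: True
      have *: "hcomp \<alpha> (hcomp \<beta> \<gamma>) (b1 + r, b2 + r) = hcomp \<beta> \<gamma> (b1 + 2 * r, b2 + 2 * r)"
        by (rule hcomp_diag_lower) (use 8 lower L in auto)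
      show ?thesis
      proof (cases "4 * r \<le> L")
        case True
        then have "m = 2 * r" using 8 by (simp add: m_def min_def)
        then show ?thesis
          using 8 True L * hcomp_diag_lower[of b1 b2 "2 * r" "hcomp \<alpha> \<beta>" \<gamma>]
            hcomp_diag_lower[of b1 b2 "2 * r" \<beta> \<gamma>] by simp
      next
        case False
        then have m: "m = r + L / 4"
          using 8 lower unfolding m_def min_def by (auto simp: field_simps)
        have "hcomp \<beta> \<gamma> (b1 + 2 * r, b2 + 2 * r) = \<beta> (b1 + (2 * (2 * r) - L), b2 + (2 * (2 * r) - L))"
          by (rule hcomp_diag_upper[OF 8(1-3) L]) (use False 8 L in linarith)
        moreover have "hcomp (hcomp \<alpha> \<beta>) \<gamma> (b1 + m, b2 + m)
            = hcomp \<alpha> \<beta> (b1 + (2 * m - L), b2 + (2 * m - L))"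
          by (rule hcomp_diag_upper[OF 8(1-3) L]) (use False 8 L m in linarith)
        moreover have "\<dots> = \<beta> (b1 + 2 * (2 * m - L), b2 + 2 * (2 * m - L))"
          by (rule hcomp_diag_lower[OF 8(1-3)]) (use lower in \<open>simp add: m flip: L\<close>)
        moreover have "2 * (2 * m - L) = 2 * (2 * r) - L" using m by simp
        ultimately show ?thesis using * by simp
      qed
    next
      case upper: False
      then have m: "m = (r + L) / 2"
        using 8 unfolding m_def min_def by (auto simp: field_simps)
      have "hcomp \<alpha> (hcomp \<beta> \<gamma>) (b1 + r, b2 + r) = \<alpha> (b1 + (2 * r - L), b2 + (2 * r - L))"
        by (rule hcomp_diag_upper[OF 8(1-3) L]) (use upper 8 L in linarith)
      moreover have "hcomp (hcomp \<alpha> \<beta>) \<gamma> (b1 + m, b2 + m)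
          = hcomp \<alpha> \<beta> (b1 + (2 * m - L), b2 + (2 * m - L))"
        by (rule hcomp_diag_upper[OF 8(1-3) L]) (use upper 8 m L in \<open>auto simp: field_simps\<close>)
      moreover have "\<dots> = \<alpha> (b1 + (2 * (2 * m - L) - L), b2 + (2 * (2 * m - L) - L))"
        by (rule hcomp_diag_upper[OF 8(1-3) L]) (use upper 8 m L in \<open>auto simp: field_simps\<close>)
      moreover have "2 * (2 * m - L) - L = 2 * r - L" using m by simp
      ultimately show ?thesis by simp
    qed
    then show ?case by (simp add: m_def L)
  qed (auto simp: min_def)
qed

text \<open>The value does not depend on \<open>r\<close>: an identity is constant on each diagonal.
  Hence the unit and inverse laws are reparametrizations of \<alpha> alone.\<close>

lemma sq_idn_h_diag:
  assumes "b1 = 0 \<or> b2 = 0" "b1 \<ge> 0" "b2 \<ge> 0" "u 0 = v 0"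
  shows "sq_idn_h u v (b1 + r, b2 + r) = (if b1 = 0 then v b2 else u b1)"
  using assms by (auto simp: sq_idn_h_def)

lemma sq_idn_h_continuous:
  assumes "pathin X u" "pathin X v" "u 0 = v 0"
  shows "continuous_map unit_sq X (sq_idn_h u v)"
  unfolding sq_idn_h_def unit_sq_def case_prod_unfold
proof (rule continuous_map_paste, goal_cases)
  case 3
  show ?case
    by (rule continuous_map_compose_on[OF assms(2)[unfolded pathin_def]]) (auto intro!: continuous_intros)
next
  case 4
  show ?case
    by (rule continuous_map_compose_on[OF assms(1)[unfolded pathin_def]]) (auto intro!: continuous_intros)
qed (use assms(3) in \<open>auto intro!: continuous_intros\<close>)

text \<open>Each diagonal waits at its start for the first half and is then run at double
  speed.\<close>

lemma hcomp_idn_right: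
  assumes "continuous_map unit_sq X \<alpha>"
  shows "sq_homotopic X (hcomp \<alpha> (sq_idn_h (side_u \<alpha>) (side_v \<alpha>))) \<alpha>"
proof (rule sq_homotopic_diag_map[where \<tau> = "\<lambda>r L. max 0 (2 * r - L)" and \<sigma> = "\<lambda>r L. r" and p = \<alpha>], goal_cases)
  case 2
  show ?case unfolding case_prod_unfold by (intro continuous_intros)
next
  case 4
  show ?case unfolding case_prod_unfold by (intro continuous_intros)
next
  case (7 b1 b2 r)
  then have "sq_idn_h (side_u \<alpha>) (side_v \<alpha>) (b1 + 2 * r, b2 + 2 * r) = \<alpha> (b1, b2)"
    by (subst sq_idn_h_diag) (auto simp: side_u_def side_v_def)
  with 7 show ?case by (simp add: hcomp_diag max_def)
qed (use assms in auto)

lemma hcomp_idn_left: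
  assumes "continuous_map unit_sq X \<alpha>"
  shows "sq_homotopic X (hcomp (sq_idn_h (side_u' \<alpha>) (side_v' \<alpha>)) \<alpha>) \<alpha>"
proof (rule sq_homotopic_diag_map[where \<tau> = "\<lambda>r L. min L (2 * r)" and \<sigma> = "\<lambda>r L. r" and p = \<alpha>], goal_cases)
  case 2
  show ?case unfolding case_prod_unfold by (intro continuous_intros)
next
  case 4
  show ?case unfolding case_prod_unfold by (intro continuous_intros)
next
  case (7 b1 b2 r)
  have "sq_idn_h (side_u' \<alpha>) (side_v' \<alpha>) (b1 + s, b2 + s)
      = \<alpha> (b1 + (1 - b1 - b2), b2 + (1 - b1 - b2))" for s
    using 7 by (subst sq_idn_h_diag) (auto simp: side_u'_def side_v'_def)
  from this[of "2 * r - (1 - b1 - b2)"] 7 show ?case by (simp add: hcomp_diag min_def)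
qed (use assms in auto)

text \<open>Reflection in the antidiagonal; it reverses each diagonal segment.\<close>

definition hinv :: "'a sqmap \<Rightarrow> 'a sqmap" where
  "hinv \<alpha> = (\<lambda>(x, y). \<alpha> (1 - y, 1 - x))"

lemma hinv_continuous:
  "continuous_map unit_sq X \<alpha> \<Longrightarrow> continuous_map unit_sq X (hinv \<alpha>)"
  unfolding hinv_def unit_sq_def case_prod_unfold
  by (erule continuous_map_compose_on) (auto intro!: continuous_intros)

lemma hinv_diag:
  assumes "b1 = 0 \<or> b2 = 0"
  shows "hinv \<alpha> (b1 + r, b2 + r) = \<alpha> (b1 + (1 - b1 - b2 - r), b2 + (1 - b1 - b2 - r))"
  using assms by (auto simp: hinv_def algebra_simps)

text \<open>Each diagonal is run out and back, and contracts to its starting point. In the other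
  order, below, it starts and ends at L, turns at 0, and contracts to L.\<close>

lemma hcomp_hinv_left:
  assumes "continuous_map unit_sq X \<alpha>"
  shows "sq_homotopic X (hcomp (hinv \<alpha>) \<alpha>) (sq_idn_h (side_u \<alpha>) (side_v \<alpha>))"
proof (rule sq_homotopic_diag_map[where \<tau> = "\<lambda>r L. min (2 * r) (2 * L - 2 * r)" and \<sigma> = "\<lambda>r L. 0" and p = \<alpha>], goal_cases)
  case 2
  show ?case unfolding case_prod_unfold by (intro continuous_intros)
next
  case 4
  show ?case unfolding case_prod_unfold by (intro continuous_intros)
next
  case (7 b1 b2 r)
  define L where "L = 1 - b1 - b2"
  show ?case using 7 by (simp add: hcomp_diag hinv_diag min_def flip: L_def)
next
  case (8 b1 b2 r)
  then show ?case
    by (subst sq_idn_h_diag) (auto simp: side_u_def side_v_def)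
qed (use assms in \<open>auto simp: min_def\<close>)

lemma hcomp_hinv_right:
  assumes "continuous_map unit_sq X \<alpha>"
  shows "sq_homotopic X (hcomp \<alpha> (hinv \<alpha>)) (sq_idn_h (side_u' \<alpha>) (side_v' \<alpha>))"
proof (rule sq_homotopic_diag_map[where \<tau> = "\<lambda>r L. max (2 * r - L) (L - 2 * r)" and \<sigma> = "\<lambda>r L. L" and p = \<alpha>], goal_cases)
  case 2
  show ?case unfolding case_prod_unfold by (intro continuous_intros)
next
  case 4
  show ?case unfolding case_prod_unfold by (intro continuous_intros)
next
  case (7 b1 b2 r)
  define L where "L = 1 - b1 - b2"
  show ?case using 7 by (simp add: hcomp_diag hinv_diag max_def flip: L_def)
next
  case (8 b1 b2 r)
  then show ?case
    by (subst sq_idn_h_diag) (auto simp: side_u'_def side_v'_def)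
qed (use assms in \<open>auto simp: max_def\<close>)

subsection \<open>Reflection and the vertical groupoid laws\<close>

text \<open>No restriction is imposed: t \<mapsto> 1 - t preserves the unit interval and its
  complement, so extensional paths stay extensional, reversal is a strict involution, and
  \<open>side_reflect\<close> consists of equations between functions.\<close>

definition rev_path :: "'a path \<Rightarrow> 'a path" where
  "rev_path u = (\<lambda>t. u (1 - t))"

definition reflect :: "'a sqmap \<Rightarrow> 'a sqmap" where
  "reflect \<alpha> = (\<lambda>(x, y). \<alpha> (1 - x, y))"

lemma rev_path_simps [simp]: "rev_path u 0 = u 1" "rev_path u 1 = u 0" "rev_path (rev_path u) = u"
  by (simp_all add: rev_path_def)

lemma reflect_reflect [simp]: "reflect (reflect \<alpha>) = \<alpha>"
  by (simp add: reflect_def)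

lemma pathin_rev_path: "pathin X u \<Longrightarrow> pathin X (rev_path u)"
  unfolding pathin_def rev_path_def
  by (erule continuous_map_compose_on) (auto intro!: continuous_intros)

lemma reflect_continuous:
  "continuous_map unit_sq X \<alpha> \<Longrightarrow> continuous_map unit_sq X (reflect \<alpha>)"
  unfolding reflect_def unit_sq_def case_prod_unfold
  by (erule continuous_map_compose_on) (auto intro!: continuous_intros)

lemma sq_homotopic_reflect:
  assumes "sq_homotopic X \<alpha> \<beta>"
  shows "sq_homotopic X (reflect \<alpha>) (reflect \<beta>)"
proof -
  obtain H where H: "continuous_map (top_of_set ({0..1::real} \<times> usq)) X H"
    "\<And>z. z\<in>usq \<Longrightarrow> H (0, z) = \<alpha> z" "\<And>z. z\<in>usq \<Longrightarrow> H (1, z) = \<beta> z"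
    "\<And>t z. t\<in>{0..1} \<Longrightarrow> z\<in>unit_sq_boundary \<Longrightarrow> H (t, z) = \<alpha> z"
    using assms unfolding sq_homotopic_iff by metis
  show ?thesis
  proof (rule sq_homotopicI)
    show "continuous_map (top_of_set ({0..1} \<times> usq)) X (\<lambda>z. H (fst z, 1 - fst (snd z), snd (snd z)))"
      by (rule continuous_map_compose_on[OF H(1)]) (auto intro!: continuous_intros)
  qed (auto simp: H reflect_def unit_sq_boundary_def)
qed

lemma vcomp_reflect: "vcomp \<beta> \<alpha> = reflect (hcomp (reflect \<beta>) (reflect \<alpha>))"
  by (auto simp: vcomp_def reflect_def hcomp_def fun_eq_iff algebra_simps)

lemma vcomp_min_max:
  "vcomp \<beta> \<alpha> = (\<lambda>(x, y). if y \<le> x then \<alpha> (x - min (1 - x) y, y + min (1 - x) y)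
     else \<beta> (1 + x - max (1 - x) y, y + max (1 - x) y - 1))"
  by (auto simp: vcomp_def fun_eq_iff algebra_simps)

lemma sq_idn_v_reflect:
  "u 1 = u' 1 \<Longrightarrow> sq_idn_v u u' = reflect (sq_idn_h (rev_path u) (rev_path u'))"
  "u 0 = v 0 \<Longrightarrow> sq_idn_h u v = reflect (sq_idn_v (rev_path u) (rev_path v))"
  by (auto simp: sq_idn_v_def sq_idn_h_def reflect_def rev_path_def fun_eq_iff algebra_simps)

lemma side_reflect [simp]:
  "side_u (reflect \<alpha>) = rev_path (side_u \<alpha>)" "side_v (reflect \<alpha>) = rev_path (side_u' \<alpha>)"
  "side_u' (reflect \<alpha>) = rev_path (side_v \<alpha>)" "side_v' (reflect \<alpha>) = rev_path (side_v' \<alpha>)"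
  by (auto simp: side_u_def side_v_def side_u'_def side_v'_def reflect_def rev_path_def
      restrict_def fun_eq_iff)

lemma side_ends:
  "side_u \<alpha> 0 = side_v \<alpha> 0" "side_u \<alpha> 1 = side_u' \<alpha> 1"
  "side_v' \<alpha> 0 = side_u' \<alpha> 0" "side_v' \<alpha> 1 = side_v \<alpha> 1"
  by (auto simp: side_u_def side_v_def side_u'_def side_v'_def)

text \<open>Defined through reflection so that the horizontal lemmas transfer directly;
  \<open>vcompat_iff\<close> gives the form in terms of sides.\<close>

definition vcompat :: "'a sqmap \<Rightarrow> 'a sqmap \<Rightarrow> bool" where
  "vcompat \<beta> \<alpha> \<longleftrightarrow> hcompat (reflect \<beta>) (reflect \<alpha>)"

lemma rev_path_eq_iff [simp]: "rev_path u = rev_path v \<longleftrightarrow> u = v"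
  by (metis rev_path_simps(3))

lemma vcompat_iff: "vcompat \<beta> \<alpha> \<longleftrightarrow> side_u \<beta> = side_v \<alpha> \<and> side_u' \<beta> = side_v' \<alpha>"
  by (auto simp: vcompat_def hcompat_iff)

lemma vcompatD:
  assumes "vcompat \<beta> \<alpha>" "0 \<le> t" "t \<le> 1"
  shows "\<beta> (t, 0) = \<alpha> (0, t)" "\<beta> (1, t) = \<alpha> (t, 1)"
  using hcompatD[OF assms(1)[unfolded vcompat_def], of t]
    hcompatD[OF assms(1)[unfolded vcompat_def], of "1 - t"] assms(2,3)
  by (auto simp: reflect_def)

lemma vcomp_boundary:
  assumes "vcompat \<beta> \<alpha>" "0 \<le> t" "t \<le> 1"
  shows "vcomp \<beta> \<alpha> (t, 0) = \<alpha> (t, 0)" "vcomp \<beta> \<alpha> (0, t) = \<beta> (0, t)"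
    "vcomp \<beta> \<alpha> (1, t) = \<alpha> (1, t)" "vcomp \<beta> \<alpha> (t, 1) = \<beta> (t, 1)"
proof -
  note * = hcomp_boundary[OF assms(1)[unfolded vcompat_def]]
  show "vcomp \<beta> \<alpha> (t, 0) = \<alpha> (t, 0)" "vcomp \<beta> \<alpha> (0, t) = \<beta> (0, t)"
    "vcomp \<beta> \<alpha> (1, t) = \<alpha> (1, t)" "vcomp \<beta> \<alpha> (t, 1) = \<beta> (t, 1)"
    using *[of t] *[of "1 - t"] assms(2,3) by (simp_all add: vcomp_reflect reflect_def)
qed

lemma vcomp_cong:
  assumes "sq_homotopic X \<alpha> \<alpha>'" "sq_homotopic X \<beta> \<beta>'" "vcompat \<beta> \<alpha>"
  shows "sq_homotopic X (vcomp \<beta> \<alpha>) (vcomp \<beta>' \<alpha>')"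
  unfolding vcomp_reflect
  by (intro sq_homotopic_reflect hcomp_cong assms(1,2) assms(3)[unfolded vcompat_def])

lemma vcomp_continuous:
  assumes "continuous_map unit_sq X \<alpha>" "continuous_map unit_sq X \<beta>" "vcompat \<beta> \<alpha>"
  shows "continuous_map unit_sq X (vcomp \<beta> \<alpha>)"
  using vcomp_cong[OF sq_homotopic_refl sq_homotopic_refl] assms sq_homotopic_continuous by blast

lemma vcomp_assoc:
  assumes "continuous_map unit_sq X \<alpha>" "continuous_map unit_sq X \<beta>" "continuous_map unit_sq X \<gamma>"
    and "vcompat \<alpha> \<beta>" "vcompat \<beta> \<gamma>"
  shows "sq_homotopic X (vcomp (vcomp \<alpha> \<beta>) \<gamma>) (vcomp \<alpha> (vcomp \<beta> \<gamma>))"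
  using sq_homotopic_reflect[OF hcomp_assoc[of X "reflect \<alpha>" "reflect \<beta>" "reflect \<gamma>"]] assms
  by (simp add: vcomp_reflect reflect_continuous vcompat_def)

lemma vcomp_idn_right:
  assumes "continuous_map unit_sq X \<alpha>"
  shows "sq_homotopic X (vcomp \<alpha> (sq_idn_v (side_u \<alpha>) (side_u' \<alpha>))) \<alpha>"
  using sq_homotopic_reflect[OF hcomp_idn_right[OF reflect_continuous[OF assms]]]
  by (simp add: vcomp_reflect sq_idn_v_reflect(1) side_ends)

lemma vcomp_idn_left:
  assumes "continuous_map unit_sq X \<alpha>"
  shows "sq_homotopic X (vcomp (sq_idn_v (side_v \<alpha>) (side_v' \<alpha>)) \<alpha>) \<alpha>"
  using sq_homotopic_reflect[OF hcomp_idn_left[OF reflect_continuous[OF assms]]]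
  by (simp add: vcomp_reflect sq_idn_v_reflect(1) side_ends)

lemma sq_idn_v_continuous:
  assumes "pathin X u" "pathin X u'" "u 1 = u' 1"
  shows "continuous_map unit_sq X (sq_idn_v u u')"
  using assms by (simp add: sq_idn_v_reflect(1) reflect_continuous sq_idn_h_continuous pathin_rev_path)

definition vinv :: "'a sqmap \<Rightarrow> 'a sqmap" where
  "vinv \<alpha> = reflect (hinv (reflect \<alpha>))"

lemma vinv_continuous:
  "continuous_map unit_sq X \<alpha> \<Longrightarrow> continuous_map unit_sq X (vinv \<alpha>)"
  by (simp add: vinv_def reflect_continuous hinv_continuous)

lemma vcomp_vinv_left:
  assumes "continuous_map unit_sq X \<alpha>"
  shows "sq_homotopic X (vcomp (vinv \<alpha>) \<alpha>) (sq_idn_v (side_u \<alpha>) (side_u' \<alpha>))"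
  using sq_homotopic_reflect[OF hcomp_hinv_left[OF reflect_continuous[OF assms]]]
  by (simp add: vcomp_reflect vinv_def sq_idn_v_reflect(1) side_ends)

lemma vcomp_vinv_right:
  assumes "continuous_map unit_sq X \<alpha>"
  shows "sq_homotopic X (vcomp \<alpha> (vinv \<alpha>)) (sq_idn_v (side_v \<alpha>) (side_v' \<alpha>))"
  using sq_homotopic_reflect[OF hcomp_hinv_right[OF reflect_continuous[OF assms]]]
  by (simp add: vcomp_reflect vinv_def sq_idn_v_reflect(1) side_ends)

lemma side_hinv [simp]:
  "side_u (hinv \<alpha>) = side_u' \<alpha>" "side_v (hinv \<alpha>) = side_v' \<alpha>"
  "side_u' (hinv \<alpha>) = side_u \<alpha>" "side_v' (hinv \<alpha>) = side_v \<alpha>"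
  by (auto simp: side_u_def side_v_def side_u'_def side_v'_def hinv_def)

lemma side_vinv [simp]:
  "side_u (vinv \<alpha>) = side_v \<alpha>" "side_v (vinv \<alpha>) = side_u \<alpha>"
  "side_u' (vinv \<alpha>) = side_v' \<alpha>" "side_v' (vinv \<alpha>) = side_u' \<alpha>"
  by (simp_all add: vinv_def)


subsection \<open>Identity squares and composition\<close>

text \<open>In the composite of the identity squares on \<open>u' \<rightarrow> u''\<close> and \<open>u \<rightarrow> u'\<close>, every diagonal follows
  \<open>u\<close>, goes back along a piece of \<open>u'\<close>, forward along the same piece and then back along \<open>u''\<close>. At time
  \<open>t\<close> of the homotopy only the part of \<open>u'\<close> over \<open>[t, 1]\<close> is traversed.\<close>

lemma hcomp_sq_idn_v:
  assumes "pathin X u" "pathin X u'" "pathin X u''" "u 1 = u' 1" "u' 1 = u'' 1"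
  shows "sq_homotopic X (hcomp (sq_idn_v u' u'') (sq_idn_v u u')) (sq_idn_v u u'')"
proof -
  \<comment> \<open>The first coordinate is the time. The map follows \<open>u\<close> on [0,1] and
    then returns along \<open>u'\<close>; the maximum with the time stops the return early.\<close>
  define E where "E u = (\<lambda>z. if snd z \<le> 1 then u (snd z) else u' (max (2 - snd z) (fst z)))" for u
  have E: "continuous_map (top_of_set ({0..1} \<times> {0..2})) X (E u)" if u: "pathin X u" "u 1 = u' 1" for u
    unfolding E_def
  proof (rule continuous_map_paste, goal_cases)
    case 3
    show ?case
      by (rule continuous_map_compose_on[OF u(1)[unfolded pathin_def]]) (auto intro!: continuous_intros)
  next
    case 4
    show ?case
      by (rule continuous_map_compose_on[OF assms(2)[unfolded pathin_def]]) (auto intro!: continuous_intros)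
  next
    case (5 z)
    then have "max (2 - snd z) (fst z) = 1" by auto
    then show ?case using 5 u(2) by simp
  qed (auto intro!: continuous_intros)
  \<comment> \<open>In the first half the argument is the sum s of the two coordinates that
    \<open>hcomp_min_max\<close> passes on. The second half is read backwards, with
    \<open>u''\<close> in place of \<open>u\<close>, so its argument is 2 - s.\<close>
  define H where "H = (\<lambda>z. let t = fst z; x = fst (snd z); y = snd (snd z) in
    if x + y \<le> 1 then E u (t, x + y + 2 * min x y) else E u'' (t, 4 - x - y - 2 * max x y))"
  have "sq_homotopic X (hcomp (sq_idn_v u' u'') (sq_idn_v u u')) (\<lambda>z. H (1, z))"
  proof (rule sq_homotopicI)
    show "continuous_map (top_of_set ({0..1} \<times> usq)) X H"
      unfolding H_def Let_def
    proof (rule continuous_map_paste, goal_cases)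
      case 3
      show ?case
        by (rule continuous_map_compose_on[OF E], use assms in simp, use assms in simp,
            intro continuous_intros) (auto simp: min_def)
    next
      case 4
      show ?case
        by (rule continuous_map_compose_on[OF E], use assms in simp, use assms in simp,
            intro continuous_intros) (auto simp: max_def)
    next
      case (5 z)
      obtain t x y where "z = (t, x, y)" by (cases z) auto
      with 5 have z: "z = (t, x, 1 - x)" by simp
      have "x \<le> 0 \<Longrightarrow> x = 0" "1 \<le> x \<Longrightarrow> x = 1" using 5 unfolding z by auto
      then show ?case using assms unfolding z by (auto simp: E_def min_def max_def)
    qed (intro continuous_intros)+
  next
    fix x y assume *: "(x, y) \<in> usq"
    show H0: "H (0, x, y) = hcomp (sq_idn_v u' u'') (sq_idn_v u u') (x, y)"
    proof (cases "x + y \<le> 1")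
      case True
      then have "max (2 - (x + y + 2 * min x y)) 0 = 2 - (x + y + 2 * min x y)"
        by (auto simp: min_def)
      with True show ?thesis
        using assms by (auto simp: H_def Let_def E_def hcomp_min_max sq_idn_v_def algebra_simps)
    next
      case False
      then have "max (2 - (4 - x - y - 2 * max x y)) 0 = 2 - (4 - x - y - 2 * max x y)"
        by (auto simp: max_def)
      with False show ?thesis
        using assms by (auto simp: H_def Let_def E_def hcomp_min_max sq_idn_v_def algebra_simps)
    qed
    fix t :: real assume t: "t \<in> {0..1}" and bd: "x = 0 \<or> x = 1 \<or> y = 0 \<or> y = 1"
    have "H (t, x, y) = H (0, x, y)"
      using * bd t assms by (auto simp: H_def Let_def E_def min_def max_def)
    with H0 show "H (t, x, y) = hcomp (sq_idn_v u' u'') (sq_idn_v u u') (x, y)" by simp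
  qed auto
  also have "sq_homotopic X (\<lambda>z. H (1, z)) (sq_idn_v u u'')"
  proof (rule sq_homotopic_convex)
    let ?W = "\<lambda>r. if r \<le> 1 then u r else u'' (2 - r)"
    \<comment> \<open>At time 1 only \<open>u\<close> followed by the reverse of \<open>u''\<close>
      is left, that is \<open>?W\<close>. The two clamped terms are the positions in the two halves
      of the composite; the inactive one equals 1 (facts \<open>low\<close> and \<open>up\<close>),
      so the sum minus 1 is the active one. On the boundary this is x + y.\<close>
    let ?\<rho> = "\<lambda>z. min 1 (fst z + snd z + 2 * min (fst z) (snd z))
        + max 1 (fst z + snd z + 2 * max (fst z) (snd z) - 2) - 1"
    show "continuous_map (top_of_set {0..2}) X ?W"
    proof (rule continuous_map_paste, goal_cases)
      case 3
      show ?case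
        by (rule continuous_map_compose_on[OF assms(1)[unfolded pathin_def]]) (auto intro!: continuous_intros)
    next
      case 4
      show ?case
        by (rule continuous_map_compose_on[OF assms(3)[unfolded pathin_def]]) (auto intro!: continuous_intros)
    qed (use assms in \<open>auto intro!: continuous_intros\<close>)
    show "continuous_on usq ?\<rho>" "continuous_on usq (\<lambda>z. fst z + snd z)"
      by (intro continuous_intros)+
    show "convex {0..2::real}" by simp
    fix z :: "real \<times> real" assume "z \<in> usq"
    then show "?\<rho> z \<in> {0..2}" "fst z + snd z \<in> {0..2}" by (auto simp: min_def max_def)
  next
    fix x y :: real assume *: "(x, y) \<in> usq"
    show "sq_idn_v u u'' (x, y) =
      (if fst (x, y) + snd (x, y) \<le> 1 then u (fst (x, y) + snd (x, y)) else u'' (2 - (fst (x, y) + snd (x, y))))"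
      by (simp add: sq_idn_v_def algebra_simps)
    let ?r = "min 1 (fst (x, y) + snd (x, y) + 2 * min (fst (x, y)) (snd (x, y)))
        + max 1 (fst (x, y) + snd (x, y) + 2 * max (fst (x, y)) (snd (x, y)) - 2) - 1"
    have low: "max 1 (x + y + 2 * max x y - 2) = 1" if "x + y \<le> 1"
      using * that by (auto simp: max_def)
    have up: "min 1 (x + y + 2 * min x y) = 1" if "\<not> x + y \<le> 1"
      using * that by (auto simp: min_def)
    show "H (1, x, y) = (if ?r \<le> 1 then u ?r else u'' (2 - ?r))"
    proof (cases "x + y \<le> 1")
      case True
      with low show ?thesis using assms by (auto simp: H_def E_def min_def)
    next
      case False
      define g where "g = x + y + 2 * max x y - 2"
      have "H (1, x, y) = E u'' (1, 4 - x - y - 2 * max x y)" using False by (simp add: H_def)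
      also have "4 - x - y - 2 * max x y = 2 - g" by (simp add: g_def)
      finally have "H (1, x, y) = (if 2 - g \<le> 1 then u'' (2 - g) else u' (max g 1))"
        by (simp add: E_def)
      moreover have "?r = max 1 g" using up[OF False] by (simp add: g_def)
      ultimately show ?thesis using assms by (auto simp: max_def)
    qed
    assume "x = 0 \<or> x = 1 \<or> y = 0 \<or> y = 1"
    then show "?r = fst (x, y) + snd (x, y)"
      unfolding fst_conv snd_conv using * by (smt (verit) mem_Sigma_iff atLeastAtMost_iff)
  qed
  finally show ?thesis .
qed

lemma vcomp_sq_idn_h:
  assumes "pathin X u" "pathin X v" "pathin X w" "u 0 = v 0" "v 0 = w 0"
  shows "sq_homotopic X (vcomp (sq_idn_h v w) (sq_idn_h u v)) (sq_idn_h u w)"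
  using sq_homotopic_reflect[OF hcomp_sq_idn_v[of X "rev_path u" "rev_path v" "rev_path w"]] assms
  by (simp add: vcomp_reflect sq_idn_v_reflect(2) pathin_rev_path)

text \<open>Both squares factor through \<open>u\<close>, by \<bar>x - y\<bar> and 1 - \<bar>x + y -
  1\<bar>, and these functions agree on the boundary.\<close>

lemma sq_idn_h_sq_idn_v:
  assumes "pathin X u"
  shows "sq_homotopic X (sq_idn_h u u) (sq_idn_v u u)"
proof (rule sq_homotopic_convex)
  show "continuous_map (top_of_set {0..1}) X u" using assms by (simp add: pathin_def)
  show "continuous_on usq (\<lambda>z. \<bar>fst z - snd z\<bar>)" "continuous_on usq (\<lambda>z. 1 - \<bar>fst z + snd z - 1\<bar>)"
    by (intro continuous_intros)+
qed (auto simp: sq_idn_h_def sq_idn_v_def algebra_simps)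


subsection \<open>The interchange law\<close>

text \<open>The two sides of the interchange law glue the four squares along different trees. All four
  squares share one edge \<open>c\<close>, and the two maps differ in the position of the center of the
  unit square, which is sent to \<open>c 1\<close> by one side of the law and to \<open>c 0\<close> by the other. The homotopy slides
  the center along \<open>c\<close>. The functions \<open>slide\<^sub>1\<close> and \<open>slide\<^sub>2\<close> are the coordinates of the resulting
  deformation of maps from the bottom one of the four triangles cut out by the diagonals to the unit
  square.\<close>

definition slide1 :: "real \<Rightarrow> real \<Rightarrow> real \<Rightarrow> real" where
  "slide1 t x y = x + (2 * t - 1) * y + min (x - y) (2 * (1 - t) * y) - min (1 - x - y) (2 * t * y)"

definition slide2 :: "real \<Rightarrow> real \<Rightarrow> real \<Rightarrow> real" where
  "slide2 t x y = 2 * y + min (x - y) (2 * (1 - t) * y) + min (1 - x - y) (2 * t * y)"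

text \<open>Here \<open>t\<close> occurs only in the product t * y. Replaced by a variable between 0
  and y, it leaves piecewise linear estimates.\<close>

lemma slide_alt:
  "slide1 t x y = x + 2 * (t * y) - y + min (x - y) (2 * y - 2 * (t * y)) - min (1 - x - y) (2 * (t * y))"
  "slide2 t x y = 2 * y + min (x - y) (2 * y - 2 * (t * y)) + min (1 - x - y) (2 * (t * y))"
  by (simp_all add: slide1_def slide2_def algebra_simps)

lemma slide_in_usq:
  assumes "0 \<le> t" "t \<le> 1" "0 \<le> y" "y \<le> x" "x + y \<le> 1"
  shows "0 \<le> slide1 t x y" "slide1 t x y \<le> 1" "0 \<le> slide2 t x y" "slide2 t x y \<le> 1"
proof -
  define w where "w = t * y"
  have w: "0 \<le> w" "w \<le> y" using assms mult_right_mono[of t 1 y] by (simp_all add: w_def)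
  then show "0 \<le> slide1 t x y" "slide1 t x y \<le> 1" "0 \<le> slide2 t x y" "slide2 t x y \<le> 1"
    using assms w unfolding slide_alt w_def[symmetric] by (auto simp: min_def)
qed

text \<open>The sides where the first coordinate is 0 or the second is 1 are those along which
  \<delta> meets \<beta>: the seam between the bottom and the left triangle is consistent at every
  time.\<close>

lemma slide_diagonal:
  assumes "0 \<le> t" "t \<le> 1" "0 \<le> x" "2 * x \<le> 1"
  shows "slide1 t x x = 0 \<or> slide2 t x x = 1"
proof -
  define w where "w = t * x"
  have w: "0 \<le> w" "w \<le> x" using assms mult_right_mono[of t 1 x] by (simp_all add: w_def)
  show ?thesis using assms w unfolding slide_alt w_def[symmetric] by (auto simp: min_def)
qed

text \<open>The analogue for the seam between the bottom and the right triangle, where \<delta>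
  meets \<gamma>.\<close>

lemma slide_antidiagonal:
  assumes "0 \<le> t" "t \<le> 1" "0 \<le> y" "y \<le> x" "x + y = 1"
  shows "slide1 t x y = 1 \<or> slide2 t x y = 1"
proof -
  define w where "w = t * y"
  have w: "0 \<le> w" "w \<le> y" using assms mult_right_mono[of t 1 y] by (simp_all add: w_def)
  have "x = 1 - y" using assms by simp
  then show ?thesis using assms w unfolding slide_alt w_def[symmetric] by (auto simp: min_def)
qed

lemma slide_bottom: "0 \<le> x \<Longrightarrow> x \<le> 1 \<Longrightarrow> slide1 t x 0 = x" "0 \<le> x \<Longrightarrow> x \<le> 1 \<Longrightarrow> slide2 t x 0 = 0"
  by (auto simp: slide1_def slide2_def)

text \<open>Time 0 gives the coordinates used by the vertical composite of horizontal composites;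
  \<open>slide_1\<close> gives those of the other side of the law.\<close>

lemma slide_0:
  assumes "0 \<le> y" "x + y \<le> 1"
  shows "slide1 0 x y = x - y + min (x - y) (2 * y)" "slide2 0 x y = 2 * y + min (x - y) (2 * y)"
  using assms by (auto simp: slide1_def slide2_def)

lemma slide_1:
  assumes "0 \<le> y" "y \<le> x"
  shows "slide1 1 x y = x + y - min (1 - x - y) (2 * y)" "slide2 1 x y = 2 * y + min (1 - x - y) (2 * y)"
  using assms by (auto simp: slide1_def slide2_def)

lemma interchange_homotopic:
  assumes cont: "continuous_map unit_sq X \<alpha>" "continuous_map unit_sq X \<beta>"
      "continuous_map unit_sq X \<gamma>" "continuous_map unit_sq X \<delta>"
    and h: "hcompat \<alpha> \<beta>" "hcompat \<gamma> \<delta>" and v: "vcompat \<alpha> \<gamma>" "vcompat \<beta> \<delta>"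
  shows "sq_homotopic X (vcomp (hcomp \<alpha> \<beta>) (hcomp \<gamma> \<delta>)) (hcomp (vcomp \<alpha> \<gamma>) (vcomp \<beta> \<delta>))"
proof -
  \<comment> \<open>The formula for the bottom triangle is transported by symmetries of the square:
    to the left triangle by reflection in the diagonal, to the right one by reflection in the
    antidiagonal, to the top one by a half turn.\<close>
  define H where "H = (\<lambda>z. let t = fst z; x = fst (snd z); y = snd (snd z) in
    if x + y \<le> 1 then
      if y \<le> x then \<delta> (slide1 t x y, slide2 t x y) else \<beta> (slide2 t y x, slide1 t y x)
    else
      if y \<le> x then \<gamma> (1 - slide2 t (1 - y) (1 - x), 1 - slide1 t (1 - y) (1 - x))
      else \<alpha> (1 - slide1 t (1 - x) (1 - y), 1 - slide2 t (1 - x) (1 - y)))"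
  note cont = cont[unfolded unit_sq_def]
  \<comment> \<open>The four compatibility conditions in a form that matches these symmetries: on
    common sides a point is identified with its mirror image in the antidiagonal or in the
    diagonal.\<close>
  have \<gamma>\<delta>: "\<delta> (p, q) = \<gamma> (1 - q, 1 - p)" if "p = 1 \<or> q = 1" "(p, q) \<in> usq" for p q
    using that hcompatD[OF h(2), of "1 - p"] hcompatD[OF h(2), of "1 - q"] by auto
  have \<alpha>\<beta>: "\<beta> (p, q) = \<alpha> (1 - q, 1 - p)" if "p = 1 \<or> q = 1" "(p, q) \<in> usq" for p q
    using that hcompatD[OF h(1), of "1 - p"] hcompatD[OF h(1), of "1 - q"] by auto
  have \<beta>\<delta>: "\<delta> (p, q) = \<beta> (q, p)" if "p = 0 \<or> q = 1" "(p, q) \<in> usq" for p q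
    using that vcompatD[OF v(2), of p] vcompatD[OF v(2), of q] by auto
  have \<alpha>\<gamma>: "\<gamma> (p, q) = \<alpha> (q, p)" if "p = 0 \<or> q = 1" "(p, q) \<in> usq" for p q
    using that vcompatD[OF v(1), of p] vcompatD[OF v(1), of q] by auto
  show ?thesis
  proof (rule sq_homotopicI)
    show "continuous_map (top_of_set ({0..1} \<times> usq)) X H"
      unfolding H_def Let_def
    proof (rule continuous_map_paste, goal_cases)
      case 3
      show ?case
      proof (rule continuous_map_paste, goal_cases)
        case 3
        show ?case
          by (rule continuous_map_compose_on[OF cont(4)], unfold slide1_def slide2_def,
              intro continuous_intros, fold slide1_def slide2_def) (auto intro: slide_in_usq)
      next
        case 4
        show ?case
          by (rule continuous_map_compose_on[OF cont(2)], unfold slide1_def slide2_def,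
              intro continuous_intros, fold slide1_def slide2_def) (auto intro: slide_in_usq)
      next
        case (5 z)
        obtain t x y where "z = (t, x, y)" by (cases z) auto
        with 5 have z: "z = (t, x, x)" by simp
        show ?case
          unfolding z fst_conv snd_conv using slide_diagonal[of t x] slide_in_usq[of t x x] 5 z by (intro \<beta>\<delta>) auto
      qed (intro continuous_intros)+
    next
      case 4
      show ?case
      proof (rule continuous_map_paste, goal_cases)
        case 3
        show ?case
          by (rule continuous_map_compose_on[OF cont(3)], unfold slide1_def slide2_def,
              intro continuous_intros, fold slide1_def slide2_def) (auto intro: slide_in_usq)
      next
        case 4
        show ?case
          by (rule continuous_map_compose_on[OF cont(1)], unfold slide1_def slide2_def,
              intro continuous_intros, fold slide1_def slide2_def) (auto intro: slide_in_usq)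
      next
        case (5 z)
        obtain t x y where "z = (t, x, y)" by (cases z) auto
        with 5 have z: "z = (t, x, x)" by simp
        show ?case
          unfolding z fst_conv snd_conv using slide_diagonal[of t "1 - x"] slide_in_usq[of t "1 - x" "1 - x"] 5 z
          by (intro \<alpha>\<gamma>) auto
      qed (intro continuous_intros)+
    next
      case (5 z)
      obtain t x y where "z = (t, x, y)" by (cases z) auto
      with 5 have z: "z = (t, x, 1 - x)" by simp
      consider "x < 1 - x" | "x = 1 - x" | "1 - x < x" by linarith
      then show ?case
      proof cases
        case 1
        then show ?thesis
          unfolding z fst_conv snd_conv using slide_antidiagonal[of t x "1 - x"]
            slide_in_usq[of t x "1 - x"] 5 z
          by (simp, subst \<alpha>\<beta>) auto
      next
        case 2
        then have x: "x = 1 / 2" by simp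
        have "\<delta> (slide1 t (1/2) (1/2), slide2 t (1/2) (1/2))
            = \<gamma> (1 - slide2 t (1/2) (1/2), 1 - slide1 t (1/2) (1/2))"
          using slide_antidiagonal[of t "1/2" "1/2"] slide_in_usq[of t "1/2" "1/2"] 5 z x by (intro \<gamma>\<delta>) auto
        then show ?thesis unfolding z x by simp
      next
        case 3
        then show ?thesis
          unfolding z fst_conv snd_conv using slide_antidiagonal[of t "1 - x" x]
            slide_in_usq[of t "1 - x" x] 5 z
          by (simp, subst \<gamma>\<delta>) auto
      qed
    qed (intro continuous_intros)+
  next
    fix x y :: real assume *: "(x, y) \<in> usq"
    consider "x + y \<le> 1" "y \<le> x" | "x + y \<le> 1" "\<not> y \<le> x"
      | "\<not> x + y \<le> 1" "y \<le> x" | "\<not> x + y \<le> 1" "\<not> y \<le> x" by blast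
    then have "H (0, x, y) = vcomp (hcomp \<alpha> \<beta>) (hcomp \<gamma> \<delta>) (x, y) \<and>
      H (1, x, y) = hcomp (vcomp \<alpha> \<gamma>) (vcomp \<beta> \<delta>) (x, y)"
      by cases (use * in \<open>simp add: H_def slide_0 slide_1 hcomp_min_max vcomp_min_max,
        simp add: min_def max_def, (intro conjI impI arg_cong[where f = \<alpha>] arg_cong[where f = \<beta>]
        arg_cong[where f = \<gamma>] arg_cong[where f = \<delta>]; simp)?\<close>)+
    then show H0: "H (0, x, y) = vcomp (hcomp \<alpha> \<beta>) (hcomp \<gamma> \<delta>) (x, y)"
      and "H (1, x, y) = hcomp (vcomp \<alpha> \<gamma>) (vcomp \<beta> \<delta>) (x, y)" by simp_all
    fix t :: real assume t: "t \<in> {0..1}" and bd: "x = 0 \<or> x = 1 \<or> y = 0 \<or> y = 1"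
    have "H (t, x, y) = H (0, x, y)"
      using * bd by (auto simp: H_def slide_bottom)
    with H0 show "H (t, x, y) = vcomp (hcomp \<alpha> \<beta>) (hcomp \<gamma> \<delta>) (x, y)" by simp
  qed
qed

section \<open>The homotopy double groupoid\<close>

lemma mem_sq_class: "\<beta> \<in> sq_class X \<alpha> \<longleftrightarrow> sq_homotopic X \<alpha> \<beta>"
  by (simp add: sq_class_def sq_homotopic_def)

lemma sq_class_eqI: "sq_homotopic X \<alpha> \<beta> \<Longrightarrow> sq_class X \<alpha> = sq_class X \<beta>"
  unfolding set_eq_iff mem_sq_class by (meson sq_homotopic_trans sq_homotopic_sym)

lemma sq_class_in_squares [simp]: "continuous_map unit_sq X \<alpha> \<Longrightarrow> sq_class X \<alpha> \<in> squares X"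
  by (auto simp: squares_def)

lemma squaresE:
  assumes "c \<in> squares X"
  obtains \<alpha> where "c = sq_class X \<alpha>" "continuous_map unit_sq X \<alpha>"
  using assms by (auto simp: squares_def)

lemma rep_sq_class:
  assumes "continuous_map unit_sq X \<alpha>"
  shows "sq_homotopic X \<alpha> (rep (sq_class X \<alpha>))"
  unfolding rep_def mem_sq_class[symmetric]
  by (rule someI[of _ \<alpha>]) (simp add: mem_sq_class sq_homotopic_refl assms)

lemma sq_homotopic_sides:
  assumes "sq_homotopic X \<alpha> \<beta>"
  shows "side_u \<beta> = side_u \<alpha>" "side_v \<beta> = side_v \<alpha>" "side_u' \<beta> = side_u' \<alpha>" "side_v' \<beta> = side_v' \<alpha>"
  using sq_homotopic_boundaryD[OF assms]
  by (auto simp: side_u_def side_v_def side_u'_def side_v'_def restrict_eq_iff)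

lemma path_cong:
  "\<lbrakk>pathin X v; \<And>t. 0 \<le> t \<Longrightarrow> t \<le> 1 \<Longrightarrow> u t = v t\<rbrakk> \<Longrightarrow> pathin X u"
  unfolding pathin_def by (erule continuous_map_eq) auto

lemma restrict_in_paths: "pathin X u \<Longrightarrow> restrict u {0..1} \<in> paths X"
  by (auto simp: paths_def intro: path_cong)

lemma pathsD: "u \<in> paths X \<Longrightarrow> pathin X u"
  by (simp add: paths_def)

lemma side_in_paths [simp]:
  assumes "continuous_map unit_sq X \<alpha>"
  shows "side_u \<alpha> \<in> paths X" "side_v \<alpha> \<in> paths X" "side_u' \<alpha> \<in> paths X" "side_v' \<alpha> \<in> paths X"
  unfolding side_u_def side_v_def side_u'_def side_v'_def
  by (rule restrict_in_paths, unfold pathin_def,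
      rule continuous_map_compose_on[OF assms[unfolded unit_sq_def]];
      auto intro!: continuous_intros)+

lemma side_extensional [simp]:
  "side_u \<alpha> \<in> extensional {0..1}" "side_v \<alpha> \<in> extensional {0..1}"
  "side_u' \<alpha> \<in> extensional {0..1}" "side_v' \<alpha> \<in> extensional {0..1}"
  by (simp_all add: side_u_def side_v_def side_u'_def side_v'_def)

lemma paths_extensional: "u \<in> paths X \<Longrightarrow> u \<in> extensional {0..1}"
  by (simp add: paths_def)

lemma side_sq_idn_h [simp]:
  assumes "u \<in> extensional {0..1}" "v \<in> extensional {0..1}" "u 0 = v 0"
  shows "side_u (sq_idn_h u v) = u" "side_v (sq_idn_h u v) = v"
    "side_u' (sq_idn_h u v) = u" "side_v' (sq_idn_h u v) = v"
  using assms
  by (auto simp: side_u_def side_v_def side_u'_def side_v'_def sq_idn_h_def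
      restrict_def extensional_def fun_eq_iff)

lemma side_sq_idn_v [simp]:
  assumes "u \<in> extensional {0..1}" "u' \<in> extensional {0..1}" "u 1 = u' 1"
  shows "side_u (sq_idn_v u u') = u" "side_v (sq_idn_v u u') = u"
    "side_u' (sq_idn_v u u') = u'" "side_v' (sq_idn_v u u') = u'"
  using assms
  by (auto simp: side_u_def side_v_def side_u'_def side_v'_def sq_idn_v_def
      restrict_def extensional_def fun_eq_iff)

lemma side_hcomp [simp]:
  assumes "hcompat \<beta> \<alpha>"
  shows "side_u (hcomp \<beta> \<alpha>) = side_u \<alpha>" "side_v (hcomp \<beta> \<alpha>) = side_v \<alpha>"
    "side_u' (hcomp \<beta> \<alpha>) = side_u' \<beta>" "side_v' (hcomp \<beta> \<alpha>) = side_v' \<beta>"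
  using hcomp_boundary[OF assms]
  by (auto simp: side_u_def side_v_def side_u'_def side_v'_def restrict_eq_iff)

lemma side_vcomp [simp]:
  assumes "vcompat \<beta> \<alpha>"
  shows "side_u (vcomp \<beta> \<alpha>) = side_u \<alpha>" "side_v (vcomp \<beta> \<alpha>) = side_v \<beta>"
    "side_u' (vcomp \<beta> \<alpha>) = side_u' \<alpha>" "side_v' (vcomp \<beta> \<alpha>) = side_v' \<beta>"
  using vcomp_boundary[OF assms]
  by (auto simp: side_u_def side_v_def side_u'_def side_v'_def restrict_eq_iff)

lemma Pi_simps [simp]:
  "Ob (Pi_Hor X) = paths X" "Ob (Pi_Ver X) = paths X"
  "(u, v) \<in> Mor (Pi_Hor X) \<longleftrightarrow> u \<in> paths X \<and> v \<in> paths X \<and> u 1 = v 1"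
  "(u, v) \<in> Mor (Pi_Ver X) \<longleftrightarrow> u \<in> paths X \<and> v \<in> paths X \<and> u 0 = v 0"
  "Src (Pi_Hor X) = fst" "Tgt (Pi_Hor X) = snd" "Src (Pi_Ver X) = fst" "Tgt (Pi_Ver X) = snd"
  "Idn (Pi_Hor X) u = (u, u)" "Idn (Pi_Ver X) u = (u, u)"
  "Cmp (Pi_Hor X) f g = (fst g, snd f)" "Cmp (Pi_Ver X) f g = (fst g, snd f)"
  "Ob (Pi_SqH X) = Mor (Pi_Ver X)" "Ob (Pi_SqV X) = Mor (Pi_Hor X)"
  "Mor (Pi_SqH X) = squares X" "Mor (Pi_SqV X) = squares X"
  "Idn (Pi_SqH X) (u, v) = sq_class X (sq_idn_h u v)"
  "Idn (Pi_SqV X) (u, v) = sq_class X (sq_idn_v u v)"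
  by (simp_all add: Pi_Hor_def Pi_Ver_def Pi_SqH_def Pi_SqV_def)

lemma Pi_ends [simp]:
  assumes "continuous_map unit_sq X \<alpha>"
  shows "Src (Pi_SqH X) (sq_class X \<alpha>) = (side_u \<alpha>, side_v \<alpha>)"
    "Tgt (Pi_SqH X) (sq_class X \<alpha>) = (side_u' \<alpha>, side_v' \<alpha>)"
    "Src (Pi_SqV X) (sq_class X \<alpha>) = (side_u \<alpha>, side_u' \<alpha>)"
    "Tgt (Pi_SqV X) (sq_class X \<alpha>) = (side_v \<alpha>, side_v' \<alpha>)"
  using sq_homotopic_sides[OF rep_sq_class[OF assms]]
  by (simp_all add: Pi_SqH_def Pi_SqV_def)

text \<open>The structure composes the representatives chosen by \<open>rep\<close>; congruence of
  composition allows any others to be used.\<close>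

lemma Pi_Cmp:
  assumes "continuous_map unit_sq X \<alpha>" "continuous_map unit_sq X \<beta>"
  shows "hcompat \<beta> \<alpha> \<Longrightarrow> Cmp (Pi_SqH X) (sq_class X \<beta>) (sq_class X \<alpha>) = sq_class X (hcomp \<beta> \<alpha>)"
    "vcompat \<beta> \<alpha> \<Longrightarrow> Cmp (Pi_SqV X) (sq_class X \<beta>) (sq_class X \<alpha>) = sq_class X (vcomp \<beta> \<alpha>)"
  using assms
  by (auto simp: Pi_SqH_def Pi_SqV_def
      intro!: sq_class_eqI[symmetric] hcomp_cong vcomp_cong rep_sq_class)

lemma sq_idn_continuous:
  "\<lbrakk>u \<in> paths X; v \<in> paths X; u 0 = v 0\<rbrakk> \<Longrightarrow> continuous_map unit_sq X (sq_idn_h u v)"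
  "\<lbrakk>u \<in> paths X; v \<in> paths X; u 1 = v 1\<rbrakk> \<Longrightarrow> continuous_map unit_sq X (sq_idn_v u v)"
  by (simp_all add: sq_idn_h_continuous sq_idn_v_continuous pathsD)

lemmas Pi_rules = hcompat_iff vcompat_iff Pi_Cmp hcomp_continuous vcomp_continuous
  sq_idn_continuous side_ends hinv_continuous vinv_continuous

section \<open>The four groupoid structures, the double groupoid and its filling condition\<close>

lemma groupoid_Pi_Hor: "groupoid (Pi_Hor X)"
proof unfold_locales
  fix f assume "f \<in> Mor (Pi_Hor X)"
  then show "\<exists>g\<in>Mor (Pi_Hor X). Src (Pi_Hor X) g = Tgt (Pi_Hor X) f \<and> Tgt (Pi_Hor X) g = Src (Pi_Hor X) f \<and>
      Cmp (Pi_Hor X) g f = Idn (Pi_Hor X) (Src (Pi_Hor X) f) \<and>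
      Cmp (Pi_Hor X) f g = Idn (Pi_Hor X) (Tgt (Pi_Hor X) f)"
    by (cases f) (auto intro!: bexI[of _ "(snd f, fst f)"])
qed auto

lemma groupoid_Pi_Ver: "groupoid (Pi_Ver X)"
proof unfold_locales
  fix f assume "f \<in> Mor (Pi_Ver X)"
  then show "\<exists>g\<in>Mor (Pi_Ver X). Src (Pi_Ver X) g = Tgt (Pi_Ver X) f \<and> Tgt (Pi_Ver X) g = Src (Pi_Ver X) f \<and>
      Cmp (Pi_Ver X) g f = Idn (Pi_Ver X) (Src (Pi_Ver X) f) \<and>
      Cmp (Pi_Ver X) f g = Idn (Pi_Ver X) (Tgt (Pi_Ver X) f)"
    by (cases f) (auto intro!: bexI[of _ "(snd f, fst f)"])
qed auto

lemma groupoid_Pi_SqH: "groupoid (Pi_SqH X)"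
proof unfold_locales
  fix f assume f: "f \<in> Mor (Pi_SqH X)"
  then obtain \<alpha> where \<alpha>: "f = sq_class X \<alpha>" "continuous_map unit_sq X \<alpha>"
    by (auto elim: squaresE)
  show "Src (Pi_SqH X) f \<in> Ob (Pi_SqH X)" "Tgt (Pi_SqH X) f \<in> Ob (Pi_SqH X)"
    using \<alpha> by (simp_all add: Pi_rules)
  show "Cmp (Pi_SqH X) (Idn (Pi_SqH X) (Tgt (Pi_SqH X) f)) f = f"
    "Cmp (Pi_SqH X) f (Idn (Pi_SqH X) (Src (Pi_SqH X) f)) = f"
    using \<alpha> hcomp_idn_left[of X \<alpha>] hcomp_idn_right[of X \<alpha>]
    by (simp_all add: Pi_rules sq_class_eqI)
  show "\<exists>g\<in>Mor (Pi_SqH X). Src (Pi_SqH X) g = Tgt (Pi_SqH X) f \<and> Tgt (Pi_SqH X) g = Src (Pi_SqH X) f \<and>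
      Cmp (Pi_SqH X) g f = Idn (Pi_SqH X) (Src (Pi_SqH X) f) \<and>
      Cmp (Pi_SqH X) f g = Idn (Pi_SqH X) (Tgt (Pi_SqH X) f)"
    using \<alpha> hcomp_hinv_left[of X \<alpha>] hcomp_hinv_right[of X \<alpha>]
    by (intro bexI[of _ "sq_class X (hinv \<alpha>)"]) (simp_all add: Pi_rules sq_class_eqI)
  fix g assume g: "g \<in> Mor (Pi_SqH X)" "Src (Pi_SqH X) f = Tgt (Pi_SqH X) g"
  then obtain \<beta> where \<beta>: "g = sq_class X \<beta>" "continuous_map unit_sq X \<beta>"
    by (auto elim: squaresE)
  have c: "hcompat \<alpha> \<beta>" using g \<alpha> \<beta> by (simp add: Pi_rules)
  show "Cmp (Pi_SqH X) f g \<in> Mor (Pi_SqH X)"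
    "Src (Pi_SqH X) (Cmp (Pi_SqH X) f g) = Src (Pi_SqH X) g"
    "Tgt (Pi_SqH X) (Cmp (Pi_SqH X) f g) = Tgt (Pi_SqH X) f"
    using \<alpha> \<beta> c by (simp_all add: Pi_Cmp hcomp_continuous)
  fix h assume h: "h \<in> Mor (Pi_SqH X)" "Src (Pi_SqH X) g = Tgt (Pi_SqH X) h"
  then obtain \<gamma> where \<gamma>: "h = sq_class X \<gamma>" "continuous_map unit_sq X \<gamma>"
    by (auto elim: squaresE)
  have c': "hcompat \<beta> \<gamma>" using h \<beta> \<gamma> by (simp add: Pi_rules)
  have c'': "hcompat (hcomp \<alpha> \<beta>) \<gamma>" "hcompat \<alpha> (hcomp \<beta> \<gamma>)"
    using c c' by (simp_all add: hcompat_iff)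
  show "Cmp (Pi_SqH X) (Cmp (Pi_SqH X) f g) h = Cmp (Pi_SqH X) f (Cmp (Pi_SqH X) g h)"
    using hcomp_assoc[OF \<alpha>(2) \<beta>(2) \<gamma>(2) c c'] \<alpha> \<beta> \<gamma> c c' c''
    by (simp add: Pi_Cmp hcomp_continuous sq_class_eqI)
next
  fix a assume a: "a \<in> Ob (Pi_SqH X)"
  then have "fst a \<in> extensional {0..1}" "snd a \<in> extensional {0..1}"
    by (cases a; auto intro: paths_extensional)+
  with a show "Idn (Pi_SqH X) a \<in> Mor (Pi_SqH X)" "Src (Pi_SqH X) (Idn (Pi_SqH X) a) = a"
    "Tgt (Pi_SqH X) (Idn (Pi_SqH X) a) = a"
    by (cases a; simp add: Pi_rules)+
qed

lemma groupoid_Pi_SqV: "groupoid (Pi_SqV X)"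
proof unfold_locales
  fix f assume f: "f \<in> Mor (Pi_SqV X)"
  then obtain \<alpha> where \<alpha>: "f = sq_class X \<alpha>" "continuous_map unit_sq X \<alpha>"
    by (auto elim: squaresE)
  show "Src (Pi_SqV X) f \<in> Ob (Pi_SqV X)" "Tgt (Pi_SqV X) f \<in> Ob (Pi_SqV X)"
    using \<alpha> by (simp_all add: Pi_rules)
  show "Cmp (Pi_SqV X) (Idn (Pi_SqV X) (Tgt (Pi_SqV X) f)) f = f"
    "Cmp (Pi_SqV X) f (Idn (Pi_SqV X) (Src (Pi_SqV X) f)) = f"
    using \<alpha> vcomp_idn_left[of X \<alpha>] vcomp_idn_right[of X \<alpha>]
    by (simp_all add: Pi_rules sq_class_eqI)
  show "\<exists>g\<in>Mor (Pi_SqV X). Src (Pi_SqV X) g = Tgt (Pi_SqV X) f \<and> Tgt (Pi_SqV X) g = Src (Pi_SqV X) f \<and>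
      Cmp (Pi_SqV X) g f = Idn (Pi_SqV X) (Src (Pi_SqV X) f) \<and>
      Cmp (Pi_SqV X) f g = Idn (Pi_SqV X) (Tgt (Pi_SqV X) f)"
    using \<alpha> vcomp_vinv_left[of X \<alpha>] vcomp_vinv_right[of X \<alpha>]
    by (intro bexI[of _ "sq_class X (vinv \<alpha>)"]) (simp_all add: Pi_rules sq_class_eqI)
  fix g assume g: "g \<in> Mor (Pi_SqV X)" "Src (Pi_SqV X) f = Tgt (Pi_SqV X) g"
  then obtain \<beta> where \<beta>: "g = sq_class X \<beta>" "continuous_map unit_sq X \<beta>"
    by (auto elim: squaresE)
  have c: "vcompat \<alpha> \<beta>" using g \<alpha> \<beta> by (simp add: Pi_rules)
  show "Cmp (Pi_SqV X) f g \<in> Mor (Pi_SqV X)"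
    "Src (Pi_SqV X) (Cmp (Pi_SqV X) f g) = Src (Pi_SqV X) g"
    "Tgt (Pi_SqV X) (Cmp (Pi_SqV X) f g) = Tgt (Pi_SqV X) f"
    using \<alpha> \<beta> c by (simp_all add: Pi_Cmp vcomp_continuous)
  fix h assume h: "h \<in> Mor (Pi_SqV X)" "Src (Pi_SqV X) g = Tgt (Pi_SqV X) h"
  then obtain \<gamma> where \<gamma>: "h = sq_class X \<gamma>" "continuous_map unit_sq X \<gamma>"
    by (auto elim: squaresE)
  have c': "vcompat \<beta> \<gamma>" using h \<beta> \<gamma> by (simp add: Pi_rules)
  have c'': "vcompat (vcomp \<alpha> \<beta>) \<gamma>" "vcompat \<alpha> (vcomp \<beta> \<gamma>)"
    using c c' by (simp_all add: vcompat_iff)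
  show "Cmp (Pi_SqV X) (Cmp (Pi_SqV X) f g) h = Cmp (Pi_SqV X) f (Cmp (Pi_SqV X) g h)"
    using vcomp_assoc[OF \<alpha>(2) \<beta>(2) \<gamma>(2) c c'] \<alpha> \<beta> \<gamma> c c' c''
    by (simp add: Pi_Cmp vcomp_continuous sq_class_eqI)
next
  fix a assume a: "a \<in> Ob (Pi_SqV X)"
  then have "fst a \<in> extensional {0..1}" "snd a \<in> extensional {0..1}"
    by (cases a; auto intro: paths_extensional)+
  with a show "Idn (Pi_SqV X) a \<in> Mor (Pi_SqV X)" "Src (Pi_SqV X) (Idn (Pi_SqV X) a) = a"
    "Tgt (Pi_SqV X) (Idn (Pi_SqV X) a) = a"
    by (cases a; simp add: Pi_rules)+
qed

lemma htpy_double_groupoid_simps [simp]: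
  "Hor (htpy_double_groupoid X) = Pi_Hor X" "Ver (htpy_double_groupoid X) = Pi_Ver X"
  "SqH (htpy_double_groupoid X) = Pi_SqH X" "SqV (htpy_double_groupoid X) = Pi_SqV X"
  by (simp_all add: htpy_double_groupoid_def)

lemma double_groupoid_Pi: "double_groupoid (htpy_double_groupoid X)"
proof (intro double_groupoid.intro double_category.intro double_groupoid_axioms.intro;
    (unfold htpy_double_groupoid_simps)?)
  show "groupoid (Pi_Hor X)" "groupoid (Pi_Ver X)" "groupoid (Pi_SqH X)" "groupoid (Pi_SqV X)"
    by (fact groupoid_Pi_Hor groupoid_Pi_Ver groupoid_Pi_SqH groupoid_Pi_SqV)+
  then show "category (Pi_Hor X)" "category (Pi_Ver X)" "category (Pi_SqH X)" "category (Pi_SqV X)"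
    by (simp_all add: groupoid_def)
next
  fix \<alpha> \<beta> \<gamma> \<delta>
  assume sq: "\<alpha> \<in> Mor (Pi_SqH X)" "\<beta> \<in> Mor (Pi_SqH X)" "\<gamma> \<in> Mor (Pi_SqH X)" "\<delta> \<in> Mor (Pi_SqH X)"
    and ends: "Src (Pi_SqH X) \<alpha> = Tgt (Pi_SqH X) \<beta>" "Src (Pi_SqH X) \<gamma> = Tgt (Pi_SqH X) \<delta>"
      "Src (Pi_SqV X) \<alpha> = Tgt (Pi_SqV X) \<gamma>" "Src (Pi_SqV X) \<beta> = Tgt (Pi_SqV X) \<delta>"
  obtain a where a: "\<alpha> = sq_class X a" "continuous_map unit_sq X a" using sq(1) by (auto elim: squaresE)
  obtain b where b: "\<beta> = sq_class X b" "continuous_map unit_sq X b" using sq(2) by (auto elim: squaresE)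
  obtain c where c: "\<gamma> = sq_class X c" "continuous_map unit_sq X c" using sq(3) by (auto elim: squaresE)
  obtain d where d: "\<delta> = sq_class X d" "continuous_map unit_sq X d" using sq(4) by (auto elim: squaresE)
  have compat: "hcompat a b" "hcompat c d" "vcompat a c" "vcompat b d"
    using ends a b c d by (simp_all add: Pi_rules)
  then have "vcompat (hcomp a b) (hcomp c d)" "hcompat (vcomp a c) (vcomp b d)"
    using compat by (simp_all add: hcompat_iff vcompat_iff)
  then show "Cmp (Pi_SqV X) (Cmp (Pi_SqH X) \<alpha> \<beta>) (Cmp (Pi_SqH X) \<gamma> \<delta>) =
      Cmp (Pi_SqH X) (Cmp (Pi_SqV X) \<alpha> \<gamma>) (Cmp (Pi_SqV X) \<beta> \<delta>)"
    using a b c d compat interchange_homotopic[of X a b c d]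
    by (simp add: Pi_Cmp hcomp_continuous vcomp_continuous sq_class_eqI)
next
  fix f g assume fg: "f \<in> Mor (Pi_Hor X)" "g \<in> Mor (Pi_Hor X)" "Src (Pi_Hor X) f = Tgt (Pi_Hor X) g"
  then have "fst g \<in> extensional {0..1}" "snd g \<in> extensional {0..1}" "snd f \<in> extensional {0..1}"
    by (cases f; cases g; auto intro: paths_extensional)+
  with fg show "Idn (Pi_SqV X) (Cmp (Pi_Hor X) f g) = Cmp (Pi_SqH X) (Idn (Pi_SqV X) f) (Idn (Pi_SqV X) g)"
    using sq_class_eqI[OF hcomp_sq_idn_v[of X "fst g" "snd g" "snd f"]]
    by (cases f; cases g) (auto simp: Pi_rules pathsD)
next
  fix f g assume fg: "f \<in> Mor (Pi_Ver X)" "g \<in> Mor (Pi_Ver X)" "Src (Pi_Ver X) f = Tgt (Pi_Ver X) g"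
  then have "fst g \<in> extensional {0..1}" "snd g \<in> extensional {0..1}" "snd f \<in> extensional {0..1}"
    by (cases f; cases g; auto intro: paths_extensional)+
  with fg show "Idn (Pi_SqH X) (Cmp (Pi_Ver X) f g) = Cmp (Pi_SqV X) (Idn (Pi_SqH X) f) (Idn (Pi_SqH X) g)"
    using sq_class_eqI[OF vcomp_sq_idn_h[of X "fst g" "snd g" "snd f"]]
    by (cases f; cases g) (auto simp: Pi_rules pathsD)
next
  fix a assume "a \<in> Ob (Pi_Hor X)"
  then show "Idn (Pi_SqH X) (Idn (Pi_Ver X) a) = Idn (Pi_SqV X) (Idn (Pi_Hor X) a)"
    using sq_class_eqI[OF sq_idn_h_sq_idn_v[of X a]] by (simp add: pathsD)
qed (auto elim!: squaresE simp: Pi_rules intro!: side_sq_idn_h side_sq_idn_v intro: paths_extensional)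

text \<open>The square retracts onto three of its sides. The given paths form one path
  \<open>w\<close> on [-1,2], and y + x (2 y - 1) runs linearly from -x to 1 + x as y runs from 0 to
  1. The fourth side is whatever results.\<close>

lemma square_with_three_sides:
  assumes "u \<in> paths X" "v \<in> paths X" "v' \<in> paths X" "u 0 = v 0" "v' 1 = v 1"
  obtains \<alpha> where "continuous_map unit_sq X \<alpha>" "side_u \<alpha> = u" "side_v \<alpha> = v" "side_v' \<alpha> = v'"
proof
  define w where "w = (\<lambda>s. if s \<le> 0 then u (- s) else if s \<le> 1 then v s else v' (2 - s))"
  note p = assms(1-3)[THEN pathsD, unfolded pathin_def]
  have w: "continuous_map (top_of_set {-1..2}) X w"
    unfolding w_def
  proof (rule continuous_map_paste, goal_cases)
    case 3
    show ?case by (rule continuous_map_compose_on[OF p(1)]) (auto intro!: continuous_intros)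
  next
    case 4
    show ?case
    proof (rule continuous_map_paste, goal_cases)
      case 3
      show ?case by (rule continuous_map_compose_on[OF p(2)]) (auto intro!: continuous_intros)
    next
      case 4
      show ?case by (rule continuous_map_compose_on[OF p(3)]) (auto intro!: continuous_intros)
    qed (use assms in \<open>auto intro!: continuous_intros\<close>)
  qed (use assms in \<open>auto intro!: continuous_intros\<close>)
  let ?\<alpha> = "\<lambda>z. w (snd z + fst z * (2 * snd z - 1))"
  show "continuous_map unit_sq X ?\<alpha>"
    unfolding unit_sq_def
  proof (rule continuous_map_compose_on[OF w])
    show "continuous_on usq (\<lambda>z. snd z + fst z * (2 * snd z - 1))" by (intro continuous_intros)
    fix z assume "z \<in> usq"
    then obtain x y where z: "z = (x, y)" "0 \<le> x" "x \<le> 1" "0 \<le> y" "y \<le> 1" by auto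
    then have "-1 \<le> 2 * y - 1" "2 * y - 1 \<le> 1" by auto
    then have "\<bar>x * (2 * y - 1)\<bar> \<le> 1 * 1" using z unfolding abs_mult by (intro mult_mono) auto
    then show "snd z + fst z * (2 * snd z - 1) \<in> {-1..2}" using z by auto
  qed
  have u: "u \<in> extensional {0..1}" "v \<in> extensional {0..1}" "v' \<in> extensional {0..1}"
    using assms by (simp_all add: paths_extensional)
  show "side_u ?\<alpha> = u" "side_v ?\<alpha> = v" "side_v' ?\<alpha> = v'"
    by (rule extensionalityI[OF _ u(1)] extensionalityI[OF _ u(2)] extensionalityI[OF _ u(3)];
        use assms in \<open>auto simp: side_u_def side_v_def side_v'_def w_def\<close>)+
qed

text \<open>A vertical and a horizontal morphism that meet consist of three paths, which are three
  sides of the square to be found.\<close>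

lemma filling_condition_Pi: "filling_condition (htpy_double_groupoid X)"
  unfolding filling_condition_def htpy_double_groupoid_simps
proof clarify
  fix v v' u w
  assume g: "(v, v') \<in> Mor (Pi_Hor X)" and u: "(u, w) \<in> Mor (Pi_Ver X)"
    and e: "Src (Pi_Hor X) (v, v') = Tgt (Pi_Ver X) (u, w)"
  then obtain \<alpha> where "continuous_map unit_sq X \<alpha>" "side_u \<alpha> = u" "side_v \<alpha> = v" "side_v' \<alpha> = v'"
    using square_with_three_sides[of u X v v'] by auto
  then show "\<exists>\<alpha>\<in>Mor (Pi_SqH X). Src (Pi_SqH X) \<alpha> = (u, w) \<and> Tgt (Pi_SqV X) \<alpha> = (v, v')"
    using e by (intro bexI[of _ "sq_class X \<alpha>"]) auto
qed

section \<open>Functoriality in the space\<close>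

lemma path_image_map_extensional [simp]: "path_image_map f u \<in> extensional {0..1}"
  by (simp add: path_image_map_def)

lemma path_image_map_in_paths:
  "\<lbrakk>continuous_map X Y f; u \<in> paths X\<rbrakk> \<Longrightarrow> path_image_map f u \<in> paths Y"
  unfolding path_image_map_def by (intro restrict_in_paths pathin_compose pathsD)

lemma path_image_map_apply [simp]:
  "0 \<le> t \<Longrightarrow> t \<le> 1 \<Longrightarrow> path_image_map f u t = f (u t)"
  by (simp add: path_image_map_def)

lemma side_compose [simp]:
  "side_u (f \<circ> \<alpha>) = path_image_map f (side_u \<alpha>)" "side_v (f \<circ> \<alpha>) = path_image_map f (side_v \<alpha>)"
  "side_u' (f \<circ> \<alpha>) = path_image_map f (side_u' \<alpha>)" "side_v' (f \<circ> \<alpha>) = path_image_map f (side_v' \<alpha>)"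
  by (auto simp: side_u_def side_v_def side_u'_def side_v'_def path_image_map_def restrict_def)

lemma compose_hcomp: "f \<circ> hcomp \<beta> \<alpha> = hcomp (f \<circ> \<beta>) (f \<circ> \<alpha>)"
  by (auto simp: hcomp_def fun_eq_iff)

lemma compose_vcomp: "f \<circ> vcomp \<beta> \<alpha> = vcomp (f \<circ> \<beta>) (f \<circ> \<alpha>)"
  by (auto simp: vcomp_def fun_eq_iff)

lemma htpy_double_functor_simps [simp]:
  "map_Ob (htpy_double_functor Y f) = path_image_map f"
  "map_Hor (htpy_double_functor Y f) = map_prod (path_image_map f) (path_image_map f)"
  "map_Ver (htpy_double_functor Y f) = map_prod (path_image_map f) (path_image_map f)"
  by (simp_all add: htpy_double_functor_def)

lemma map_Sq_class:
  assumes "continuous_map X Y f" "continuous_map unit_sq X \<alpha>"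
  shows "map_Sq (htpy_double_functor Y f) (sq_class X \<alpha>) = sq_class Y (f \<circ> \<alpha>)"
  using sq_class_eqI[OF sq_homotopic_compose[OF rep_sq_class[OF assms(2)] assms(1)]]
  by (simp add: htpy_double_functor_def)

lemma double_functor_Pi:
  assumes f: "continuous_map X Y f"
  shows "double_functor (htpy_double_groupoid X) (htpy_double_groupoid Y) (htpy_double_functor Y f)"
proof -
  have f\<alpha>: "continuous_map unit_sq Y (f \<circ> \<alpha>)" if "continuous_map unit_sq X \<alpha>" for \<alpha>
    using that f by (rule continuous_map_compose)
  have h: "sq_class Y (f \<circ> sq_idn_h u v) = sq_class Y (sq_idn_h (path_image_map f u) (path_image_map f v))"
    if "u \<in> paths X" "v \<in> paths X" "u 0 = v 0" for u v
    by (rule sq_class_eqI, rule sq_homotopic_cong)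
       (use f\<alpha>[OF sq_idn_continuous(1)[OF that]] in \<open>auto simp: sq_idn_h_def\<close>)
  have v: "sq_class Y (f \<circ> sq_idn_v u v) = sq_class Y (sq_idn_v (path_image_map f u) (path_image_map f v))"
    if "u \<in> paths X" "v \<in> paths X" "u 1 = v 1" for u v
    by (rule sq_class_eqI, rule sq_homotopic_cong)
       (use f\<alpha>[OF sq_idn_continuous(2)[OF that]] in \<open>auto simp: sq_idn_v_def\<close>)
  have "is_functor (Pi_Hor X) (Pi_Hor Y) (path_image_map f) (map_prod (path_image_map f) (path_image_map f))"
    "is_functor (Pi_Ver X) (Pi_Ver Y) (path_image_map f) (map_prod (path_image_map f) (path_image_map f))"
    by (auto simp: is_functor_def intro: path_image_map_in_paths[OF f])
  moreover have "is_functor (Pi_SqH X) (Pi_SqH Y) (map_prod (path_image_map f) (path_image_map f))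
      (map_Sq (htpy_double_functor Y f))"
    unfolding is_functor_def
    by (intro conjI ballI impI; auto elim!: squaresE simp: map_Sq_class[OF f] path_image_map_in_paths[OF f] f\<alpha> h Pi_rules compose_hcomp)
  moreover have "is_functor (Pi_SqV X) (Pi_SqV Y) (map_prod (path_image_map f) (path_image_map f))
      (map_Sq (htpy_double_functor Y f))"
    unfolding is_functor_def
    by (intro conjI ballI impI; auto elim!: squaresE simp: map_Sq_class[OF f] path_image_map_in_paths[OF f] f\<alpha> v Pi_rules compose_vcomp)
  ultimately show ?thesis by (simp add: double_functor_def)
qed

section \<open>Comparison of the homotopy groups\<close>

text \<open>The maps induced on path components, \<open>pi0\<close>, \<open>pi1\<close> and the
  homotopy groups of spaces all have this shape. The right-hand side speaks of representatives only,
  which makes the classical and the double-groupoid versions comparable.\<close>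

lemma bij_betw_quotient_iff:
  assumes A: "equiv A r" and B: "equiv B s"
    and F: "\<And>x. x \<in> A \<Longrightarrow> F x \<in> B" and resp: "\<And>x y. (x, y) \<in> r \<Longrightarrow> (F x, F y) \<in> s"
  shows "bij_betw (\<lambda>C. \<Union>x\<in>C. s `` {F x}) (A // r) (B // s) \<longleftrightarrow>
    (\<forall>x\<in>A. \<forall>y\<in>A. (F x, F y) \<in> s \<longrightarrow> (x, y) \<in> r) \<and> (\<forall>z\<in>B. \<exists>x\<in>A. (F x, z) \<in> s)"
    (is "bij_betw ?G _ _ \<longleftrightarrow> ?inj \<and> ?surj")
proof -
  have G: "?G (r `` {x}) = s `` {F x}" if "x \<in> A" for x
  proof -
    have "s `` {F y} = s `` {F x}" if "y \<in> r `` {x}" for y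
      using that resp[of x y] equiv_class_eq[OF B, of "F x" "F y"] by blast
    moreover have "x \<in> r `` {x}" using A \<open>x \<in> A\<close> by (rule equiv_class_self)
    ultimately show ?thesis by blast
  qed
  have "inj_on ?G (A // r) \<longleftrightarrow> ?inj"
  proof
    assume inj: "inj_on ?G (A // r)"
    show ?inj
    proof (intro ballI impI)
      fix x y assume xy: "x \<in> A" "y \<in> A" "(F x, F y) \<in> s"
      then have "?G (r `` {x}) = ?G (r `` {y})" unfolding G[OF xy(1)] G[OF xy(2)] by (intro equiv_class_eq[OF B])
      then have "r `` {x} = r `` {y}"
        by (rule inj_onD[OF inj _ quotientI[OF xy(1)] quotientI[OF xy(2)]])
      then show "(x, y) \<in> r" using eq_equiv_class[OF _ A xy(2)] by blast
    qed
  next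
    assume inj: ?inj
    show "inj_on ?G (A // r)"
    proof (rule inj_onI, elim quotientE, clarify)
      fix x y assume xy: "x \<in> A" "y \<in> A" "?G (r `` {x}) = ?G (r `` {y})"
      then have "(F x, F y) \<in> s" using eq_equiv_class[OF _ B F[OF xy(2)]] by (simp add: G)
      then show "r `` {x} = r `` {y}" using inj xy equiv_class_eq[OF A] by blast
    qed
  qed
  moreover have "?G ` (A // r) = B // s \<longleftrightarrow> ?surj"
  proof
    assume surj: "?G ` (A // r) = B // s"
    show ?surj
    proof
      fix z assume z: "z \<in> B"
      have "s `` {z} \<in> ?G ` (A // r)" unfolding surj by (rule quotientI[OF z])
      then obtain C where C: "C \<in> A // r" "s `` {z} = ?G C" by (rule imageE)
      then obtain x where x: "x \<in> A" "C = r `` {x}" by (elim quotientE)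
      with C have "s `` {F x} = s `` {z}" by (simp only: G)
      then show "\<exists>x\<in>A. (F x, z) \<in> s" using eq_equiv_class[OF _ B z] x(1) by blast
    qed
  next
    assume surj: ?surj
    show "?G ` (A // r) = B // s"
    proof (intro equalityI subsetI)
      fix C assume "C \<in> ?G ` (A // r)"
      then obtain D where D: "D \<in> A // r" "C = ?G D" by (rule imageE)
      then obtain x where x: "x \<in> A" "D = r `` {x}" by (elim quotientE)
      with D have "C = s `` {F x}" by (simp only: G)
      then show "C \<in> B // s" using quotientI[OF F[OF x(1)]] by simp
    next
      fix C assume "C \<in> B // s"
      then obtain z where z: "z \<in> B" "C = s `` {z}" by (auto elim: quotientE)
      then obtain x where x: "x \<in> A" "(F x, z) \<in> s" using surj by blast
      then have "C = ?G (r `` {x})" unfolding G[OF x(1)] z(2) by (intro equiv_class_eq[OF B, symmetric])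
      then show "C \<in> ?G ` (A // r)" using quotientI[OF x(1)] by (rule image_eqI)
    qed
  qed
  ultimately show ?thesis by (auto simp: bij_betw_def)
qed


subsection \<open>Path components\<close>

definition const_path :: "'a \<Rightarrow> 'a path" where
  "const_path x = (\<lambda>t\<in>{0..1}. x)"

lemma const_path_in_paths [simp]: "x \<in> topspace X \<Longrightarrow> const_path x \<in> paths X"
  unfolding const_path_def by (intro restrict_in_paths) simp

lemma const_path_apply [simp]: "0 \<le> t \<Longrightarrow> t \<le> 1 \<Longrightarrow> const_path x t = x"
  by (simp add: const_path_def)

lemma path_image_const_path [simp]: "path_image_map f (const_path x) = const_path (f x)"
  by (auto simp: path_image_map_def const_path_def)

lemma paths_in_topspace: "u \<in> paths X \<Longrightarrow> 0 \<le> t \<Longrightarrow> t \<le> 1 \<Longrightarrow> u t \<in> topspace X"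
  using path_image_subset_topspace pathsD by fastforce

lemma path_component_of_path:
  assumes "u \<in> paths X" shows "path_component_of X (u 0) (u 1)"
  using assms pathsD by (auto simp: path_component_of_def)

text \<open>The intermediate object of the definition is a path from \<open>a 0\<close> to
  \<open>b 1\<close>, and \<open>b\<close> itself joins \<open>b 0\<close> to
  \<open>b 1\<close>.\<close>

lemma conn_rel_Pi:
  "conn_rel (htpy_double_groupoid X) =
    {(a, b). a \<in> paths X \<and> b \<in> paths X \<and> path_component_of X (a 0) (b 0)}"
proof -
  have "(a, b) \<in> conn_rel (htpy_double_groupoid X) \<longleftrightarrow>
    a \<in> paths X \<and> b \<in> paths X \<and> path_component_of X (a 0) (b 0)" for a b
  proof
    assume "(a, b) \<in> conn_rel (htpy_double_groupoid X)"
    then obtain w where "a \<in> paths X" "b \<in> paths X" "w \<in> paths X" "w 1 = b 1" "a 0 = w 0"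
      by (auto simp: conn_rel_def)
    then show "a \<in> paths X \<and> b \<in> paths X \<and> path_component_of X (a 0) (b 0)"
      by (metis path_component_of_path path_component_of_sym path_component_of_trans)
  next
    assume ab: "a \<in> paths X \<and> b \<in> paths X \<and> path_component_of X (a 0) (b 0)"
    then have "path_component_of X (a 0) (b 1)"
      using path_component_of_path path_component_of_trans by metis
    then obtain g where g: "pathin X g" "g 0 = a 0" "g 1 = b 1" by (auto simp: path_component_of_def)
    define w where "w = restrict g {0..1}"
    have "w \<in> paths X" "w 0 = a 0" "w 1 = b 1" using g by (auto simp: w_def intro: restrict_in_paths)
    then have "(w, b) \<in> Mor (Pi_Hor X)" "(a, w) \<in> Mor (Pi_Ver X)" using ab by auto
    then show "(a, b) \<in> conn_rel (htpy_double_groupoid X)"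
      unfolding conn_rel_def htpy_double_groupoid_simps
      by (intro CollectI case_prodI bexI[of _ "(w, b)"] bexI[of _ "(a, w)"]) simp_all
  qed
  then show ?thesis by auto
qed

lemma equiv_path_component:
  "equiv (topspace X) {(x, y). path_component_of X x y}"
  by (intro equivI refl_onI symI transI)
     (auto simp: path_component_of_refl intro: path_component_of_sym path_component_of_trans
       dest: path_component_in_topspace)

lemma bij_betw_path_components_iff:
  assumes "continuous_map X Y f"
  shows "bij_betw (\<lambda>C. \<Union>x\<in>C. path_component_of_set Y (f x)) (path_components_of X) (path_components_of Y) \<longleftrightarrow>
    (\<forall>x\<in>topspace X. \<forall>y\<in>topspace X. path_component_of Y (f x) (f y) \<longrightarrow> path_component_of X x y) \<and>
    (\<forall>z\<in>topspace Y. \<exists>x\<in>topspace X. path_component_of Y (f x) z)"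
proof -
  have *: "path_components_of X = topspace X // {(x, y). path_component_of X x y}" for X :: "'c topology"
    by (auto simp: quotient_def Image_def path_components_of_def)
  have "path_component_of Y (f x) (f y)" if "path_component_of X x y" for x y
    using that pathin_compose[OF _ assms] by (fastforce simp: path_component_of_def)
  moreover have "f x \<in> topspace Y" if "x \<in> topspace X" for x
    using assms that by (auto simp: continuous_map_def)
  ultimately show ?thesis
    unfolding *
    using bij_betw_quotient_iff[OF equiv_path_component[of X] equiv_path_component[of Y], of f]
    by (simp add: Image_def)
qed

text \<open>Points become objects as constant paths, and objects become points by evaluation at
  0.\<close>

lemma bij_betw_pi0_iff:
  assumes f: "continuous_map X Y f"
  shows "bij_betw (pi0_map (htpy_double_groupoid Y) (htpy_double_functor Y f))
      (pi0 (htpy_double_groupoid X)) (pi0 (htpy_double_groupoid Y)) \<longleftrightarrow>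
    bij_betw (\<lambda>C. \<Union>x\<in>C. path_component_of_set Y (f x)) (path_components_of X) (path_components_of Y)"
proof -
  have equiv: "equiv (paths X) (conn_rel (htpy_double_groupoid X))" for X :: "'c topology"
    unfolding conn_rel_Pi
    by (intro equivI refl_onI symI transI)
       (auto simp: path_component_of_refl paths_in_topspace
         intro: path_component_of_sym path_component_of_trans)
  have "path_component_of Y (f x) (f y)" if "path_component_of X x y" for x y
    using that pathin_compose[OF _ f] by (fastforce simp: path_component_of_def)
  then have "bij_betw (pi0_map (htpy_double_groupoid Y) (htpy_double_functor Y f))
      (pi0 (htpy_double_groupoid X)) (pi0 (htpy_double_groupoid Y)) \<longleftrightarrow>
    (\<forall>x\<in>paths X. \<forall>y\<in>paths X. (path_image_map f x, path_image_map f y) \<in> conn_rel (htpy_double_groupoid Y) \<longrightarrow>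
      (x, y) \<in> conn_rel (htpy_double_groupoid X)) \<and>
    (\<forall>z\<in>paths Y. \<exists>x\<in>paths X. (path_image_map f x, z) \<in> conn_rel (htpy_double_groupoid Y))"
    unfolding pi0_def pi0_map_def htpy_double_functor_simps htpy_double_groupoid_simps Pi_simps(1)
    by (intro bij_betw_quotient_iff equiv path_image_map_in_paths[OF f])
       (auto simp: conn_rel_Pi path_image_map_in_paths[OF f])
  also have "\<dots> \<longleftrightarrow>
    (\<forall>x\<in>topspace X. \<forall>y\<in>topspace X. path_component_of Y (f x) (f y) \<longrightarrow> path_component_of X x y) \<and>
    (\<forall>z\<in>topspace Y. \<exists>x\<in>topspace X. path_component_of Y (f x) z)"
  proof (intro conj_cong iffI ballI impI)
    fix x y
    assume "\<forall>x\<in>paths X. \<forall>y\<in>paths X. (path_image_map f x, path_image_map f y) \<in> conn_rel (htpy_double_groupoid Y) \<longrightarrow>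
      (x, y) \<in> conn_rel (htpy_double_groupoid X)"
      "x \<in> topspace X" "y \<in> topspace X" "path_component_of Y (f x) (f y)"
    then show "path_component_of X x y"
      by (elim ballE[of _ _ "const_path x"] ballE[of _ _ "const_path y"])
         (auto simp: conn_rel_Pi path_component_in_topspace)
  next
    fix z
    assume surj: "\<forall>z\<in>paths Y. \<exists>x\<in>paths X. (path_image_map f x, z) \<in> conn_rel (htpy_double_groupoid Y)"
      and z: "z \<in> topspace Y"
    then obtain w where "w \<in> paths X" "(path_image_map f w, const_path z) \<in> conn_rel (htpy_double_groupoid Y)"
      by (meson const_path_in_paths)
    then show "\<exists>x\<in>topspace X. path_component_of Y (f x) z"
      by (intro bexI[of _ "w 0"]) (auto simp: conn_rel_Pi paths_in_topspace)
  next
    fix w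
    assume surj: "\<forall>z\<in>topspace Y. \<exists>x\<in>topspace X. path_component_of Y (f x) z" and w: "w \<in> paths Y"
    then obtain x where "x \<in> topspace X" "path_component_of Y (f x) (w 0)"
      using paths_in_topspace[OF w, of 0] by auto
    then show "\<exists>x\<in>paths X. (path_image_map f x, w) \<in> conn_rel (htpy_double_groupoid Y)"
      using w by (intro bexI[of _ "const_path x"]) (auto simp: conn_rel_Pi path_component_in_topspace)
  qed (auto simp: conn_rel_Pi path_image_map_in_paths[OF f] paths_in_topspace)
  finally show ?thesis by (simp add: bij_betw_path_components_iff[OF f])
qed


subsection \<open>Existence of squares with given sides\<close>

text \<open>The relation and the product of \<open>pi1\<close> depend only on whether a square with
  given sides exists. The rules that follow are what compositions, inverses and fillings of squares
  imply for this predicate.\<close>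

definition has_square :: "'a topology \<Rightarrow> 'a path \<Rightarrow> 'a path \<Rightarrow> 'a path \<Rightarrow> 'a path \<Rightarrow> bool" where
  "has_square X u v u' v' \<longleftrightarrow>
     (\<exists>\<alpha>. continuous_map unit_sq X \<alpha> \<and> side_u \<alpha> = u \<and> side_v \<alpha> = v \<and> side_u' \<alpha> = u' \<and> side_v' \<alpha> = v')"

lemma has_squareI: "continuous_map unit_sq X \<alpha> \<Longrightarrow> has_square X (side_u \<alpha>) (side_v \<alpha>) (side_u' \<alpha>) (side_v' \<alpha>)"
  by (auto simp: has_square_def)

lemma has_square_paths:
  assumes "has_square X u v u' v'"
  shows "u \<in> paths X" "v \<in> paths X" "u' \<in> paths X" "v' \<in> paths X"
    "u 0 = v 0" "u 1 = u' 1" "v' 0 = u' 0" "v' 1 = v 1"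
  using assms unfolding has_square_def by (auto simp: side_ends)

lemma has_square_hcomp:
  assumes "has_square X u v u' v'" "has_square X u' v' u'' v''"
  shows "has_square X u v u'' v''"
proof -
  obtain \<alpha> \<beta> where "continuous_map unit_sq X \<alpha>" "continuous_map unit_sq X \<beta>" "hcompat \<beta> \<alpha>"
    "side_u \<alpha> = u" "side_v \<alpha> = v" "side_u' \<beta> = u''" "side_v' \<beta> = v''"
    using assms unfolding has_square_def hcompat_iff by metis
  then show ?thesis using has_squareI[OF hcomp_continuous[of X \<alpha> \<beta>]] by simp
qed

lemma has_square_vcomp:
  assumes "has_square X u v u' v'" "has_square X v w v' w'"
  shows "has_square X u w u' w'"
proof -
  obtain \<alpha> \<beta> where "continuous_map unit_sq X \<alpha>" "continuous_map unit_sq X \<beta>" "vcompat \<beta> \<alpha>"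
    "side_u \<alpha> = u" "side_u' \<alpha> = u'" "side_v \<beta> = w" "side_v' \<beta> = w'"
    using assms unfolding has_square_def vcompat_iff by metis
  then show ?thesis using has_squareI[OF vcomp_continuous[of X \<alpha> \<beta>]] by simp
qed

lemma has_square_hinv: "has_square X u v u' v' \<Longrightarrow> has_square X u' v' u v"
  unfolding has_square_def using hinv_continuous side_hinv by metis

lemma has_square_vinv: "has_square X u v u' v' \<Longrightarrow> has_square X v u v' u'"
  unfolding has_square_def using vinv_continuous side_vinv by metis

lemma has_square_idn_h: "\<lbrakk>u \<in> paths X; v \<in> paths X; u 0 = v 0\<rbrakk> \<Longrightarrow> has_square X u v u v"
  using has_squareI[OF sq_idn_continuous(1)[of u X v]] by (simp add: paths_extensional)

lemma has_square_compose:
  assumes "continuous_map X Y f" "has_square X u v u' v'"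
  shows "has_square Y (path_image_map f u) (path_image_map f v) (path_image_map f u') (path_image_map f v')"
proof -
  obtain \<alpha> where \<alpha>: "continuous_map unit_sq X \<alpha>" "side_u \<alpha> = u" "side_v \<alpha> = v" "side_u' \<alpha> = u'" "side_v' \<alpha> = v'"
    using assms(2) by (auto simp: has_square_def)
  show ?thesis
    using has_squareI[OF continuous_map_compose[OF \<alpha>(1) assms(1)]] \<alpha> by simp
qed

lemma has_square_fill_u':
  assumes "u \<in> paths X" "v \<in> paths X" "v' \<in> paths X" "u 0 = v 0" "v' 1 = v 1"
  obtains u' where "has_square X u v u' v'"
  using square_with_three_sides[OF assms] has_squareI by metis

text \<open>Horizontal and vertical inverses permute the four sides, so the missing one can be moved
  to the place of \<open>u'\<close>.\<close>

lemma has_square_fill_v: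
  assumes "u \<in> paths X" "u' \<in> paths X" "v' \<in> paths X" "u 1 = u' 1" "v' 0 = u' 0"
  obtains v where "has_square X u v u' v'"
  using has_square_fill_u'[of v' X u' u] assms has_square_vinv has_square_hinv by metis

lemma has_square_fill_u:
  assumes "v \<in> paths X" "u' \<in> paths X" "v' \<in> paths X" "v' 1 = v 1" "v' 0 = u' 0"
  obtains u where "has_square X u v u' v'"
  using has_square_fill_u'[of u' X v' v] assms has_square_hinv by metis


subsection \<open>The fundamental groups\<close>

text \<open>For paths \<open>w\<close> and \<open>w'\<close> with the ends of \<open>a\<close>, a square with sides \<open>a\<close>, \<open>w\<close>, \<open>a\<close>, \<open>w'\<close> exists iff
  \<open>w\<close> and \<open>w'\<close> are homotopic relative to the ends. In this form the relation depends on \<open>a\<close> only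
  through its ends.\<close>

lemma has_square_change_base:
  assumes "has_square X a w a w'" "b \<in> paths X" "b 0 = a 0"
  shows "has_square X b w b w'"
  \<comment> \<open>The horizontal identity with sides \<open>b\<close>, \<open>a\<close>,
    \<open>b\<close>, \<open>a\<close> exists because \<open>b\<close> and \<open>a\<close> start at
    the same point; the given square is composed with it vertically.\<close>
  using has_square_vcomp[OF has_square_idn_h] has_square_paths[OF assms(1)] assms by metis

definition paths_along :: "'a topology \<Rightarrow> 'a path \<Rightarrow> 'a path set" where
  "paths_along X a = {w \<in> paths X. w 0 = a 0 \<and> w 1 = a 1}"

definition along_rel :: "'a topology \<Rightarrow> 'a path \<Rightarrow> ('a path \<times> 'a path) set" where
  "along_rel X a = {(w, w'). w \<in> paths_along X a \<and> w' \<in> paths_along X a \<and> has_square X a w a w'}"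

text \<open>A horizontal morphism to \<open>a\<close> and a vertical one from \<open>a\<close> that
  meet are determined by the object \<open>w\<close> where they meet.\<close>

definition path_pair :: "'a path \<Rightarrow> 'a path \<Rightarrow> ('a path \<times> 'a path) \<times> ('a path \<times> 'a path)" where
  "path_pair a w = ((w, a), (a, w))"

lemma path_pair_inject [simp]: "path_pair a w = path_pair a w' \<longleftrightarrow> w = w'"
  by (auto simp: path_pair_def)

lemma pi1_pairs_Pi:
  "a \<in> paths X \<Longrightarrow> pi1_pairs (htpy_double_groupoid X) a = path_pair a ` paths_along X a"
  by (auto simp: pi1_pairs_def paths_along_def path_pair_def)

text \<open>The two squares of the definition share their horizontal target, so one followed by the
  inverse of the other has sides \<open>a\<close>, \<open>w\<close>, \<open>a\<close>,
  \<open>w'\<close>. Conversely, filling three sides yields one of them, and composition with the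
  given square the other.\<close>

lemma pi1_rel_Pi:
  assumes a: "a \<in> paths X"
  shows "pi1_rel (htpy_double_groupoid X) a = map_prod (path_pair a) (path_pair a) ` along_rel X a"
proof -
  have *: "has_square X a w a w' \<longleftrightarrow> (\<exists>\<alpha>\<in>squares X. \<exists>\<alpha>'\<in>squares X.
      Tgt (Pi_SqH X) \<alpha> = Tgt (Pi_SqH X) \<alpha>' \<and> Src (Pi_SqV X) \<alpha> = Src (Pi_SqV X) \<alpha>' \<and>
      Src (Pi_SqH X) \<alpha> = (a, w) \<and> Tgt (Pi_SqV X) \<alpha> = (w, a) \<and>
      Src (Pi_SqH X) \<alpha>' = (a, w') \<and> Tgt (Pi_SqV X) \<alpha>' = (w', a))" (is "_ \<longleftrightarrow> ?R")
    if w: "w \<in> paths_along X a" "w' \<in> paths_along X a" for w w'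
  proof
    assume sq: "has_square X a w a w'"
    obtain b where b: "has_square X a w b a"
      using has_square_fill_u'[of a X w a] a w by (auto simp: paths_along_def)
    have b': "has_square X a w' b a"
      by (rule has_square_hcomp[OF has_square_hinv[OF sq] b])
    obtain \<alpha> where \<alpha>: "continuous_map unit_sq X \<alpha>" "side_u \<alpha> = a" "side_v \<alpha> = w" "side_u' \<alpha> = b" "side_v' \<alpha> = a"
      using b by (auto simp: has_square_def)
    obtain \<beta> where \<beta>: "continuous_map unit_sq X \<beta>" "side_u \<beta> = a" "side_v \<beta> = w'" "side_u' \<beta> = b" "side_v' \<beta> = a"
      using b' by (auto simp: has_square_def)
    show ?R
      using \<alpha> \<beta> by (intro bexI[of _ "sq_class X \<alpha>"] bexI[of _ "sq_class X \<beta>"]) auto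
  next
    assume ?R
    then obtain \<alpha> \<beta> where \<alpha>: "continuous_map unit_sq X \<alpha>" "side_u \<alpha> = a" "side_v \<alpha> = w" "side_v' \<alpha> = a"
      and \<beta>: "continuous_map unit_sq X \<beta>" "side_u \<beta> = a" "side_v \<beta> = w'" "side_v' \<beta> = a"
      and "side_u' \<alpha> = side_u' \<beta>"
      by (elim bexE conjE squaresE) simp
    then have "has_square X a w (side_u' \<beta>) a" "has_square X a w' (side_u' \<beta>) a"
      using has_squareI[OF \<alpha>(1)] has_squareI[OF \<beta>(1)] by simp_all
    then show "has_square X a w a w'"
      using has_square_hcomp has_square_hinv by metis
  qed
  have mem: "(path_pair a w, path_pair a w') \<in> pi1_rel (htpy_double_groupoid X) a \<longleftrightarrow> (w, w') \<in> along_rel X a"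
    for w w'
  proof (cases "w \<in> paths_along X a \<and> w' \<in> paths_along X a")
    case True
    then have "path_pair a w \<in> pi1_pairs (htpy_double_groupoid X) a"
      "path_pair a w' \<in> pi1_pairs (htpy_double_groupoid X) a"
      by (simp_all add: pi1_pairs_Pi[OF a])
    then show ?thesis using True *[of w w'] by (simp add: pi1_rel_def along_rel_def path_pair_def)
  next
    case False
    then show ?thesis
      using pi1_pairs_Pi[OF a] by (auto simp: pi1_rel_def along_rel_def)
  qed
  show ?thesis
  proof (intro equalityI subrelI)
    fix p q assume pq: "(p, q) \<in> pi1_rel (htpy_double_groupoid X) a"
    then have "p \<in> path_pair a ` paths_along X a" "q \<in> path_pair a ` paths_along X a"
      unfolding pi1_pairs_Pi[OF a, symmetric] by (auto simp: pi1_rel_def)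
    then show "(p, q) \<in> map_prod (path_pair a) (path_pair a) ` along_rel X a"
      using pq mem by (auto intro!: image_eqI)
  qed (use mem in auto)
qed


lemma has_square_refl:
  "\<lbrakk>a \<in> paths X; w \<in> paths_along X a\<rbrakk> \<Longrightarrow> has_square X a w a w"
  by (rule has_square_idn_h) (auto simp: paths_along_def)

lemma equiv_along_rel:
  assumes "a \<in> paths X"
  shows "equiv (paths_along X a) (along_rel X a)"
  using assms has_square_refl has_square_hinv has_square_hcomp
  by (intro equivI refl_onI symI transI; unfold along_rel_def) (blast, blast, blast, blast)

lemma paths_along_compose:
  "\<lbrakk>continuous_map X Y f; w \<in> paths_along X a\<rbrakk> \<Longrightarrow> path_image_map f w \<in> paths_along Y (path_image_map f a)"
  by (auto simp: paths_along_def path_image_map_in_paths)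

lemma along_rel_compose:
  "\<lbrakk>continuous_map X Y f; (w, w') \<in> along_rel X a\<rbrakk> \<Longrightarrow>
     (path_image_map f w, path_image_map f w') \<in> along_rel Y (path_image_map f a)"
  by (auto simp: along_rel_def paths_along_compose has_square_compose)

lemma equiv_pi1_rel:
  assumes "a \<in> paths X"
  shows "equiv (pi1_pairs (htpy_double_groupoid X) a) (pi1_rel (htpy_double_groupoid X) a)"
proof -
  have "refl_on (paths_along X a) (along_rel X a)" "sym (along_rel X a)" "trans (along_rel X a)"
    using equiv_along_rel[OF assms] by (auto simp: equiv_def)
  note along = this
  let ?P = "path_pair a ` paths_along X a" and ?R = "map_prod (path_pair a) (path_pair a) ` along_rel X a"
  have "?R \<subseteq> ?P \<times> ?P" by (auto simp: along_rel_def)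
  moreover have "refl_on ?P ?R"
  proof (rule refl_onI)
    fix p assume "p \<in> ?P"
    then obtain w where "p = path_pair a w" "w \<in> paths_along X a" by blast
    then show "(p, p) \<in> ?R" using refl_onD[OF along(1)] by (intro image_eqI[of _ _ "(w, w)"]) auto
  qed
  moreover have "sym ?R"
  proof (rule symI)
    fix p q assume "(p, q) \<in> ?R"
    then obtain v w where "p = path_pair a v" "q = path_pair a w" "(v, w) \<in> along_rel X a" by auto
    then show "(q, p) \<in> ?R" using symD[OF along(2)] by auto
  qed
  moreover have "trans ?R"
  proof (rule transI)
    fix p q r assume "(p, q) \<in> ?R" "(q, r) \<in> ?R"
    then obtain u v w where "p = path_pair a u" "r = path_pair a w" "(u, v) \<in> along_rel X a" "(v, w) \<in> along_rel X a"
      by auto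
    then show "(p, r) \<in> ?R" using transD[OF along(3)] by auto
  qed
  ultimately show ?thesis
    unfolding pi1_pairs_Pi[OF assms] pi1_rel_Pi[OF assms] by (intro equivI)
qed

lemma pi1_rel_path_pair:
  assumes "a \<in> paths X"
  shows "(path_pair a w, path_pair a w') \<in> pi1_rel (htpy_double_groupoid X) a \<longleftrightarrow> (w, w') \<in> along_rel X a"
  unfolding pi1_rel_Pi[OF assms] by auto

text \<open>The right-hand side of \<open>bij_betw_quotient_iff\<close> for \<open>pi1\<close>, in
  terms of the middle objects. Both \<open>pi1\<close> and \<open>htpy_group 1\<close> are compared
  with this condition.\<close>

definition pi1_bij :: "'a topology \<Rightarrow> 'b topology \<Rightarrow> ('a \<Rightarrow> 'b) \<Rightarrow> 'a path \<Rightarrow> bool" where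
  "pi1_bij X Y f a \<longleftrightarrow>
    (\<forall>w\<in>paths_along X a. \<forall>w'\<in>paths_along X a.
       (path_image_map f w, path_image_map f w') \<in> along_rel Y (path_image_map f a) \<longrightarrow> (w, w') \<in> along_rel X a) \<and>
    (\<forall>z\<in>paths_along Y (path_image_map f a). \<exists>w\<in>paths_along X a.
       (path_image_map f w, z) \<in> along_rel Y (path_image_map f a))"

lemma map_path_pair:
  "(case path_pair a w of (g, u) \<Rightarrow> (map_Hor (htpy_double_functor Y f) g, map_Ver (htpy_double_functor Y f) u))
    = path_pair (path_image_map f a) (path_image_map f w)"
  by (simp add: path_pair_def)

lemma bij_betw_pi1_iff:
  assumes f: "continuous_map X Y f" and a: "a \<in> paths X"
  shows "bij_betw (pi1_map (htpy_double_groupoid Y) (htpy_double_functor Y f) a)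
      (carrier (pi1 (htpy_double_groupoid X) a))
      (carrier (pi1 (htpy_double_groupoid Y) (path_image_map f a))) \<longleftrightarrow> pi1_bij X Y f a"
proof -
  let ?F = "\<lambda>(g, u). (map_Hor (htpy_double_functor Y f) g, map_Ver (htpy_double_functor Y f) u)"
  have fa: "path_image_map f a \<in> paths Y" by (rule path_image_map_in_paths[OF f a])
  have map: "pi1_map (htpy_double_groupoid Y) (htpy_double_functor Y f) a =
    (\<lambda>C. \<Union>p\<in>C. pi1_rel (htpy_double_groupoid Y) (path_image_map f a) `` {?F p})"
    by (simp add: pi1_map_def fun_eq_iff case_prod_unfold)
  show ?thesis
    unfolding map pi1_def monoid.simps partial_object.simps
    apply (subst bij_betw_quotient_iff[OF equiv_pi1_rel[OF a] equiv_pi1_rel[OF fa]])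
    subgoal
      using map_path_pair[where Y = Y and f = f and a = a] paths_along_compose[OF f]
      by (auto simp: pi1_pairs_Pi[OF a] pi1_pairs_Pi[OF fa])
    subgoal
      using map_path_pair[where Y = Y and f = f and a = a] along_rel_compose[OF f]
      by (auto simp: pi1_rel_Pi[OF a] pi1_rel_path_pair[OF fa])
    subgoal
      unfolding pi1_pairs_Pi[OF a] pi1_pairs_Pi[OF fa] ball_simps bex_simps map_path_pair
        pi1_rel_path_pair[OF a] pi1_rel_path_pair[OF fa] pi1_bij_def by simp
    done
qed

text \<open>A square \<gamma> as in the definition of the product has sides \<open>w2\<close>,
  \<open>w3\<close>, \<open>a\<close>, \<open>w1\<close>, and the product is the class of its free
  side \<open>w3\<close>. As the product is a union over all choices, every other choice has to
  yield the same class.\<close>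

lemma pi1_mult_Pi:
  assumes a: "a \<in> paths X" and w: "w1 \<in> paths_along X a" "w2 \<in> paths_along X a"
    and sq: "has_square X w2 w3 a w1"
  shows "mult (pi1 (htpy_double_groupoid X) a)
      (pi1_rel (htpy_double_groupoid X) a `` {path_pair a w1})
      (pi1_rel (htpy_double_groupoid X) a `` {path_pair a w2})
    = pi1_rel (htpy_double_groupoid X) a `` {path_pair a w3}"
proof -
  let ?r = "pi1_rel (htpy_double_groupoid X) a"
  let ?M = "{?r `` {(Cmp (Pi_Hor X) g1 (Tgt (Pi_SqV X) \<gamma>), Cmp (Pi_Ver X) (Src (Pi_SqH X) \<gamma>) u2)}
      | g1 u1 g2 u2 \<gamma>. (g1, u1) \<in> ?r `` {path_pair a w1} \<and> (g2, u2) \<in> ?r `` {path_pair a w2} \<and>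
          \<gamma> \<in> squares X \<and> Src (Pi_SqV X) \<gamma> = g2 \<and> Tgt (Pi_SqH X) \<gamma> = u1}"
  have "?M = {?r `` {path_pair a w3}}"
  proof (intro equalityI subsetI)
    fix C assume "C \<in> ?M"
    then obtain g1 u1 g2 u2 \<gamma> where C: "C = ?r `` {(Cmp (Pi_Hor X) g1 (Tgt (Pi_SqV X) \<gamma>), Cmp (Pi_Ver X) (Src (Pi_SqH X) \<gamma>) u2)}"
      and 1: "(g1, u1) \<in> ?r `` {path_pair a w1}" and 2: "(g2, u2) \<in> ?r `` {path_pair a w2}"
      and \<gamma>: "\<gamma> \<in> squares X" "Src (Pi_SqV X) \<gamma> = g2" "Tgt (Pi_SqH X) \<gamma> = u1" by blast
    obtain v1 where v1: "(g1, u1) = path_pair a v1" "(w1, v1) \<in> along_rel X a"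
      using 1 unfolding pi1_rel_Pi[OF a] by auto
    obtain v2 where v2: "(g2, u2) = path_pair a v2" "(w2, v2) \<in> along_rel X a"
      using 2 unfolding pi1_rel_Pi[OF a] by auto
    obtain c where c: "\<gamma> = sq_class X c" "continuous_map unit_sq X c" using \<gamma>(1) by (rule squaresE)
    have sides: "side_u c = v2" "side_u' c = a" "side_v' c = v1"
      using \<gamma> c v1(1) v2(1) by (auto simp: path_pair_def)
    define v3 where "v3 = side_v c"
    have sq': "has_square X v2 v3 a v1" using has_squareI[OF c(2)] sides by (simp add: v3_def)
    have "C = ?r `` {path_pair a v3}"
      using C c v1(1) v2(1) sides by (simp add: path_pair_def v3_def)
    moreover have "(w3, v3) \<in> along_rel X a"
    proof -
      have e: "v3 \<in> paths_along X a" "w3 \<in> paths_along X a"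
        using has_square_paths[OF sq] has_square_paths[OF sq'] w v1(2) v2(2)
        by (auto simp: along_rel_def paths_along_def)
      \<comment> \<open>The chain of squares: first from \<open>v2\<close> to \<open>w2\<close>,
        completed vertically by a square on \<open>w3\<close>; then the given square; then the one
        from \<open>w1\<close> to \<open>v1\<close>; and finally the inverse of the other product
        square. The outer sides compare \<open>w3\<close> with \<open>v3\<close>.\<close>
      have "has_square X v2 a w2 a"
        using v2(2) has_square_hinv[OF has_square_vinv] by (auto simp: along_rel_def)
      then have "has_square X v2 w3 w2 w3"
        by (rule has_square_vcomp[OF _ has_square_refl[OF a e(2)]])
      then have "has_square X v2 w3 a v1"
        using has_square_hcomp sq v1(2) unfolding along_rel_def by blast
      then have "has_square X v2 w3 v2 v3"
        by (rule has_square_hcomp[OF _ has_square_hinv[OF sq']])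
      then have "has_square X a w3 a v3"
        by (rule has_square_change_base) (use a v2(2) in \<open>auto simp: along_rel_def paths_along_def\<close>)
      with e show ?thesis by (simp add: along_rel_def)
    qed
    then have "?r `` {path_pair a w3} = ?r `` {path_pair a v3}"
      by (intro equiv_class_eq[OF equiv_pi1_rel[OF a]]) (simp add: pi1_rel_path_pair[OF a])
    ultimately show "C \<in> {?r `` {path_pair a w3}}" by simp
  next
    fix C assume "C \<in> {?r `` {path_pair a w3}}"
    obtain c where "continuous_map unit_sq X c" "side_u c = w2" "side_u' c = a" "side_v' c = w1" "side_v c = w3"
      using sq by (auto simp: has_square_def)
    moreover have "path_pair a w1 \<in> ?r `` {path_pair a w1}" "path_pair a w2 \<in> ?r `` {path_pair a w2}"
      using equiv_class_self[OF equiv_pi1_rel[OF a]] w by (auto simp: pi1_pairs_Pi[OF a])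
    ultimately show "C \<in> ?M"
      using \<open>C \<in> {?r `` {path_pair a w3}}\<close>
      by (intro CollectI exI[of _ "(w1, a)"] exI[of _ "(a, w1)"] exI[of _ "(w2, a)"] exI[of _ "(a, w2)"]
          exI[of _ "sq_class X c"]) (auto simp: path_pair_def)
  qed
  then show ?thesis by (simp add: pi1_def)
qed


section \<open>The homomorphism induced on the fundamental groups\<close>

lemma pi1_map_class:
  assumes f: "continuous_map X Y f" and a: "a \<in> paths X" and w: "w \<in> paths_along X a"
  shows "pi1_map (htpy_double_groupoid Y) (htpy_double_functor Y f) a
      (pi1_rel (htpy_double_groupoid X) a `` {path_pair a w})
    = pi1_rel (htpy_double_groupoid Y) (path_image_map f a) `` {path_pair (path_image_map f a) (path_image_map f w)}"
proof -
  let ?r = "pi1_rel (htpy_double_groupoid X) a"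
  let ?s = "pi1_rel (htpy_double_groupoid Y) (path_image_map f a)"
  let ?F = "\<lambda>(g, u). (map_Hor (htpy_double_functor Y f) g, map_Ver (htpy_double_functor Y f) u)"
  have fa: "path_image_map f a \<in> paths Y" by (rule path_image_map_in_paths[OF f a])
  have "?s `` {?F p} = ?s `` {?F (path_pair a w)}" if "p \<in> ?r `` {path_pair a w}" for p
  proof (rule equiv_class_eq[OF equiv_pi1_rel[OF fa], symmetric])
    show "(?F (path_pair a w), ?F p) \<in> ?s"
      using that along_rel_compose[OF f] unfolding pi1_rel_Pi[OF a]
      by (auto simp: map_path_pair pi1_rel_path_pair[OF fa] simp del: htpy_double_functor_simps)
  qed
  moreover have "path_pair a w \<in> ?r `` {path_pair a w}"
    using equiv_class_self[OF equiv_pi1_rel[OF a]] w by (auto simp: pi1_pairs_Pi[OF a])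
  ultimately have "(\<Union>p\<in>?r `` {path_pair a w}. ?s `` {?F p}) = ?s `` {?F (path_pair a w)}" by blast
  then show ?thesis
    by (simp add: pi1_map_def case_prod_unfold path_pair_def)
qed

lemma pi1_carrier_Pi:
  assumes "a \<in> paths X"
  shows "carrier (pi1 (htpy_double_groupoid X) a)
    = (\<lambda>w. pi1_rel (htpy_double_groupoid X) a `` {path_pair a w}) ` paths_along X a"
  by (auto simp: pi1_def pi1_pairs_Pi[OF assms] quotient_def)

text \<open>Composition with \<open>f\<close> takes a square that computes a product to one that
  computes the product of the images.\<close>

lemma pi1_map_hom:
  assumes f: "continuous_map X Y f" and a: "a \<in> paths X"
  shows "pi1_map (htpy_double_groupoid Y) (htpy_double_functor Y f) a
    \<in> hom (pi1 (htpy_double_groupoid X) a) (pi1 (htpy_double_groupoid Y) (path_image_map f a))"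
proof -
  have fa: "path_image_map f a \<in> paths Y" by (rule path_image_map_in_paths[OF f a])
  note carrier = pi1_carrier_Pi[OF a] pi1_carrier_Pi[OF fa]
  show ?thesis
  proof (rule homI)
    fix A assume "A \<in> carrier (pi1 (htpy_double_groupoid X) a)"
    then show "pi1_map (htpy_double_groupoid Y) (htpy_double_functor Y f) a A
        \<in> carrier (pi1 (htpy_double_groupoid Y) (path_image_map f a))"
      by (auto simp: carrier pi1_map_class[OF f a] paths_along_compose[OF f])
  next
    fix A B assume "A \<in> carrier (pi1 (htpy_double_groupoid X) a)" "B \<in> carrier (pi1 (htpy_double_groupoid X) a)"
    then obtain w1 w2 where w1: "w1 \<in> paths_along X a" "A = pi1_rel (htpy_double_groupoid X) a `` {path_pair a w1}"
      and w2: "w2 \<in> paths_along X a" "B = pi1_rel (htpy_double_groupoid X) a `` {path_pair a w2}"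
      by (auto simp: carrier)
    obtain w3 where w3: "has_square X w2 w3 a w1"
      using has_square_fill_v[of w2 X a w1] w1(1) w2(1) a by (auto simp: paths_along_def)
    have "w3 \<in> paths_along X a"
      using has_square_paths[OF w3] w1(1) w2(1) by (auto simp: paths_along_def)
    then show "pi1_map (htpy_double_groupoid Y) (htpy_double_functor Y f) a
        (A \<otimes>\<^bsub>pi1 (htpy_double_groupoid X) a\<^esub> B)
      = pi1_map (htpy_double_groupoid Y) (htpy_double_functor Y f) a A
        \<otimes>\<^bsub>pi1 (htpy_double_groupoid Y) (path_image_map f a)\<^esub>
        pi1_map (htpy_double_groupoid Y) (htpy_double_functor Y f) a B"
      using w1 w2 pi1_mult_Pi[OF a w1(1) w2(1) w3] has_square_compose[OF f w3]
      by (simp add: pi1_map_class[OF f a] pi1_mult_Pi[OF fa] paths_along_compose[OF f])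
  qed
qed

text \<open>Sending \<open>w\<close> to a loop \<open>l\<close> such that there is a square with sides \<open>w\<close>, \<open>l\<close>, \<open>a\<close> and a constant
  path amounts to composing \<open>w\<close> with the inverse of \<open>a\<close>.\<close>

lemma pi1_bij_change_base:
  assumes f: "continuous_map X Y f" and a: "a \<in> paths X"
    and bij: "pi1_bij X Y f (const_path (a 0))"
  shows "pi1_bij X Y f a"
proof -
  define k where "k = const_path (a 0)"
  have k: "k \<in> paths X" "k 0 = a 0" "k 1 = a 0"
    using paths_in_topspace[OF a] by (auto simp: k_def)
  \<comment> \<open>The comparison squares of \<open>w\<close> and \<open>w'\<close> combine to a
    square with sides \<open>w\<close>, \<open>l\<close>, \<open>w'\<close>, \<open>l'\<close>.
    Vertical composition with it or with its inverse exchanges \<open>w\<close>, \<open>w'\<close>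
    for \<open>l\<close>, \<open>l'\<close>, after which the base is changed from \<open>b\<close>
    to \<open>c\<close>.\<close>
  have transfer: "(w, w') \<in> along_rel Z b \<longleftrightarrow> (l, l') \<in> along_rel Z c"
    if "b \<in> paths Z" "c \<in> paths Z" "c 0 = b 0" "c 1 = b 0"
      "w \<in> paths_along Z b" "w' \<in> paths_along Z b"
      and sq: "has_square Z w l b c" "has_square Z w' l' b c" for Z :: "'c topology" and b c w w' l l'
  proof -
    have ww': "has_square Z w l w' l'" using has_square_hcomp[OF sq(1) has_square_hinv[OF sq(2)]] .
    have l: "l \<in> paths_along Z c" "l' \<in> paths_along Z c"
      using has_square_paths[OF sq(1)] has_square_paths[OF sq(2)] that by (auto simp: paths_along_def)
    have "has_square Z b w b w' \<longleftrightarrow> has_square Z b l b l'"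
      using has_square_vcomp ww' has_square_vinv[OF ww'] by blast
    also have "\<dots> \<longleftrightarrow> has_square Z c l c l'"
      using has_square_change_base[of Z b l l' c] has_square_change_base[of Z c l l' b] that(1-3) by auto
    finally show ?thesis using l that by (simp add: along_rel_def)
  qed
  have ex_loop: "\<exists>l\<in>paths_along X k. has_square X w l a k" if w: "w \<in> paths_along X a" for w
  proof -
    obtain l where l: "has_square X w l a k"
      using has_square_fill_v[of w X a k] w a k by (auto simp: paths_along_def)
    then show ?thesis
      using has_square_paths[OF l] w k by (intro bexI[of _ l]) (auto simp: paths_along_def)
  qed
  have fa: "path_image_map f a \<in> paths Y" and fk: "path_image_map f k \<in> paths Y"
    using path_image_map_in_paths[OF f] a k by auto
  note * = transfer[OF a k] and ** = transfer[OF fa fk]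
  show ?thesis
    unfolding pi1_bij_def
  proof (intro conjI ballI impI)
    fix w w' assume w: "w \<in> paths_along X a" "w' \<in> paths_along X a"
      and fw: "(path_image_map f w, path_image_map f w') \<in> along_rel Y (path_image_map f a)"
    obtain l where l: "l \<in> paths_along X k" "has_square X w l a k" using ex_loop[OF w(1)] by blast
    obtain l' where l': "l' \<in> paths_along X k" "has_square X w' l' a k" using ex_loop[OF w(2)] by blast
    have "(path_image_map f l, path_image_map f l') \<in> along_rel Y (path_image_map f k)"
      using **[OF _ _ paths_along_compose[OF f w(1)] paths_along_compose[OF f w(2)]
          has_square_compose[OF f l(2)] has_square_compose[OF f l'(2)]] fw k by simp
    then have "(l, l') \<in> along_rel X k"
      using bij l(1) l'(1) by (auto simp: pi1_bij_def k_def)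
    then show "(w, w') \<in> along_rel X a" using *[OF w l(2) l'(2)] by simp
  next
    fix z assume z: "z \<in> paths_along Y (path_image_map f a)"
    then obtain m where m: "has_square Y z m (path_image_map f a) (path_image_map f k)"
      using has_square_fill_v[of z Y "path_image_map f a" "path_image_map f k"] fa fk k
      by (auto simp: paths_along_def)
    then have "m \<in> paths_along Y (path_image_map f k)"
      using has_square_paths[OF m] z k by (auto simp: paths_along_def)
    then obtain l where l: "l \<in> paths_along X k" "(path_image_map f l, m) \<in> along_rel Y (path_image_map f k)"
      using bij unfolding pi1_bij_def k_def[symmetric] by blast
    \<comment> \<open>Up to homotopy this path is \<open>l\<close> followed by \<open>a\<close>,
      which undoes the passage from paths to loops.\<close>
    obtain w where w: "has_square X w l a k"
      using has_square_fill_u[of l X a k] l(1) a k by (auto simp: paths_along_def)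
    then have w': "w \<in> paths_along X a"
      using has_square_paths[OF w] l(1) k by (auto simp: paths_along_def)
    have "(path_image_map f w, z) \<in> along_rel Y (path_image_map f a)"
      using **[OF _ _ paths_along_compose[OF f w'] z has_square_compose[OF f w] m] l(2) k by simp
    with w' show "\<exists>w\<in>paths_along X a. (path_image_map f w, z) \<in> along_rel Y (path_image_map f a)" by blast
  qed
qed

subsection \<open>Homotopy groups of spaces\<close>

definition spheroids :: "nat \<Rightarrow> 'a topology \<Rightarrow> 'a \<Rightarrow> ((nat \<Rightarrow> real) \<Rightarrow> 'a) set" where
  "spheroids n X x = {p. continuous_map (cube n) X p \<and> (\<forall>z\<in>cube_boundary n. p z = x)}"

definition spheroid_rel :: "nat \<Rightarrow> 'a topology \<Rightarrow> 'a \<Rightarrow> (((nat \<Rightarrow> real) \<Rightarrow> 'a) \<times> ((nat \<Rightarrow> real) \<Rightarrow> 'a)) set" where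
  "spheroid_rel n X x = {(p, q). homotopic_with (\<lambda>h. \<forall>z\<in>cube_boundary n. h z = x) (cube n) X p q}"

lemma equiv_spheroid_rel: "equiv (spheroids n X x) (spheroid_rel n X x)"
proof (rule equivI)
  show "spheroid_rel n X x \<subseteq> spheroids n X x \<times> spheroids n X x"
    using homotopic_with_imp_continuous_maps homotopic_with_imp_property
    unfolding spheroid_rel_def spheroids_def by blast
  show "refl_on (spheroids n X x) (spheroid_rel n X x)"
    by (rule refl_onI) (simp add: spheroid_rel_def spheroids_def)
  show "sym (spheroid_rel n X x)"
    by (rule symI) (simp add: spheroid_rel_def homotopic_with_sym)
  show "trans (spheroid_rel n X x)"
    by (rule transI) (auto simp: spheroid_rel_def intro: homotopic_with_trans)
qed

lemma spheroids_compose: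
  "\<lbrakk>continuous_map X Y f; p \<in> spheroids n X x\<rbrakk> \<Longrightarrow> f \<circ> p \<in> spheroids n Y (f x)"
  by (auto simp: spheroids_def intro: continuous_map_compose)

lemma spheroid_rel_compose:
  "\<lbrakk>continuous_map X Y f; (p, q) \<in> spheroid_rel n X x\<rbrakk> \<Longrightarrow> (f \<circ> p, f \<circ> q) \<in> spheroid_rel n Y (f x)"
  unfolding spheroid_rel_def by (auto elim!: homotopic_with_compose_continuous_map_left)

lemma htpy_class_eq: "htpy_class n X x p = spheroid_rel n X x `` {p}"
  by (auto simp: htpy_class_def spheroid_rel_def)

lemma htpy_group_quotient: "htpy_group n X x = spheroids n X x // spheroid_rel n X x"
  by (auto simp: htpy_group_def htpy_class_eq spheroids_def quotient_def)

lemma htpy_group_map_quotient: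
  "htpy_group_map n Y f x = (\<lambda>C. \<Union>p\<in>C. spheroid_rel n Y (f x) `` {f \<circ> p})"
  by (simp add: htpy_group_map_def htpy_class_eq fun_eq_iff)

lemma bij_betw_htpy_group_iff:
  assumes f: "continuous_map X Y f"
  shows "bij_betw (htpy_group_map n Y f x) (htpy_group n X x) (htpy_group n Y (f x)) \<longleftrightarrow>
    (\<forall>p\<in>spheroids n X x. \<forall>q\<in>spheroids n X x. (f \<circ> p, f \<circ> q) \<in> spheroid_rel n Y (f x) \<longrightarrow> (p, q) \<in> spheroid_rel n X x) \<and>
    (\<forall>r\<in>spheroids n Y (f x). \<exists>p\<in>spheroids n X x. (f \<circ> p, r) \<in> spheroid_rel n Y (f x))"
proof -
  show ?thesis
    unfolding htpy_group_quotient htpy_group_map_quotient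
    using spheroids_compose[OF f] spheroid_rel_compose[OF f]
    by (intro bij_betw_quotient_iff equiv_spheroid_rel)
qed

lemma topspace_cube: "topspace (cube n) = {..<n} \<rightarrow>\<^sub>E {0..1}"
  by (simp add: cube_def)

lemma continuous_map_cubeI:
  assumes "\<And>i. i < n \<Longrightarrow> continuous_map Z (top_of_set {0..1}) (\<lambda>z. g z i)"
  shows "continuous_map Z (cube n) (\<lambda>z. \<lambda>i\<in>{..<n}. g z i)"
  unfolding cube_def continuous_map_componentwise using assms by auto

lemma continuous_map_cube_coordinate:
  "i < n \<Longrightarrow> continuous_map (cube n) (top_of_set {0..1}) (\<lambda>z. z i)"
  unfolding cube_def by (rule continuous_map_product_projection) simp

definition loop_of :: "((nat \<Rightarrow> real) \<Rightarrow> 'a) \<Rightarrow> 'a path" where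
  "loop_of p = (\<lambda>t\<in>{0..1}. p (\<lambda>i\<in>{..<1}. t))"

lemma paths_along_const:
  "x \<in> topspace X \<Longrightarrow> w \<in> paths_along X (const_path x) \<longleftrightarrow> w \<in> paths X \<and> w 0 = x \<and> w 1 = x"
  by (simp add: paths_along_def)

lemma point_in_cube1: "t \<in> {0..1} \<Longrightarrow> (\<lambda>i\<in>{..<1}. t) \<in> topspace (cube 1)"
  by (auto simp: topspace_cube)

lemma loop_of_in_paths_along:
  assumes "p \<in> spheroids 1 X x" "x \<in> topspace X"
  shows "loop_of p \<in> paths_along X (const_path x)"
proof -
  have "continuous_map (top_of_set {0..1}) (cube 1) (\<lambda>t. \<lambda>i\<in>{..<1}. t)"
    by (rule continuous_map_cubeI) simp
  moreover have "continuous_map (cube 1) X p" using assms by (simp add: spheroids_def)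
  ultimately have "pathin X (\<lambda>t. p (\<lambda>i\<in>{..<1}. t))"
    unfolding pathin_def using continuous_map_compose by (fastforce simp: o_def)
  then have "loop_of p \<in> paths X" unfolding loop_of_def by (rule restrict_in_paths)
  moreover have "loop_of p 0 = x" "loop_of p 1 = x"
    using assms(1) point_in_cube1[of 0] point_in_cube1[of 1]
    by (auto simp: loop_of_def spheroids_def cube_boundary_def)
  ultimately show ?thesis using assms(2) by (simp add: paths_along_const)
qed

lemma ex_loop_of:
  assumes w: "w \<in> paths_along X (const_path x)" and x: "x \<in> topspace X"
  obtains p where "p \<in> spheroids 1 X x" "loop_of p = w"
proof
  have "continuous_map (cube 1) X (w \<circ> (\<lambda>z. z 0))"
    using continuous_map_compose[OF continuous_map_cube_coordinate[of 0 1], of X w] w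
    by (auto simp: paths_along_def dest!: pathsD simp: pathin_def)
  then show "w \<circ> (\<lambda>z. z 0) \<in> spheroids 1 X x"
    using w x by (auto simp: spheroids_def cube_boundary_def paths_along_const)
  show "loop_of (w \<circ> (\<lambda>z. z 0)) = w"
    using w x by (intro extensionalityI[of _ "{0..1}"])
      (auto simp: loop_of_def paths_along_def paths_extensional)
qed

lemma loop_of_compose: "loop_of (f \<circ> p) = path_image_map f (loop_of p)"
  by (auto simp: loop_of_def path_image_map_def restrict_def)

text \<open>In the relation the two loops sit on the adjacent sides x = 0 and y = 1, in a homotopy
  of loops on the opposite sides y = 0 and y = 1. The square \<open>\<alpha>\<close>, which depends
  on the first coordinate only, mediates between the two positions.\<close>

lemma along_rel_const_iff:
  assumes w: "w \<in> paths_along X (const_path x)" "w' \<in> paths_along X (const_path x)" and x: "x \<in> topspace X"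
  shows "(w, w') \<in> along_rel X (const_path x) \<longleftrightarrow>
    has_square X w (const_path x) (const_path x) (rev_path w')"
proof -
  let ?k = "const_path x"
  have w': "pathin X w'" "w' \<in> extensional {0..1}" "w' 0 = x" "w' 1 = x"
    using w x by (auto simp: paths_along_const paths_extensional dest: pathsD)
  define \<alpha> where "\<alpha> = (\<lambda>z::real \<times> real. w' (fst z))"
  have "continuous_map unit_sq X \<alpha>"
    unfolding \<alpha>_def unit_sq_def
    by (rule continuous_map_compose_on[OF w'(1)[unfolded pathin_def]]) (auto intro!: continuous_intros)
  moreover have "side_u \<alpha> = w'" "side_v \<alpha> = ?k" "side_u' \<alpha> = ?k" "side_v' \<alpha> = rev_path w'"
    using w' by (auto simp: \<alpha>_def side_u_def side_v_def side_u'_def side_v'_def const_path_def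
        rev_path_def restrict_def extensional_def fun_eq_iff)
  ultimately have sq: "has_square X w' ?k ?k (rev_path w')"
    using has_squareI by metis
  have "has_square X ?k w ?k w' \<longleftrightarrow> has_square X w ?k w' ?k"
    using has_square_vinv by blast
  also have "\<dots> \<longleftrightarrow> has_square X w ?k ?k (rev_path w')"
    using has_square_hcomp[OF _ sq] has_square_hcomp[OF _ has_square_hinv[OF sq]] by blast
  finally show ?thesis using w by (simp add: along_rel_def)
qed

lemma homotopic_loops_iff:
  assumes p: "p \<in> spheroids 1 X x" and q: "q \<in> spheroids 1 X x" and x: "x \<in> topspace X"
  shows "(p, q) \<in> spheroid_rel 1 X x \<longleftrightarrow> (loop_of p, loop_of q) \<in> along_rel X (const_path x)"
proof
  assume "(p, q) \<in> spheroid_rel 1 X x"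
  then obtain h where h: "continuous_map (prod_topology (top_of_set {0..1::real}) (cube 1)) X h"
    "\<And>z. h (0, z) = p z" "\<And>z. h (1, z) = q z"
    "\<And>t z. t \<in> {0..1} \<Longrightarrow> z \<in> cube_boundary 1 \<Longrightarrow> h (t, z) = x"
    by (auto simp: spheroid_rel_def homotopic_with_def)
  \<comment> \<open>The time of the homotopy is the second coordinate of the square, hence the
    swap.\<close>
  define e where "e = (\<lambda>z::real \<times> real. (snd z, \<lambda>i\<in>{..<1::nat}. fst z))"
  have "continuous_map unit_sq (prod_topology (top_of_set {0..1}) (cube 1)) e"
    unfolding e_def continuous_map_paired unit_sq_def
    by (intro conjI continuous_map_cubeI)
       (auto simp: continuous_map_in_subtopology intro!: continuous_intros)
  then have "continuous_map unit_sq X (h \<circ> e)"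
    using h(1) by (rule continuous_map_compose)
  moreover have "side_u (h \<circ> e) = loop_of p" "side_v' (h \<circ> e) = rev_path (loop_of q)"
    by (auto simp: side_u_def side_v'_def e_def loop_of_def h rev_path_def restrict_def fun_eq_iff cong: if_cong)
  moreover have "side_v (h \<circ> e) = const_path x" "side_u' (h \<circ> e) = const_path x"
    using h(4) point_in_cube1[of 0] point_in_cube1[of 1]
    by (auto simp: side_v_def side_u'_def e_def const_path_def restrict_eq_iff cube_boundary_def)
  ultimately have "has_square X (loop_of p) (const_path x) (const_path x) (rev_path (loop_of q))"
    using has_squareI by metis
  then show "(loop_of p, loop_of q) \<in> along_rel X (const_path x)"
    using along_rel_const_iff[OF loop_of_in_paths_along[OF p x] loop_of_in_paths_along[OF q x] x] by simp
next
  assume "(loop_of p, loop_of q) \<in> along_rel X (const_path x)"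
  then have "has_square X (loop_of p) (const_path x) (const_path x) (rev_path (loop_of q))"
    using along_rel_const_iff[OF loop_of_in_paths_along[OF p x] loop_of_in_paths_along[OF q x] x] by simp
  then obtain \<alpha> where \<alpha>: "continuous_map unit_sq X \<alpha>" and sides: "side_u \<alpha> = loop_of p"
    "side_v \<alpha> = const_path x" "side_u' \<alpha> = const_path x" "side_v' \<alpha> = rev_path (loop_of q)"
    by (auto simp: has_square_def)
  have u: "\<alpha> (t, 0) = p (\<lambda>i\<in>{..<1}. t)" and v: "\<alpha> (0, t) = x"
    and u': "\<alpha> (1, t) = x" and v': "\<alpha> (t, 1) = q (\<lambda>i\<in>{..<1}. t)" if "t \<in> {0..1}" for t
    using fun_cong[OF sides(1), of t] fun_cong[OF sides(2), of t] fun_cong[OF sides(3), of "1 - t"]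
      fun_cong[OF sides(4), of "1 - t"] that
    by (auto simp: side_u_def side_v_def side_u'_def side_v'_def loop_of_def rev_path_def)
  define e where "e = (\<lambda>y::real \<times> (nat \<Rightarrow> real). (snd y 0, fst y))"
  have "continuous_map (prod_topology (top_of_set {0..1}) (cube 1))
      (prod_topology (top_of_set {0..1}) (top_of_set {0..1})) e"
    unfolding e_def continuous_map_paired
    using continuous_map_compose[OF continuous_map_snd continuous_map_cube_coordinate[of 0 1]]
      continuous_map_fst by (auto simp: o_def)
  then have "continuous_map (prod_topology (top_of_set {0..1}) (cube 1)) unit_sq e"
    by (simp add: unit_sq_def)
  then have cont: "continuous_map (prod_topology (top_of_set {0..1}) (cube 1)) X (\<alpha> \<circ> e)"
    using \<alpha> by (rule continuous_map_compose)
  have z: "z 0 \<in> {0..1} \<and> z = (\<lambda>i\<in>{..<1}. z 0)" if "z \<in> topspace (cube 1)" for z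
    using that by (auto simp: topspace_cube PiE_iff extensional_def restrict_def fun_eq_iff)
  have "homotopic_with (\<lambda>h. \<forall>z\<in>cube_boundary 1. h z = x) (cube 1) X p q"
  proof (subst homotopic_with)
    show "(\<forall>z\<in>cube_boundary 1. h z = x) = (\<forall>z\<in>cube_boundary 1. k z = x)"
      if "\<And>z. z \<in> topspace (cube 1) \<Longrightarrow> h z = k z" for h k :: "(nat \<Rightarrow> real) \<Rightarrow> 'a"
      using that by (auto simp: cube_boundary_def)
    show "\<exists>h. continuous_map (prod_topology (top_of_set {0..1::real}) (cube 1)) X h \<and>
        (\<forall>z\<in>topspace (cube 1). h (0, z) = p z) \<and> (\<forall>z\<in>topspace (cube 1). h (1, z) = q z) \<and>
        (\<forall>t\<in>{0..1}. \<forall>z\<in>cube_boundary 1. h (t, z) = x)"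
    proof (intro exI[of _ "\<alpha> \<circ> e"] conjI ballI cont)
      fix t :: real and y assume "t \<in> {0..1}" "y \<in> cube_boundary 1"
      then show "(\<alpha> \<circ> e) (t, y) = x" using v[of t] u'[of t] by (auto simp: cube_boundary_def e_def)
    next
      fix y assume "y \<in> topspace (cube 1)"
      then show "(\<alpha> \<circ> e) (0, y) = p y" "(\<alpha> \<circ> e) (1, y) = q y"
        using z[of y] u[of "y 0"] v'[of "y 0"] by (auto simp: e_def)
    qed
  qed
  then show "(p, q) \<in> spheroid_rel 1 X x" by (simp add: spheroid_rel_def)
qed

lemma bij_betw_htpy_group_1_iff:
  assumes f: "continuous_map X Y f" and x: "x \<in> topspace X"
  shows "bij_betw (htpy_group_map 1 Y f x) (htpy_group 1 X x) (htpy_group 1 Y (f x))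
    \<longleftrightarrow> pi1_bij X Y f (const_path x)"
proof -
  have fx: "f x \<in> topspace Y" using f x by (auto simp: continuous_map_def)
  have X: "paths_along X (const_path x) = loop_of ` spheroids 1 X x"
    using ex_loop_of[OF _ x] loop_of_in_paths_along[OF _ x] by blast
  have Y: "paths_along Y (const_path (f x)) = loop_of ` spheroids 1 Y (f x)"
    using ex_loop_of[OF _ fx] loop_of_in_paths_along[OF _ fx] by blast
  show ?thesis
    unfolding bij_betw_htpy_group_iff[OF f] pi1_bij_def path_image_const_path X Y ball_simps bex_simps
      loop_of_compose[symmetric]
    using homotopic_loops_iff[OF _ _ x] homotopic_loops_iff[OF _ _ fx] spheroids_compose[OF f]
    by (intro conj_cong ball_cong bex_cong imp_cong) auto
qed

subsection \<open>Second homotopy groups at constant paths\<close>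

definition const_squares :: "'a topology \<Rightarrow> 'a \<Rightarrow> 'a sqmap set" where
  "const_squares X x = {\<alpha>. continuous_map unit_sq X \<alpha> \<and> (\<forall>z\<in>unit_sq_boundary. \<alpha> z = x)}"

definition const_square_rel :: "'a topology \<Rightarrow> 'a \<Rightarrow> ('a sqmap \<times> 'a sqmap) set" where
  "const_square_rel X x = {(\<alpha>, \<beta>). \<alpha> \<in> const_squares X x \<and> sq_homotopic X \<alpha> \<beta>}"

lemma const_squares_homotopic:
  "\<lbrakk>\<alpha> \<in> const_squares X x; sq_homotopic X \<alpha> \<beta>\<rbrakk> \<Longrightarrow> \<beta> \<in> const_squares X x"
  using sq_homotopic_boundary[of X \<alpha> \<beta>] sq_homotopic_continuous(2)[of X \<alpha> \<beta>] by (auto simp: const_squares_def)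

lemma equiv_const_square_rel: "equiv (const_squares X x) (const_square_rel X x)"
proof (rule equivI)
  show "const_square_rel X x \<subseteq> const_squares X x \<times> const_squares X x"
    using const_squares_homotopic by (fastforce simp: const_square_rel_def)
  show "refl_on (const_squares X x) (const_square_rel X x)"
    by (rule refl_onI) (auto simp: const_square_rel_def const_squares_def sq_homotopic_refl)
  show "sym (const_square_rel X x)"
    by (rule symI) (auto simp: const_square_rel_def intro: const_squares_homotopic sq_homotopic_sym)
  show "trans (const_square_rel X x)"
    by (rule transI) (auto simp: const_square_rel_def intro: sq_homotopic_trans)
qed

lemma const_square_class: "\<alpha> \<in> const_squares X x \<Longrightarrow> const_square_rel X x `` {\<alpha>} = sq_class X \<alpha>"
  by (auto simp: const_square_rel_def mem_sq_class)

lemma const_squares_iff: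
  assumes "continuous_map unit_sq X \<alpha>"
  shows "\<alpha> \<in> const_squares X x \<longleftrightarrow> side_u \<alpha> = const_path x \<and> side_v \<alpha> = const_path x \<and>
    side_u' \<alpha> = const_path x \<and> side_v' \<alpha> = const_path x"
proof
  assume "\<alpha> \<in> const_squares X x"
  then have "\<alpha> (s, t) = x" if "(s, t) \<in> unit_sq_boundary" for s t
    using that by (simp add: const_squares_def)
  then show "side_u \<alpha> = const_path x \<and> side_v \<alpha> = const_path x \<and>
    side_u' \<alpha> = const_path x \<and> side_v' \<alpha> = const_path x"
    by (simp add: unit_sq_boundary_iff side_u_def side_v_def side_u'_def side_v'_def const_path_def restrict_eq_iff)
next
  assume sides: "side_u \<alpha> = const_path x \<and> side_v \<alpha> = const_path x \<and>
    side_u' \<alpha> = const_path x \<and> side_v' \<alpha> = const_path x"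
  have "\<alpha> (t, 0) = x \<and> \<alpha> (0, t) = x \<and> \<alpha> (1, t) = x \<and> \<alpha> (t, 1) = x" if "0 \<le> t" "t \<le> 1" for t
  proof -
    have "side_u \<alpha> t = x" "side_v \<alpha> t = x" "side_u' \<alpha> (1 - t) = x" "side_v' \<alpha> (1 - t) = x"
      using sides that by simp_all
    then show ?thesis using that by (simp add: side_u_def side_v_def side_u'_def side_v'_def)
  qed
  then show "\<alpha> \<in> const_squares X x"
    using assms by (auto simp: const_squares_def unit_sq_boundary_def)
qed

lemma carrier_pi2_const:
  assumes "x \<in> topspace X"
  shows "carrier (pi2 (htpy_double_groupoid X) (const_path x)) = const_squares X x // const_square_rel X x"
proof -
  have "c \<in> carrier (pi2 (htpy_double_groupoid X) (const_path x)) \<longleftrightarrow> (\<exists>\<alpha>\<in>const_squares X x. c = sq_class X \<alpha>)" for c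
  proof
    assume c: "c \<in> carrier (pi2 (htpy_double_groupoid X) (const_path x))"
    then obtain \<alpha> where "c = sq_class X \<alpha>" "continuous_map unit_sq X \<alpha>"
      by (auto simp: pi2_def elim: squaresE)
    with c show "\<exists>\<alpha>\<in>const_squares X x. c = sq_class X \<alpha>"
      by (auto simp: pi2_def const_squares_iff)
  next
    assume "\<exists>\<alpha>\<in>const_squares X x. c = sq_class X \<alpha>"
    then obtain \<alpha> where \<alpha>: "\<alpha> \<in> const_squares X x" "c = sq_class X \<alpha>" by blast
    then have "continuous_map unit_sq X \<alpha>" by (simp add: const_squares_def)
    with \<alpha> show "c \<in> carrier (pi2 (htpy_double_groupoid X) (const_path x))"
      by (auto simp: pi2_def const_squares_iff)
  qed
  then show ?thesis by (auto simp: quotient_def const_square_class)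
qed

lemma const_squares_compose:
  "\<lbrakk>continuous_map X Y f; \<alpha> \<in> const_squares X x\<rbrakk> \<Longrightarrow> f \<circ> \<alpha> \<in> const_squares Y (f x)"
  by (auto simp: const_squares_def intro: continuous_map_compose)

lemma const_square_rel_compose:
  "\<lbrakk>continuous_map X Y f; (\<alpha>, \<beta>) \<in> const_square_rel X x\<rbrakk> \<Longrightarrow> (f \<circ> \<alpha>, f \<circ> \<beta>) \<in> const_square_rel Y (f x)"
  by (auto simp: const_square_rel_def const_squares_compose sq_homotopic_compose)

text \<open>The functor maps one chosen representative instead of forming a union over the class. On
  classes of squares with constant boundary both give the same result, so that
  \<open>bij_betw_quotient_iff\<close> applies.\<close>

lemma bij_betw_pi2_const_iff:
  assumes f: "continuous_map X Y f" and x: "x \<in> topspace X"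
  shows "bij_betw (map_Sq (htpy_double_functor Y f)) (carrier (pi2 (htpy_double_groupoid X) (const_path x)))
      (carrier (pi2 (htpy_double_groupoid Y) (const_path (f x)))) \<longleftrightarrow>
    (\<forall>\<alpha>\<in>const_squares X x. \<forall>\<beta>\<in>const_squares X x.
       (f \<circ> \<alpha>, f \<circ> \<beta>) \<in> const_square_rel Y (f x) \<longrightarrow> (\<alpha>, \<beta>) \<in> const_square_rel X x) \<and>
    (\<forall>\<gamma>\<in>const_squares Y (f x). \<exists>\<alpha>\<in>const_squares X x. (f \<circ> \<alpha>, \<gamma>) \<in> const_square_rel Y (f x))"
proof -
  have fx: "f x \<in> topspace Y" using f x by (auto simp: continuous_map_def)
  have "map_Sq (htpy_double_functor Y f) C = (\<Union>\<alpha>\<in>C. const_square_rel Y (f x) `` {f \<circ> \<alpha>})"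
    if C: "C \<in> const_squares X x // const_square_rel X x" for C
  proof -
    obtain \<alpha> where \<alpha>: "\<alpha> \<in> const_squares X x" "C = const_square_rel X x `` {\<alpha>}"
      using C by (rule quotientE)
    note \<alpha> = \<alpha>(1) \<alpha>(2)[unfolded const_square_class[OF \<alpha>(1)]]
    then have cont: "continuous_map unit_sq X \<alpha>" by (simp add: const_squares_def)
    have "const_square_rel Y (f x) `` {f \<circ> \<beta>} = sq_class Y (f \<circ> \<alpha>)" if "\<beta> \<in> C" for \<beta>
    proof -
      have "sq_homotopic X \<alpha> \<beta>" using that \<alpha> by (simp add: mem_sq_class)
      then have "sq_class Y (f \<circ> \<alpha>) = sq_class Y (f \<circ> \<beta>)" "\<beta> \<in> const_squares X x"
        using sq_class_eqI[OF sq_homotopic_compose[OF _ f]] const_squares_homotopic[OF \<alpha>(1)] by blast+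
      then show ?thesis using const_square_class[OF const_squares_compose[OF f]] by simp
    qed
    moreover have "\<alpha> \<in> C" using \<alpha> cont by (simp add: mem_sq_class sq_homotopic_refl)
    ultimately show ?thesis using map_Sq_class[OF f cont] \<alpha>(2) by blast
  qed
  then show ?thesis
    unfolding carrier_pi2_const[OF x] carrier_pi2_const[OF fx]
    using bij_betw_quotient_iff[OF equiv_const_square_rel equiv_const_square_rel
        const_squares_compose[OF f] const_square_rel_compose[OF f]]
    by (simp cong: bij_betw_cong)
qed

definition square_of :: "((nat \<Rightarrow> real) \<Rightarrow> 'a) \<Rightarrow> 'a sqmap" where
  "square_of p = p \<circ> (\<lambda>z. \<lambda>i\<in>{..<2}. if i = 0 then fst z else snd z)"

lemma continuous_map_square_to_cube:
  "continuous_map unit_sq (cube 2) (\<lambda>z. \<lambda>i\<in>{..<2}. if i = 0 then fst z else snd z)"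
  unfolding unit_sq_def
  by (rule continuous_map_cubeI) (auto simp: continuous_map_in_subtopology intro!: continuous_intros)

lemma continuous_map_cube_to_square: "continuous_map (cube 2) unit_sq (\<lambda>z. (z 0, z 1))"
proof -
  have "continuous_map (cube 2) (prod_topology (top_of_set {0..1}) (top_of_set {0..1})) (\<lambda>z. (z 0, z 1))"
    unfolding continuous_map_paired by (simp add: continuous_map_cube_coordinate)
  then show ?thesis by (simp add: unit_sq_def)
qed

lemma square_to_cube_boundary:
  "z \<in> unit_sq_boundary \<Longrightarrow> (\<lambda>i\<in>{..<2}. if i = 0 then fst z else snd z) \<in> cube_boundary 2"
proof -
  assume z: "z \<in> unit_sq_boundary"
  then obtain i :: nat where "i < 2" "(if i = 0 then fst z else snd z) \<in> {0, 1}"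
    unfolding unit_sq_boundary_def by (auto intro: that[of 0] that[of 1])
  then show ?thesis
    using z by (auto simp: unit_sq_boundary_def cube_boundary_def topspace_cube intro!: exI[of _ i])
qed

lemma cube_to_square_boundary: "z \<in> cube_boundary 2 \<Longrightarrow> (z 0, z 1) \<in> unit_sq_boundary"
  by (auto simp: unit_sq_boundary_def cube_boundary_def topspace_cube PiE_iff less_2_cases_iff)

lemma square_of_in_const_squares: "p \<in> spheroids 2 X x \<Longrightarrow> square_of p \<in> const_squares X x"
  unfolding square_of_def spheroids_def const_squares_def
  using continuous_map_compose[OF continuous_map_square_to_cube] square_to_cube_boundary by auto

lemma const_squares_eq: "const_squares X x = square_of ` spheroids 2 X x"
proof (intro equalityI subsetI)
  fix \<alpha> assume \<alpha>: "\<alpha> \<in> const_squares X x"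
  have "\<alpha> = square_of (\<alpha> \<circ> (\<lambda>z. (z 0, z 1)))" by (auto simp: square_of_def)
  moreover have "\<alpha> \<circ> (\<lambda>z. (z 0, z 1)) \<in> spheroids 2 X x"
    using \<alpha> continuous_map_compose[OF continuous_map_cube_to_square] cube_to_square_boundary
    by (auto simp: spheroids_def const_squares_def)
  ultimately show "\<alpha> \<in> square_of ` spheroids 2 X x" by blast
qed (auto simp: square_of_in_const_squares)

lemma square_of_rel_iff:
  assumes p: "p \<in> spheroids 2 X x" and q: "q \<in> spheroids 2 X x"
  shows "(p, q) \<in> spheroid_rel 2 X x \<longleftrightarrow> (square_of p, square_of q) \<in> const_square_rel X x"
proof
  assume "(p, q) \<in> spheroid_rel 2 X x"
  then have "homotopic_with (\<lambda>h. \<forall>z\<in>unit_sq_boundary. h z = x) unit_sq X (square_of p) (square_of q)"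
    unfolding spheroid_rel_def square_of_def
    using square_to_cube_boundary
    by (auto elim!: homotopic_with_compose_continuous_map_right[OF _ continuous_map_square_to_cube])
  then have "sq_homotopic X (square_of p) (square_of q)"
    unfolding sq_homotopic_def
    by (rule homotopic_with_mono) (use square_of_in_const_squares[OF p] in \<open>auto simp: const_squares_def\<close>)
  then show "(square_of p, square_of q) \<in> const_square_rel X x"
    by (simp add: const_square_rel_def square_of_in_const_squares p)
next
  let ?P = "\<lambda>h. \<forall>z\<in>cube_boundary 2. h z = x" and ?g = "\<lambda>z::nat \<Rightarrow> real. (z 0, z 1)"
  \<comment> \<open>Pulling back to the square and forward again recovers \<open>p\<close> on the
    cube only, since elsewhere arguments need not be extensional. Hence a homotopy instead of an
    equation.\<close>
  have eq: "(p, square_of p \<circ> ?g) \<in> spheroid_rel 2 X x" if p: "p \<in> spheroids 2 X x" for p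
  proof -
    have *: "p z = (square_of p \<circ> ?g) z" if "z \<in> topspace (cube 2)" for z
    proof -
      have "(\<lambda>i\<in>{..<2}. if i = 0 then z 0 else z 1) = z"
        using that by (auto simp: topspace_cube PiE_iff extensional_def restrict_def less_2_cases_iff fun_eq_iff)
      then show ?thesis unfolding square_of_def o_apply fst_conv snd_conv by simp
    qed
    have "homotopic_with ?P (cube 2) X p (square_of p \<circ> ?g)"
    proof (rule homotopic_with_equal[OF _ _ _ *])
      show "\<forall>z\<in>cube_boundary 2. p z = x" "continuous_map (cube 2) X p"
        using p by (simp_all add: spheroids_def)
      then show "\<forall>z\<in>cube_boundary 2. (square_of p \<circ> ?g) z = x"
        using * by (simp add: cube_boundary_def)
    qed
    then show ?thesis by (simp add: spheroid_rel_def)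
  qed
  assume "(square_of p, square_of q) \<in> const_square_rel X x"
  then have "homotopic_with (\<lambda>h. \<forall>z\<in>unit_sq_boundary. h z = x) unit_sq X (square_of p) (square_of q)"
    unfolding const_square_rel_def sq_homotopic_def const_squares_def
    by (auto elim: homotopic_with_mono)
  then have "(square_of p \<circ> ?g, square_of q \<circ> ?g) \<in> spheroid_rel 2 X x"
    unfolding spheroid_rel_def
    by (intro CollectI case_prodI, elim homotopic_with_compose_continuous_map_right[OF _ continuous_map_cube_to_square])
       (simp del: One_nat_def add: cube_to_square_boundary)
  with eq[OF p] eq[OF q] show "(p, q) \<in> spheroid_rel 2 X x"
    using equiv_spheroid_rel[of 2 X x] unfolding equiv_def by (meson symD transD)
qed

lemma bij_betw_htpy_group_2_iff:
  assumes f: "continuous_map X Y f" and x: "x \<in> topspace X"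
  shows "bij_betw (htpy_group_map 2 Y f x) (htpy_group 2 X x) (htpy_group 2 Y (f x)) \<longleftrightarrow>
    bij_betw (map_Sq (htpy_double_functor Y f)) (carrier (pi2 (htpy_double_groupoid X) (const_path x)))
      (carrier (pi2 (htpy_double_groupoid Y) (const_path (f x))))"
proof -
  have "f \<circ> square_of p = square_of (f \<circ> p)" for p by (simp add: square_of_def comp_assoc)
  then show ?thesis
    unfolding bij_betw_htpy_group_iff[OF f] bij_betw_pi2_const_iff[OF f x] const_squares_eq ball_simps bex_simps
    using square_of_rel_iff[where X = X and x = x] square_of_rel_iff[where X = Y and x = "f x"]
      spheroids_compose[OF f]
    by (intro conj_cong ball_cong bex_cong imp_cong) auto
qed


subsection \<open>Change of base point for the second homotopy groups\<close>

text \<open>The inverse \<open>k\<close> is an explicit argument: no inverse has to be chosen, and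
  naturality under double functors is immediate.\<close>

definition pi2_conj :: "('o, 'h, 'v, 'c) double_cat \<Rightarrow> 'h \<Rightarrow> 'h \<Rightarrow> 'c \<Rightarrow> 'c" where
  "pi2_conj D h k c = Cmp (SqH D) (Idn (SqV D) h) (Cmp (SqH D) c (Idn (SqV D) k))"

definition inverse_hor :: "('o, 'h, 'v, 'c) double_cat \<Rightarrow> 'o \<Rightarrow> 'o \<Rightarrow> 'h \<Rightarrow> 'h \<Rightarrow> bool" where
  "inverse_hor D a b h k \<longleftrightarrow> h \<in> Mor (Hor D) \<and> k \<in> Mor (Hor D) \<and>
     Src (Hor D) h = a \<and> Tgt (Hor D) h = b \<and> Src (Hor D) k = b \<and> Tgt (Hor D) k = a \<and>
     Cmp (Hor D) h k = Idn (Hor D) b \<and> Cmp (Hor D) k h = Idn (Hor D) a"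

context double_category
begin

lemma idn_V_square:
  assumes "h \<in> Mor (Hor D)"
  shows "Idn (SqV D) h \<in> Mor (SqH D)" "Src (SqV D) (Idn (SqV D) h) = h" "Tgt (SqV D) (Idn (SqV D) h) = h"
  using assms category.idn_in[OF cat_SqV] category.src_idn[OF cat_SqV] category.tgt_idn[OF cat_SqV]
    Ob_SqV Mor_SqV by auto

text \<open>The vertical source and target of the composite are h followed backwards by the identity
  and k, which is the identity of \<open>b\<close>; the horizontal ends are identities because those
  of an identity square on a horizontal morphism are.\<close>

lemma pi2_conj_in:
  assumes h: "inverse_hor D a b h k" and c: "c \<in> carrier (pi2 D a)"
  shows "pi2_conj D h k c \<in> carrier (pi2 D b)"
proof -
  interpret H: category "Hor D" by (rule cat_Hor)
  interpret SH: category "SqH D" by (rule cat_SqH)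
  note h = h[unfolded inverse_hor_def]
  have c: "c \<in> Mor (SqH D)" "Src (SqH D) c = Idn (Ver D) a" "Tgt (SqH D) c = Idn (Ver D) a"
    "Src (SqV D) c = Idn (Hor D) a" "Tgt (SqV D) c = Idn (Hor D) a"
    using c by (auto simp: pi2_def)
  have idn: "Cmp (Hor D) (Idn (Hor D) a) k = k" using h H.idn_left[of k] by auto
  show ?thesis
    using h c idn
    by (simp add: pi2_conj_def pi2_def idn_V_square SH.cmp_in SH.src_cmp SH.tgt_cmp src_idn_V tgt_idn_V
        src_cmp_H tgt_cmp_H)
qed

text \<open>The identity squares on \<open>k\<close> and \<open>h\<close> compose to an identity by
  \<open>idn_cmp_H\<close> and \<open>idn_idn\<close>, so the outer factors cancel after
  reassociation.\<close>

lemma pi2_conj_inverse: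
  assumes h: "inverse_hor D a b h k" and c: "c \<in> carrier (pi2 D a)"
  shows "pi2_conj D k h (pi2_conj D h k c) = c"
proof -
  interpret H: category "Hor D" by (rule cat_Hor)
  interpret SH: category "SqH D" by (rule cat_SqH)
  note h = h[unfolded inverse_hor_def]
  have c: "c \<in> Mor (SqH D)" "Src (SqH D) c = Idn (Ver D) a" "Tgt (SqH D) c = Idn (Ver D) a"
    using c by (auto simp: pi2_def)
  let ?e = "Idn (SqV D) h" and ?e' = "Idn (SqV D) k"
  have a: "a \<in> Ob (Hor D)" using h H.src_in by auto
  have e: "?e \<in> Mor (SqH D)" "?e' \<in> Mor (SqH D)" "Src (SqH D) ?e = Idn (Ver D) a" "Tgt (SqH D) ?e = Idn (Ver D) b"
    "Src (SqH D) ?e' = Idn (Ver D) b" "Tgt (SqH D) ?e' = Idn (Ver D) a"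
    using h by (auto simp: idn_V_square src_idn_V tgt_idn_V)
  have e'e: "Cmp (SqH D) ?e' ?e = Idn (SqH D) (Idn (Ver D) a)"
    using idn_cmp_H[of k h] h idn_idn[OF a] by simp
  have "pi2_conj D k h (pi2_conj D h k c)
      = Cmp (SqH D) ?e' (Cmp (SqH D) (Cmp (SqH D) ?e (Cmp (SqH D) c ?e')) ?e)"
    by (simp add: pi2_conj_def)
  also have "\<dots> = Cmp (SqH D) ?e' (Cmp (SqH D) ?e (Cmp (SqH D) c (Cmp (SqH D) ?e' ?e)))"
    using e c by (simp add: SH.assoc SH.cmp_in SH.src_cmp SH.tgt_cmp)
  also have "\<dots> = Cmp (SqH D) ?e' (Cmp (SqH D) ?e c)"
    using SH.idn_right[OF c(1)] c(2) by (simp add: e'e)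
  also have "\<dots> = Cmp (SqH D) (Cmp (SqH D) ?e' ?e) c"
    using e c by (simp add: SH.assoc)
  also have "\<dots> = c" using SH.idn_left[OF c(1)] c(3) by (simp add: e'e)
  finally show ?thesis .
qed

lemma bij_betw_pi2_conj:
  assumes "inverse_hor D a b h k"
  shows "bij_betw (pi2_conj D h k) (carrier (pi2 D a)) (carrier (pi2 D b))"
proof -
  have "inverse_hor D b a k h" using assms by (auto simp: inverse_hor_def)
  then show ?thesis
    using assms pi2_conj_in pi2_conj_inverse
    by (intro bij_betw_byWitness[where f' = "pi2_conj D k h"]) auto
qed

end

lemma pi2_map_in:
  assumes F: "double_functor D E F" and "double_category D" and "a \<in> Ob (Hor D)"
    and c: "c \<in> carrier (pi2 D a)"
  shows "map_Sq F c \<in> carrier (pi2 E (map_Ob F a))"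
proof -
  have "a \<in> Ob (Ver D)" "c \<in> Mor (SqV D)"
    using assms double_category.Ob_Ver double_category.Mor_SqV by (auto simp: pi2_def)
  then show ?thesis
    using F c assms(3) by (simp add: pi2_def double_functor_def is_functor_def)
qed

lemma pi2_map_hom:
  assumes F: "double_functor D E F" and D: "double_category D" and a: "a \<in> Ob (Hor D)"
  shows "map_Sq F \<in> hom (pi2 D a) (pi2 E (map_Ob F a))"
proof (rule homI)
  fix c d assume "c \<in> carrier (pi2 D a)" "d \<in> carrier (pi2 D a)"
  then show "map_Sq F (c \<otimes>\<^bsub>pi2 D a\<^esub> d) = map_Sq F c \<otimes>\<^bsub>pi2 E (map_Ob F a)\<^esub> map_Sq F d"
    using F by (simp add: pi2_def double_functor_def is_functor_def)
qed (rule pi2_map_in[OF F D a])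

text \<open>Conjugation is bijective in both double groupoids and commutes with the functor, so it
  can be cancelled from the composite that ends at \<open>b\<close>.\<close>

lemma bij_betw_pi2_change_base:
  assumes F: "double_functor D E F" and D: "double_category D" and E: "double_category E"
    and h: "inverse_hor D a b h k"
    and bij: "bij_betw (map_Sq F) (carrier (pi2 D b)) (carrier (pi2 E (map_Ob F b)))"
  shows "bij_betw (map_Sq F) (carrier (pi2 D a)) (carrier (pi2 E (map_Ob F a)))"
proof -
  interpret D: double_category D by (rule D)
  interpret H: category "Hor D" by (rule D.cat_Hor)
  interpret SH: category "SqH D" by (rule D.cat_SqH)
  note h' = h[unfolded inverse_hor_def]
  have a: "a \<in> Ob (Hor D)" and b: "b \<in> Ob (Hor D)" using h' H.src_in H.tgt_in by auto
  have FH: "is_functor (Hor D) (Hor E) (map_Ob F) (map_Hor F)"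
    and FSH: "is_functor (SqH D) (SqH E) (map_Ver F) (map_Sq F)"
    and FSV: "is_functor (SqV D) (SqV E) (map_Hor F) (map_Sq F)"
    using F by (auto simp: double_functor_def)
  have Fh: "inverse_hor E (map_Ob F a) (map_Ob F b) (map_Hor F h) (map_Hor F k)"
    using FH h' a b unfolding is_functor_def inverse_hor_def by metis
  have natural: "map_Sq F (pi2_conj D h k c) = pi2_conj E (map_Hor F h) (map_Hor F k) (map_Sq F c)"
    if c: "c \<in> carrier (pi2 D a)" for c
  proof -
    have c: "c \<in> Mor (SqH D)" "Src (SqH D) c = Idn (Ver D) a" "Tgt (SqH D) c = Idn (Ver D) a"
      using c by (auto simp: pi2_def)
    have "map_Sq F (Idn (SqV D) h) = Idn (SqV E) (map_Hor F h)" "map_Sq F (Idn (SqV D) k) = Idn (SqV E) (map_Hor F k)"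
      using FSV h' D.Ob_SqV by (auto simp: is_functor_def)
    moreover have "map_Sq F (Cmp (SqH D) f g) = Cmp (SqH E) (map_Sq F f) (map_Sq F g)"
      if "f \<in> Mor (SqH D)" "g \<in> Mor (SqH D)" "Src (SqH D) f = Tgt (SqH D) g" for f g
      using FSH that by (simp add: is_functor_def)
    ultimately show ?thesis
      using c h' by (simp add: pi2_conj_def D.idn_V_square SH.cmp_in SH.tgt_cmp D.src_idn_V D.tgt_idn_V)
  qed
  have "bij_betw (map_Sq F \<circ> pi2_conj D h k) (carrier (pi2 D a)) (carrier (pi2 E (map_Ob F b)))"
    using D.bij_betw_pi2_conj[OF h] bij by (rule bij_betw_trans)
  then have "bij_betw (pi2_conj E (map_Hor F h) (map_Hor F k) \<circ> map_Sq F) (carrier (pi2 D a)) (carrier (pi2 E (map_Ob F b)))"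
    using natural by (simp cong: bij_betw_cong)
  then show ?thesis
    by (subst bij_betw_comp_iff2[OF double_category.bij_betw_pi2_conj[OF E Fh]]) (use pi2_map_in[OF F D a] in auto)
qed

theorem corollary4p3:
  fixes X :: "'a topology" and Y :: "'b topology" and f :: "'a \<Rightarrow> 'b"
  assumes "continuous_map X Y f"
  shows "weak_homotopy_2_equivalence X Y f \<longleftrightarrow>
    weak_equivalence (htpy_double_groupoid X) (htpy_double_groupoid Y) (htpy_double_functor Y f)"
proof -
  let ?D = "htpy_double_groupoid X" and ?E = "htpy_double_groupoid Y" and ?F = "htpy_double_functor Y f"
  note F = double_functor_Pi[OF assms]
  have D: "double_category ?D" and E: "double_category ?E"
    using double_groupoid_Pi by (auto simp: double_groupoid_def)
  \<comment> \<open>An isomorphism is a bijective homomorphism, and the homomorphism property is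
    known for both groups.\<close>
  have iso: "pi1_map ?E ?F a \<in> iso (pi1 ?D a) (pi1 ?E (path_image_map f a)) \<and>
      map_Sq ?F \<in> iso (pi2 ?D a) (pi2 ?E (path_image_map f a)) \<longleftrightarrow>
      pi1_bij X Y f a \<and> bij_betw (map_Sq ?F) (carrier (pi2 ?D a)) (carrier (pi2 ?E (path_image_map f a)))"
    if "a \<in> paths X" for a
    using that pi1_map_hom[OF assms that] bij_betw_pi1_iff[OF assms that] pi2_map_hom[OF F D, of a]
    by (simp add: iso_def)
  have const: "(pi1_bij X Y f (const_path x) \<and>
      bij_betw (map_Sq ?F) (carrier (pi2 ?D (const_path x))) (carrier (pi2 ?E (const_path (f x))))) \<longleftrightarrow>
      (\<forall>n\<in>{1, 2}. bij_betw (htpy_group_map n Y f x) (htpy_group n X x) (htpy_group n Y (f x)))"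
    if "x \<in> topspace X" for x
    using bij_betw_htpy_group_1_iff[OF assms that] bij_betw_htpy_group_2_iff[OF assms that] by simp
  \<comment> \<open>Only this passage from constant paths to arbitrary ones needs work; the converse
    is specialization, as constant paths are objects.\<close>
  have base: "pi1_bij X Y f a \<and> bij_betw (map_Sq ?F) (carrier (pi2 ?D a)) (carrier (pi2 ?E (path_image_map f a)))"
    if bij: "\<And>x. x \<in> topspace X \<Longrightarrow> pi1_bij X Y f (const_path x) \<and>
      bij_betw (map_Sq ?F) (carrier (pi2 ?D (const_path x))) (carrier (pi2 ?E (const_path (f x))))"
    and a: "a \<in> paths X" for a
  proof
    show "pi1_bij X Y f a"
      using pi1_bij_change_base[OF assms a] bij paths_in_topspace[OF a, of 0] by simp
    let ?k = "const_path (a 1)"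
    have x: "a 1 \<in> topspace X" using paths_in_topspace[OF a, of 1] by simp
    \<comment> \<open>The path \<open>a\<close> and the constant path at \<open>a 1\<close> have the
      same end, so they are joined by a horizontal morphism in each direction.\<close>
    have "inverse_hor ?D a ?k (a, ?k) (?k, a)"
      using a x by (simp add: inverse_hor_def)
    from bij_betw_pi2_change_base[OF F D E this] bij[OF x]
    show "bij_betw (map_Sq ?F) (carrier (pi2 ?D a)) (carrier (pi2 ?E (path_image_map f a)))" by simp
  qed
  have "(\<forall>a\<in>paths X. pi1_map ?E ?F a \<in> iso (pi1 ?D a) (pi1 ?E (path_image_map f a)) \<and>
      map_Sq ?F \<in> iso (pi2 ?D a) (pi2 ?E (path_image_map f a))) \<longleftrightarrow>
    (\<forall>x\<in>topspace X. \<forall>n\<in>{1, 2}. bij_betw (htpy_group_map n Y f x) (htpy_group n X x) (htpy_group n Y (f x)))"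
    (is "?L \<longleftrightarrow> ?R")
  proof
    assume L: ?L
    show ?R
    proof
      fix x assume x: "x \<in> topspace X"
      then show "\<forall>n\<in>{1, 2}. bij_betw (htpy_group_map n Y f x) (htpy_group n X x) (htpy_group n Y (f x))"
        using const[OF x] iso[OF const_path_in_paths[OF x]] bspec[OF L const_path_in_paths[OF x]]
        unfolding path_image_const_path by blast
    qed
  next
    assume ?R
    then show ?L using iso base const by blast
  qed
  then show ?thesis
    unfolding weak_homotopy_2_equivalence_def weak_equivalence_def
    using assms F double_groupoid_Pi[of X] double_groupoid_Pi[of Y]
      filling_condition_Pi[of X] filling_condition_Pi[of Y] bij_betw_pi0_iff[OF assms] by simp
qed

end
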